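(* For all integers $a\ge 6$ and $b\ge 3$ there exist constants $\delta>0$ and $k_0>0$ such that the following holds for all $n\in\mathbb{N}$ and all $k\ge k_0$. If $G$ is an $n$-vertex graph with $kn^{1+1/b}$ edges, then there exist an integer $2\le t\le b$ and a $G$-hypergraph $\mathcal{H}'_t$ with $|\mathcal{H}'_t|\ge b^{-1}\delta k^{ab}n^2$ which is $D'_t$-good, where for $\nu\subseteq V(\theta_{a,b})$ \[ D'_t(\nu):=\begin{cases} D_{\mathrm{forest}}(\nu) & \text{if }\nu\text{ induces a forest in }\theta_{a,b},\\ \min\{D_t(\nu),\,20(D_{0,t}(\nu)+\lceil\log n\rceil)\} & \text{otherwise,}\end{cases} \] and the functions $D_{\mathrm{forest}},D_t,D_{0,t}$ (defined in the context) are taken with these parameters $\delta,k,n$.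
   Context: The theta graph $\theta_{a,b}$ consists of two vertices $u,v$ together with $a$ internally disjoint paths $u\,w_1^j w_2^j\cdots w_{b-1}^j\,v$, $1\le j\le a$, each of length $b$. $v(\cdot)$ denotes number of vertices. $\mathbb{N}$ denotes the positive integers and $\log$ the natural logarithm. Given a graph $G$ and $\chi\subseteq V(\theta_{a,b})\times V(G)$, let $\chi_\theta=\{w:\exists z,(w,z)\in\chi\}$ and $\chi_G=\{z:\exists w,(w,z)\in\chi\}$. The set $\chi$ is valid if $|\chi|=|\chi_\theta|=|\chi_G|$ and whenever $(w,z),(w',z')\in\chi$ with $ww'\in E(\theta_{a,b})$ we have $zz'\in E(G)$. $\mathbb{V}$ is the set of valid sets. A $G$-hypergraph is a hypergraph $\mathcal{H}$ with vertex set $V(\theta_{a,b})\times V(G)$ all of whose hyperedges are valid sets of size $v(\theta_{a,b})$; $|\mathcal{H}|$ is its number of hyperedges and $\deg_{\mathcal{H}}(\chi)$ the number of hyperedges containing $\chi$. A codegree function is a function $D:2^{V(\theta_{a,b})}\to\mathbb{N}\cup\{\infty\}$; $\mathcal{H}$ is $D$-good if $\deg_{\mathcal{H}}(\chi)\le D(\chi_\theta)$ for all $\chi\in\mathbb{V}$. Let $\delta>0$ and $k>0$ be real and $n$ a positive integer. Define the following codegree functions. (1) If $\nu$ induces a forest with $e\ge1$ edges in $\theta_{a,b}$, then $D_{\mathrm{forest}}(\nu)=\left\lceil\dfrac{k^{ab}n^2}{\delta kn^{1+1/b}\,(\delta k^{b/(b-1)})^{e-1}}\right\rceil$; otherwise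 $D_{\mathrm{forest}}(\nu)=\infty$. (2) If $u,v\in\nu$, then $D_{0,b}(\nu)=\left\lceil\dfrac{k^{ab}n^2}{n^2\,\delta^{|\nu|}(k^{b})^{(|\nu|-2)/(b-1)}}\right\rceil$; otherwise $D_{0,b}(\nu)=\infty$. (3) For $2\le t<b$ let $F_t=\{w_i^j: t\le i<b,\ i-t\text{ even}\}$ and $f=|\nu\cap F_t|$. If $u,v\in\nu$, then $D_{0,t}(\nu)=\left\lceil\dfrac{k^{ab}n^2}{k^{(2b-2t+1)/(b-1)}n^{(2t-1)/b}\,\delta^{|\nu|}(kn^{1/b})^{f}(k^{b/(b-1)})^{|\nu|-f-2}}\right\rceil$; otherwise $D_{0,t}(\nu)=\infty$. (4) For $2\le t<b$ let $g=|\nu\cap F_t|$ if $b-t$ is even and $g=|\nu\cap F_t|-1$ if $b-t$ is odd. If $u,v\in\nu$ and $w_{b-1}^j\in\nu$ for some $j$, then $D_t(\nu)=\left\lceil\dfrac{k^{ab}n^2}{kn^{1+1/b}\,(kn^{1/b})^{g}(k^{b/(b-1)})^{|\nu|-g-3}\,\delta^{|\nu|}}\right\rceil$; otherwise $D_t(\nu)=\infty$. Also $D_b(\nu)=\infty$ for all $\nu$. *)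

theory Defs
  imports Complex_Main "HOL-Library.Extended_Nat"
begin

text \<open>A graph is given by its vertex set and its set of edges, an edge being a two-element set.\<close>

definition finite_simple_graph :: "'v set \<Rightarrow> 'v set set \<Rightarrow> bool" where
  "finite_simple_graph V E \<longleftrightarrow> finite V \<and> (\<forall>e\<in>E. e \<subseteq> V \<and> card e = 2)"

definition cycle_in :: "'v set set \<Rightarrow> 'v list \<Rightarrow> bool" where
  "cycle_in E xs \<longleftrightarrow> length xs \<ge> 3 \<and> distinct xs \<and>
     (\<forall>i<length xs. {xs ! i, xs ! ((i + 1) mod length xs)} \<in> E)"

definition forest :: "'v set set \<Rightarrow> bool" where
  "forest E \<longleftrightarrow> \<not> (\<exists>xs. cycle_in E xs)"

definition induced_edges :: "'v set set \<Rightarrow> 'v set \<Rightarrow> 'v set set" where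
  "induced_edges E \<nu> = {e \<in> E. e \<subseteq> \<nu>}"

text \<open>\<open>W i j\<close> is the vertex \<open>w\<^sub>i\<^sup>j\<close>: position \<open>i\<close> (counted from \<open>u\<close>) on the \<open>j\<close>-th path.\<close>

datatype theta_vertex = U_end | V_end | W nat nat

definition theta_verts :: "nat \<Rightarrow> nat \<Rightarrow> theta_vertex set" where
  "theta_verts a b = {U_end, V_end} \<union> {W i j | i j. 1 \<le> i \<and> i < b \<and> 1 \<le> j \<and> j \<le> a}"

definition path_vertex :: "nat \<Rightarrow> nat \<Rightarrow> nat \<Rightarrow> theta_vertex" where
  "path_vertex b i j = (if i = 0 then U_end else if i = b then V_end else W i j)"

definition theta_edges :: "nat \<Rightarrow> nat \<Rightarrow> theta_vertex set set" where
  "theta_edges a b =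
     {{path_vertex b i j, path_vertex b (i + 1) j} | i j. i < b \<and> 1 \<le> j \<and> j \<le> a}"

text \<open>For a set \<open>\<chi>\<close> of pairs, \<open>\<chi>\<^sub>\<theta>\<close> is \<open>fst ` \<chi>\<close> and \<open>\<chi>\<^sub>G\<close> is \<open>snd ` \<chi>\<close>.\<close>

definition valid_set ::
  "nat \<Rightarrow> nat \<Rightarrow> 'v set \<Rightarrow> 'v set set \<Rightarrow> (theta_vertex \<times> 'v) set \<Rightarrow> bool" where
  "valid_set a b V E \<chi> \<longleftrightarrow>
     \<chi> \<subseteq> theta_verts a b \<times> V \<and>
     card \<chi> = card (fst ` \<chi>) \<and> card \<chi> = card (snd ` \<chi>) \<and>
     (\<forall>w z w' z'. (w, z) \<in> \<chi> \<and> (w', z') \<in> \<chi> \<and> {w, w'} \<in> theta_edges a b \<longrightarrow> {z, z'} \<in> E)"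

text \<open>A hypergraph is identified with its set of hyperedges.\<close>

definition G_hypergraph ::
  "nat \<Rightarrow> nat \<Rightarrow> 'v set \<Rightarrow> 'v set set \<Rightarrow> (theta_vertex \<times> 'v) set set \<Rightarrow> bool" where
  "G_hypergraph a b V E H \<longleftrightarrow>
     (\<forall>h\<in>H. valid_set a b V E h \<and> card h = card (theta_verts a b))"

definition hdeg :: "'x set set \<Rightarrow> 'x set \<Rightarrow> nat" where
  "hdeg H \<chi> = card {h \<in> H. \<chi> \<subseteq> h}"

text \<open>Codegree functions are only ever evaluated at subsets of \<open>theta_verts a b\<close>.\<close>

type_synonym codegree = "theta_vertex set \<Rightarrow> enat"

definition good ::
  "nat \<Rightarrow> nat \<Rightarrow> 'v set \<Rightarrow> 'v set set \<Rightarrow> codegree \<Rightarrow> (theta_vertex \<times> 'v) set set \<Rightarrow> bool" where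
  "good a b V E D H \<longleftrightarrow> (\<forall>\<chi>. valid_set a b V E \<chi> \<longrightarrow> enat (hdeg H \<chi>) \<le> D (fst ` \<chi>))"

definition ceil_enat :: "real \<Rightarrow> enat" where
  "ceil_enat x = enat (nat \<lceil>x\<rceil>)"

definition D_forest :: "nat \<Rightarrow> nat \<Rightarrow> real \<Rightarrow> real \<Rightarrow> nat \<Rightarrow> codegree" where
  "D_forest a b \<delta> k n \<nu> =
     (let I = induced_edges (theta_edges a b) \<nu>; e = card I in
      if forest I \<and> e \<ge> 1
      then ceil_enat (k ^ (a * b) * real n ^ 2 /
             (\<delta> * k * real n powr (1 + 1 / real b) *
              (\<delta> * k powr (real b / (real b - 1))) ^ (e - 1)))
      else \<infinity>)"

definition F_set :: "nat \<Rightarrow> nat \<Rightarrow> nat \<Rightarrow> theta_vertex set" where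
  "F_set a b t = {W i j | i j. t \<le> i \<and> i < b \<and> even (i - t) \<and> 1 \<le> j \<and> j \<le> a}"

text \<open>
  The exponents below involving \<open>card \<nu>\<close> are computed in the reals to avoid truncated
  subtraction; all bases are positive when \<open>\<delta>, k > 0\<close> and \<open>n \<ge> 1\<close>.
\<close>

definition D_0b :: "nat \<Rightarrow> nat \<Rightarrow> real \<Rightarrow> real \<Rightarrow> nat \<Rightarrow> codegree" where
  "D_0b a b \<delta> k n \<nu> =
     (if U_end \<in> \<nu> \<and> V_end \<in> \<nu>
      then ceil_enat (k ^ (a * b) * real n ^ 2 /
             (real n ^ 2 * \<delta> ^ card \<nu> *
              (k ^ b) powr ((real (card \<nu>) - 2) / (real b - 1))))
      else \<infinity>)"

definition D_0 :: "nat \<Rightarrow> nat \<Rightarrow> real \<Rightarrow> real \<Rightarrow> nat \<Rightarrow> nat \<Rightarrow> codegree" where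
  "D_0 a b \<delta> k n t \<nu> =
     (if t = b then D_0b a b \<delta> k n \<nu>
      else if U_end \<in> \<nu> \<and> V_end \<in> \<nu>
      then (let f = card (\<nu> \<inter> F_set a b t) in
        ceil_enat (k ^ (a * b) * real n ^ 2 /
          (k powr ((2 * real b - 2 * real t + 1) / (real b - 1)) *
           real n powr ((2 * real t - 1) / real b) *
           \<delta> ^ card \<nu> *
           (k * real n powr (1 / real b)) ^ f *
           (k powr (real b / (real b - 1))) powr (real (card \<nu>) - real f - 2))))
      else \<infinity>)"

definition D_t :: "nat \<Rightarrow> nat \<Rightarrow> real \<Rightarrow> real \<Rightarrow> nat \<Rightarrow> nat \<Rightarrow> codegree" where
  "D_t a b \<delta> k n t \<nu> =
     (if t < b \<and> U_end \<in> \<nu> \<and> V_end \<in> \<nu> \<and> (\<exists>j. 1 \<le> j \<and> j \<le> a \<and> W (b - 1) j \<in> \<nu>)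
      then (let f = real (card (\<nu> \<inter> F_set a b t));
                g = (if even (b - t) then f else f - 1) in
        ceil_enat (k ^ (a * b) * real n ^ 2 /
          (k * real n powr (1 + 1 / real b) *
           (k * real n powr (1 / real b)) powr g *
           (k powr (real b / (real b - 1))) powr (real (card \<nu>) - g - 3) *
           \<delta> ^ card \<nu>)))
      else \<infinity>)"

definition D' :: "nat \<Rightarrow> nat \<Rightarrow> real \<Rightarrow> real \<Rightarrow> nat \<Rightarrow> nat \<Rightarrow> codegree" where
  "D' a b \<delta> k n t \<nu> =
     (if forest (induced_edges (theta_edges a b) \<nu>)
      then D_forest a b \<delta> k n \<nu>
      else min (D_t a b \<delta> k n t \<nu>) (20 * (D_0 a b \<delta> k n t \<nu> + ceil_enat (ln (real n)))))"

end

theory Submission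
  imports Defs "HOL-Library.FuncSet" "HOL-Analysis.Convex"
begin

text \<open>
  It suffices to find a probability distribution on copies of \<open>\<theta>\<^sub>a\<^sub>,\<^sub>b\<close> in \<open>G\<close> that contains any fixed \<open>\<chi>\<close>
  with probability \<open>O(D(\<chi>\<^sub>\<theta>) / (k\<^sup>a\<^sup>b n\<^sup>2))\<close>, the constant not depending on \<open>\<delta>\<close>: then a maximal \<open>D\<close>-good
  hypergraph is large, because its saturated sets meet only a small part of the distribution.

  Pass to a subgraph of large minimum degree, and write \<open>\<kappa> = k powr (b / (b - 1))\<close> and \<open>\<kappa>\<rho> = k * n powr (1 / b)\<close>, so that
  \<open>n = \<kappa>\<rho>\<^sup>b\<close>. The stationary random walk spreads over about \<open>\<kappa>\<rho>\<^sup>g\<close> vertices in \<open>g\<close> steps, until a first time \<open>t \<le> b\<close>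
  at which, with probability bounded below, its conditional distribution given the start is concentrated
  (at time \<open>b\<close> this is forced since there are only \<open>n\<close> vertices). The walk is then continued by moving back and
  forth between the levels \<open>t - 1\<close> and \<open>t\<close>; forward steps have probability \<open>O(1/(\<kappa>\<rho>))\<close>, and by concentration backward
  steps have probability \<open>O(1/\<kappa>)\<close>. Conditioned on both ends, such a path of length \<open>b\<close> passes
  through prescribed inner vertices with the product of these probabilities, and the theta graph consists of \<open>a\<close> conditionally
  independent paths with the same ends.
\<close>

section \<open>Greedy choice of a hypergraph\<close>

text \<open>Conditioning a path on both ends divides by its end mass \<open>pz u v\<close>, which
  has no useful lower bound. None is needed: this mass is also the weight with which the walk from
  \<open>u\<close> is at \<open>v\<close> at time \<open>b\<close>, so transition bounds for the
  time-reversed walk give estimates proportional to \<open>pz u v\<close> itself. After time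
  \<open>t\<close> the reversal is possible because, for fixed \<open>u\<close>, the zigzag is
  reversible; before \<open>t\<close> it rests on comparing \<open>Pn\<close> with its threshold. In
  a forest, one edge is paid by the stationary flow \<open>1 / M\<close>, of order
  \<open>1 / (\<kappa> * \<rho> * n)\<close>, and every further edge by a factor of order
  \<open>1 / \<kappa>\<close>. A set inducing a cycle contains a whole path, which is paid step by
  step; all other paths are paid conditionally on its ends. The resulting denominator is
  \<open>\<kappa>\<close> to the number of vertices times \<open>\<rho>\<close> to the power
  \<open>b + t + f\<close>, less 1 if \<open>b - t\<close> is odd. For every \<open>t\<close> from 2
  to \<open>b\<close> these exponents are at least those in \<open>D_0\<close> and in
  \<open>D_t\<close>, so one estimate serves both members of the minimum.\<close>

lemma finite_maximal_subset:
  assumes "finite X" and "P {}"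
  obtains H where "H \<subseteq> X" "P H" "\<And>x. x \<in> X - H \<Longrightarrow> \<not> P (insert x H)"
proof -
  let ?F = "{H. H \<subseteq> X \<and> P H}"
  have "finite ?F" using assms by auto
  moreover have "{} \<in> ?F" using assms by auto
  ultimately obtain H where H: "H \<in> ?F" "\<And>H'. H' \<in> ?F \<Longrightarrow> H \<subseteq> H' \<Longrightarrow> H = H'"
    using finite_has_maximal[of ?F] by auto
  show ?thesis
  proof
    show "H \<subseteq> X" "P H" using H by auto
    fix x assume x: "x \<in> X - H"
    show "\<not> P (insert x H)" using H(2)[of "insert x H"] x H(1) by auto
  qed
qed

lemma sum_Un_le:
  fixes m :: "'i \<Rightarrow> real"
  assumes "finite A" "finite B" "\<And>i. i \<in> A \<union> B \<Longrightarrow> 0 \<le> m i"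
  shows "sum m (A \<union> B) \<le> sum m A + sum m B"
  using sum_Un[OF assms(1,2), of m] sum_nonneg[of "A \<inter> B" m] assms(3) by force

lemma sum_UN_le:
  fixes m :: "'i \<Rightarrow> real"
  assumes "finite X" "\<And>x. x \<in> X \<Longrightarrow> finite (f x)" "\<And>x i. x \<in> X \<Longrightarrow> i \<in> f x \<Longrightarrow> 0 \<le> m i"
  shows "sum m (\<Union>x\<in>X. f x) \<le> (\<Sum>x\<in>X. sum m (f x))"
  using assms
proof (induction X rule: finite_induct)
  case (insert x X)
  have "finite (f x)" "finite (\<Union>x\<in>X. f x)" using insert by auto
  then have "sum m (f x \<union> (\<Union>x\<in>X. f x)) \<le> sum m (f x) + sum m (\<Union>x\<in>X. f x)"
    using insert.prems by (intro sum_Un_le) auto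
  moreover have "sum m (\<Union>x\<in>X. f x) \<le> (\<Sum>x\<in>X. sum m (f x))" using insert by (intro insert.IH) auto
  ultimately show ?case using insert.hyps by simp
qed simp

lemma finite_theta_verts: "finite (theta_verts a b)"
proof -
  have "theta_verts a b \<subseteq> {U_end, V_end} \<union> (\<lambda>(i,j). W i j) ` ({..b} \<times> {..a})"
    unfolding theta_verts_def by auto
  then show ?thesis by (rule finite_subset) auto
qed

lemma valid_set_finite: "valid_set a b V E \<chi> \<Longrightarrow> finite V \<Longrightarrow> finite \<chi>"
  unfolding valid_set_def using finite_theta_verts finite_subset by blast

lemma valid_set_inj_fst:
  assumes "valid_set a b V E h" "finite V"
  shows "inj_on fst h"
  using assms valid_set_finite[OF assms] unfolding valid_set_def by (intro eq_card_imp_inj_on) auto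

text \<open>\<open>h\<close> is the graph of a function of the theta vertex, so a subset is
  determined by its type. This makes the families of hyperedges containing different saturated sets
  of one type disjoint.\<close>

lemma subset_eq_restrict:
  assumes "inj_on fst h" "\<chi> \<subseteq> h"
  shows "\<chi> = {x \<in> h. fst x \<in> fst ` \<chi>}"
  using assms unfolding inj_on_def by blast

lemma valid_set_subset:
  assumes h: "valid_set a b V E h" and V: "finite V" and sub: "\<chi> \<subseteq> h"
  shows "valid_set a b V E \<chi>"
proof -
  have "inj_on snd h"
    using h valid_set_finite[OF h V] unfolding valid_set_def by (intro eq_card_imp_inj_on) auto
  then have "card (snd ` \<chi>) = card \<chi>" "card (fst ` \<chi>) = card \<chi>"
    using valid_set_inj_fst[OF h V] sub card_image inj_on_subset by metis+
  moreover have "\<chi> \<subseteq> theta_verts a b \<times> V" using h sub unfolding valid_set_def by blast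
  moreover have "\<forall>w z w' z'. (w, z) \<in> \<chi> \<and> (w', z') \<in> \<chi> \<and> {w, w'} \<in> theta_edges a b \<longrightarrow> {z, z'} \<in> E"
    using h sub unfolding valid_set_def by (meson subsetD)
  ultimately show ?thesis unfolding valid_set_def by simp
qed

text \<open>A hyperedge contains exactly one set of each type \<open>\<nu>\<close>, so few sets are saturated.\<close>

lemma greedy_good_hypergraph:
  fixes h :: "'i \<Rightarrow> (theta_vertex \<times> 'v) set" and m :: "'i \<Rightarrow> real" and D :: codegree
  assumes I: "finite I" and m0: "\<And>i. i \<in> I \<Longrightarrow> 0 \<le> m i" and V: "finite V" and B: "0 \<le> B"
    and valid: "\<And>i. i \<in> I \<Longrightarrow> valid_set a b V E (h i) \<and> card (h i) = card (theta_verts a b)"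
    and full: "\<And>i. i \<in> I \<Longrightarrow> (\<Sum>i'\<in>{i'\<in>I. h i \<subseteq> h i'}. m i') \<le> B"
    and spread: "\<And>\<chi> q. valid_set a b V E \<chi> \<Longrightarrow> D (fst ` \<chi>) = enat q \<Longrightarrow>
       q \<ge> 1 \<and> (\<Sum>i\<in>{i\<in>I. \<chi> \<subseteq> h i}. m i) \<le> B * real q"
  obtains H where "G_hypergraph a b V E H" "good a b V E D H"
    "(\<Sum>i\<in>I. m i) \<le> real (card H) * B * (2 ^ card (theta_verts a b) + 1)"
proof -
  let ?T = "theta_verts a b"
  have fin: "finite (h ` I)" using I by auto
  have g0: "good a b V E D {}" unfolding good_def hdeg_def by (auto simp: zero_enat_def[symmetric])
  obtain H where HX: "H \<subseteq> h ` I" and HG: "good a b V E D H"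
    and Hmax: "\<And>x. x \<in> h ` I - H \<Longrightarrow> \<not> good a b V E D (insert x H)"
    using finite_maximal_subset[OF fin, of "good a b V E D"] g0 by blast
  have finH: "finite H" using HX fin finite_subset by auto
  have validH: "valid_set a b V E x \<and> card x = card ?T" if "x \<in> H" for x using that HX valid by auto
  \<comment> \<open>The sets that can block the insertion of a further hyperedge.\<close>
  define sat where "sat \<nu> = {\<chi>. \<exists>x\<in>h ` I. \<chi> \<subseteq> x \<and> fst ` \<chi> = \<nu> \<and> D \<nu> \<noteq> \<infinity> \<and> D \<nu> \<le> enat (hdeg H \<chi>)}" for \<nu>
  have sat_fin: "finite (sat \<nu>)" for \<nu>
  proof -
    have "sat \<nu> \<subseteq> \<Union> (Pow ` (h ` I))" unfolding sat_def by auto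
    moreover have "finite (\<Union> (Pow ` (h ` I)))" using fin valid valid_set_finite[OF _ V] by blast
    ultimately show ?thesis by (rule finite_subset)
  qed
  have cover: "I \<subseteq> {i\<in>I. h i \<in> H} \<union> (\<Union>\<nu>\<in>Pow ?T. \<Union>\<chi>\<in>sat \<nu>. {i\<in>I. \<chi> \<subseteq> h i})"
  proof
    fix i assume i: "i \<in> I"
    show "i \<in> {i\<in>I. h i \<in> H} \<union> (\<Union>\<nu>\<in>Pow ?T. \<Union>\<chi>\<in>sat \<nu>. {i\<in>I. \<chi> \<subseteq> h i})"
    proof (cases "h i \<in> H")
      case False
      then have "\<not> good a b V E D (insert (h i) H)" using Hmax i by auto
      then obtain \<chi> where \<chi>: "valid_set a b V E \<chi>" "\<not> enat (hdeg (insert (h i) H) \<chi>) \<le> D (fst ` \<chi>)"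
        unfolding good_def by auto
      \<comment> \<open>The bound holds for \<open>H\<close> and fails after one insertion, so
        \<open>\<chi>\<close> lies in the inserted hyperedge and its old degree was already equal to
        the bound.\<close>
      have old: "enat (hdeg H \<chi>) \<le> D (fst ` \<chi>)" using HG \<chi> unfolding good_def by auto
      have sub: "\<chi> \<subseteq> h i"
      proof (rule ccontr)
        assume "\<not> \<chi> \<subseteq> h i"
        then have "{x \<in> insert (h i) H. \<chi> \<subseteq> x} = {x \<in> H. \<chi> \<subseteq> x}" by auto
        then show False using \<chi> old unfolding hdeg_def by simp
      qed
      then have "{x \<in> insert (h i) H. \<chi> \<subseteq> x} = insert (h i) {x \<in> H. \<chi> \<subseteq> x}" by auto
      then have deg: "hdeg (insert (h i) H) \<chi> = Suc (hdeg H \<chi>)"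
        using False finH unfolding hdeg_def by (simp add: card_insert_if)
      obtain q where q: "D (fst ` \<chi>) = enat q" using \<chi>(2) by (cases "D (fst ` \<chi>)") auto
      have "q \<le> hdeg H \<chi>" using \<chi>(2) deg q by auto
      then have "\<chi> \<in> sat (fst ` \<chi>)" unfolding sat_def using i sub q by auto
      moreover have "fst ` \<chi> \<in> Pow ?T" using \<chi>(1) unfolding valid_set_def by auto
      ultimately show ?thesis using i sub by blast
    qed (use i in auto)
  qed
  have satbound: "(\<Sum>\<chi>\<in>sat \<nu>. \<Sum>i\<in>{i\<in>I. \<chi> \<subseteq> h i}. m i) \<le> real (card H) * B" for \<nu>
  proof (cases "sat \<nu> = {}")
    case True then show ?thesis using B by auto
  next
    case False
    then obtain q where q: "D \<nu> = enat q" unfolding sat_def by auto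
    have validS: "valid_set a b V E \<chi>" "fst ` \<chi> = \<nu>" "q \<le> hdeg H \<chi>" if "\<chi> \<in> sat \<nu>" for \<chi>
      using that valid valid_set_subset[OF _ V] q unfolding sat_def by fastforce+
    have q1: "q \<ge> 1" using spread[of _ q] validS q False by (metis ex_in_conv)
    have "(\<Sum>\<chi>\<in>sat \<nu>. \<Sum>i\<in>{i\<in>I. \<chi> \<subseteq> h i}. m i) \<le> (\<Sum>\<chi>\<in>sat \<nu>. B * real q)"
      using spread validS q by (intro sum_mono) auto
    \<comment> \<open>Saturation replaces the bound \<open>q\<close> by a degree in
      \<open>H\<close>, so that the lost mass is charged to hyperedges of \<open>H\<close>.\<close>
    also have "\<dots> \<le> B * (\<Sum>\<chi>\<in>sat \<nu>. real (hdeg H \<chi>))"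
      unfolding sum_distrib_left using validS B by (intro sum_mono mult_left_mono) auto
    also have "(\<Sum>\<chi>\<in>sat \<nu>. real (hdeg H \<chi>)) = real (\<Sum>\<chi>\<in>sat \<nu>. card {x \<in> H. \<chi> \<subseteq> x})"
      unfolding hdeg_def by simp
    also have "(\<Sum>\<chi>\<in>sat \<nu>. card {x \<in> H. \<chi> \<subseteq> x}) = card (\<Union>\<chi>\<in>sat \<nu>. {x \<in> H. \<chi> \<subseteq> x})"
    proof (rule card_UN_disjoint[symmetric, OF sat_fin])
      show "\<forall>\<chi>\<in>sat \<nu>. \<forall>\<chi>'\<in>sat \<nu>. \<chi> \<noteq> \<chi>' \<longrightarrow> {x \<in> H. \<chi> \<subseteq> x} \<inter> {x \<in> H. \<chi>' \<subseteq> x} = {}"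
      proof (intro ballI impI equals0I)
        fix \<chi> \<chi>' x assume a: "\<chi> \<in> sat \<nu>" "\<chi>' \<in> sat \<nu>" "\<chi> \<noteq> \<chi>'" "x \<in> {x \<in> H. \<chi> \<subseteq> x} \<inter> {x \<in> H. \<chi>' \<subseteq> x}"
        then have "inj_on fst x" using validH valid_set_inj_fst[OF _ V] by blast
        then have "\<chi> = \<chi>'" using subset_eq_restrict[of x \<chi>] subset_eq_restrict[of x \<chi>'] a validS(2) by auto
        then show False using a by auto
      qed
    qed (use finH in auto)
    also have "\<dots> \<le> card H" by (rule card_mono[OF finH]) auto
    finally show ?thesis using B by (simp add: mult.commute mult_left_mono)
  qed
  have Hbound: "(\<Sum>i\<in>{i\<in>I. h i \<in> H}. m i) \<le> real (card H) * B"
  proof -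
    \<comment> \<open>Several indices may yield the same hyperedge; \<open>full\<close> bounds the
      mass of each such fibre.\<close>
    have "(\<Sum>i\<in>{i\<in>I. h i \<in> H}. m i) = (\<Sum>x\<in>H. \<Sum>i\<in>{i\<in>{i\<in>I. h i \<in> H}. h i = x}. m i)"
      by (rule sum.group[symmetric]) (use I finH in auto)
    also have "\<dots> \<le> (\<Sum>x\<in>H. B)"
    proof (rule sum_mono)
      fix x assume "x \<in> H"
      then obtain i where i: "i \<in> I" "x = h i" using HX by auto
      have "(\<Sum>i\<in>{i\<in>{i\<in>I. h i \<in> H}. h i = x}. m i) \<le> (\<Sum>i'\<in>{i'\<in>I. h i \<subseteq> h i'}. m i')"
        using I m0 i by (intro sum_mono2) auto
      also have "\<dots> \<le> B" using full i by auto
      finally show "(\<Sum>i\<in>{i\<in>{i\<in>I. h i \<in> H}. h i = x}. m i) \<le> B" .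
    qed
    finally show ?thesis by simp
  qed
  have UN: "sum m (\<Union>x\<in>X. f x) \<le> (\<Sum>x\<in>X. sum m (f x))" if "finite X" "\<And>x. x \<in> X \<Longrightarrow> f x \<subseteq> I" for X :: "'x set" and f
    by (rule sum_UN_le) (use that m0 in \<open>auto intro: finite_subset[OF _ I]\<close>)
  have "sum m I \<le> sum m ({i\<in>I. h i \<in> H} \<union> (\<Union>\<nu>\<in>Pow ?T. \<Union>\<chi>\<in>sat \<nu>. {i\<in>I. \<chi> \<subseteq> h i}))"
    by (rule sum_mono2[OF _ cover]) (use I m0 in \<open>auto simp: finite_theta_verts sat_fin\<close>)
  also have "\<dots> \<le> sum m {i\<in>I. h i \<in> H} + sum m (\<Union>\<nu>\<in>Pow ?T. \<Union>\<chi>\<in>sat \<nu>. {i\<in>I. \<chi> \<subseteq> h i})"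
    using m0 by (intro sum_Un_le) (auto intro: finite_subset[OF _ I])
  also have "sum m (\<Union>\<nu>\<in>Pow ?T. \<Union>\<chi>\<in>sat \<nu>. {i\<in>I. \<chi> \<subseteq> h i}) \<le> (\<Sum>\<nu>\<in>Pow ?T. sum m (\<Union>\<chi>\<in>sat \<nu>. {i\<in>I. \<chi> \<subseteq> h i}))"
    by (rule UN) (auto simp: finite_theta_verts)
  also have "\<dots> \<le> (\<Sum>\<nu>\<in>Pow ?T. real (card H) * B)"
  proof (rule sum_mono)
    fix \<nu>
    have "sum m (\<Union>\<chi>\<in>sat \<nu>. {i\<in>I. \<chi> \<subseteq> h i}) \<le> (\<Sum>\<chi>\<in>sat \<nu>. \<Sum>i\<in>{i\<in>I. \<chi> \<subseteq> h i}. m i)"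
      by (rule UN) (auto simp: sat_fin)
    then show "sum m (\<Union>\<chi>\<in>sat \<nu>. {i\<in>I. \<chi> \<subseteq> h i}) \<le> real (card H) * B"
      using satbound[of \<nu>] by linarith
  qed
  also have "\<dots> = real (card H) * B * 2 ^ card ?T"
    by (simp add: card_Pow finite_theta_verts)
  finally have tot: "sum m I \<le> real (card H) * B * (2 ^ card ?T + 1)"
    using Hbound by (simp add: algebra_simps)
  show ?thesis
    by (rule that[OF _ HG tot]) (use validH in \<open>auto simp: G_hypergraph_def\<close>)
qed

section \<open>Passing to dense substructures\<close>

lemma obtain_maximiser:
  fixes F :: "'x \<Rightarrow> real"
  assumes "finite X" "X \<noteq> {}"
  obtains x where "x \<in> X" "\<And>y. y \<in> X \<Longrightarrow> F y \<le> F x"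
proof -
  have "Max (F ` X) \<in> F ` X" using assms by (intro Max_in) auto
  then obtain x where "x \<in> X" "F x = Max (F ` X)" by auto
  then show ?thesis using that[of x] assms by simp
qed

text \<open>Take a pair of sets maximising retained mass minus the charges \<open>A\<close> and
  \<open>B\<close>. Deleting one point cannot raise this difference, so the mass through the point
  is at least its charge; comparison with the full pair bounds the total loss. One maximisation thus
  replaces an iterated deletion on two sides.\<close>

lemma bipartite_cleaning:
  fixes g :: "'i \<Rightarrow> real" and A :: "'x \<Rightarrow> real" and B :: "'y \<Rightarrow> real"
  assumes fin: "finite G" "finite X" "finite Y"
    and im: "\<And>i. i \<in> G \<Longrightarrow> \<alpha> i \<in> X" "\<And>i. i \<in> G \<Longrightarrow> \<beta> i \<in> Y"
    and pos: "\<And>x. x \<in> X \<Longrightarrow> A x \<ge> 0" "\<And>y. y \<in> Y \<Longrightarrow> B y \<ge> 0"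
  obtains X' Y' where "X' \<subseteq> X" "Y' \<subseteq> Y"
    "(\<Sum>i\<in>{i\<in>G. \<alpha> i \<in> X' \<and> \<beta> i \<in> Y'}. g i) \<ge> sum g G - sum A X - sum B Y"
    "\<And>x. x \<in> X' \<Longrightarrow> A x \<le> (\<Sum>i\<in>{i\<in>G. \<alpha> i \<in> X' \<and> \<beta> i \<in> Y' \<and> \<alpha> i = x}. g i)"
    "\<And>y. y \<in> Y' \<Longrightarrow> B y \<le> (\<Sum>i\<in>{i\<in>G. \<alpha> i \<in> X' \<and> \<beta> i \<in> Y' \<and> \<beta> i = y}. g i)"
proof -
  define F where "F = (\<lambda>(X',Y'). (\<Sum>i\<in>{i\<in>G. \<alpha> i \<in> X' \<and> \<beta> i \<in> Y'}. g i) - sum A X' - sum B Y')"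
  let ?P = "Pow X \<times> Pow Y"
  have "finite ?P" "?P \<noteq> {}" using fin by auto
  then obtain Z where Z: "Z \<in> ?P" "\<And>Z'. Z' \<in> ?P \<Longrightarrow> F Z' \<le> F Z"
    using obtain_maximiser[of ?P F] by blast
  obtain X' Y' where ZZ: "Z = (X',Y')" by (cases Z)
  have XY: "X' \<subseteq> X" "Y' \<subseteq> Y" using Z ZZ by auto
  have finXY: "finite X'" "finite Y'" using XY fin finite_subset by auto
  show ?thesis
  proof
    show "X' \<subseteq> X" "Y' \<subseteq> Y" by fact+
    have "{i\<in>G. \<alpha> i \<in> X \<and> \<beta> i \<in> Y} = G" using im by auto
    moreover have "sum A X' \<ge> 0" "sum B Y' \<ge> 0" using pos XY by (auto intro!: sum_nonneg)
    ultimately show "(\<Sum>i\<in>{i\<in>G. \<alpha> i \<in> X' \<and> \<beta> i \<in> Y'}. g i) \<ge> sum g G - sum A X - sum B Y"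
      using Z(2)[of "(X,Y)"] ZZ unfolding F_def by auto
  next
    fix x assume x: "x \<in> X'"
    have "{i\<in>G. \<alpha> i \<in> X' \<and> \<beta> i \<in> Y'} =
      {i\<in>G. \<alpha> i \<in> X' - {x} \<and> \<beta> i \<in> Y'} \<union> {i\<in>G. \<alpha> i \<in> X' \<and> \<beta> i \<in> Y' \<and> \<alpha> i = x}" using x by auto
    then have "(\<Sum>i\<in>{i\<in>G. \<alpha> i \<in> X' \<and> \<beta> i \<in> Y'}. g i) =
      (\<Sum>i\<in>{i\<in>G. \<alpha> i \<in> X' - {x} \<and> \<beta> i \<in> Y'}. g i) + (\<Sum>i\<in>{i\<in>G. \<alpha> i \<in> X' \<and> \<beta> i \<in> Y' \<and> \<alpha> i = x}. g i)"
      using fin by (subst sum.union_disjoint[symmetric]) (auto intro!: sum.cong)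
    moreover have "F (X' - {x}, Y') \<le> F (X', Y')"
      using Z(2)[of "(X' - {x}, Y')"] XY ZZ by blast
    ultimately show "A x \<le> (\<Sum>i\<in>{i\<in>G. \<alpha> i \<in> X' \<and> \<beta> i \<in> Y' \<and> \<alpha> i = x}. g i)"
      using x finXY unfolding F_def by (simp add: sum.remove)
  next
    fix y assume y: "y \<in> Y'"
    have "{i\<in>G. \<alpha> i \<in> X' \<and> \<beta> i \<in> Y'} =
      {i\<in>G. \<alpha> i \<in> X' \<and> \<beta> i \<in> Y' - {y}} \<union> {i\<in>G. \<alpha> i \<in> X' \<and> \<beta> i \<in> Y' \<and> \<beta> i = y}" using y by auto
    then have "(\<Sum>i\<in>{i\<in>G. \<alpha> i \<in> X' \<and> \<beta> i \<in> Y'}. g i) =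
      (\<Sum>i\<in>{i\<in>G. \<alpha> i \<in> X' \<and> \<beta> i \<in> Y' - {y}}. g i) + (\<Sum>i\<in>{i\<in>G. \<alpha> i \<in> X' \<and> \<beta> i \<in> Y' \<and> \<beta> i = y}. g i)"
      using fin by (subst sum.union_disjoint[symmetric]) (auto intro!: sum.cong)
    moreover have "F (X', Y' - {y}) \<le> F (X', Y')"
      using Z(2)[of "(X', Y' - {y})"] XY ZZ by blast
    ultimately show "B y \<le> (\<Sum>i\<in>{i\<in>G. \<alpha> i \<in> X' \<and> \<beta> i \<in> Y' \<and> \<beta> i = y}. g i)"
      using y finXY unfolding F_def by (simp add: sum.remove)
  qed
qed

definition nbrs :: "'v set \<Rightarrow> 'v set set \<Rightarrow> 'v \<Rightarrow> 'v set" where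
  "nbrs V E x = {y \<in> V. {x, y} \<in> E}"

text \<open>The same potential argument, with edges minus \<open>c\<close> times vertices: deleting
  a vertex of degree below \<open>c\<close> would increase it.\<close>

lemma min_degree_subgraph:
  assumes G: "finite_simple_graph V E" and c: "c \<ge> 0"
  obtains V' where "V' \<subseteq> V" "real (card E) - c * real (card V) \<le> real (card (induced_edges E V'))"
    "\<And>x. x \<in> V' \<Longrightarrow> c \<le> real (card (nbrs V' (induced_edges E V') x))"
proof -
  have finV: "finite V" and E: "\<And>e. e \<in> E \<Longrightarrow> e \<subseteq> V \<and> card e = 2"
    using G unfolding finite_simple_graph_def by auto
  have finE: "finite E" using E finV by (auto intro: finite_subset[of E "Pow V"])
  define F where "F X = real (card (induced_edges E X)) - c * real (card X)" for X
  have "finite (Pow V)" "Pow V \<noteq> {}" using finV by auto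
  then obtain V' where V': "V' \<subseteq> V" "\<And>X. X \<subseteq> V \<Longrightarrow> F X \<le> F V'"
    using obtain_maximiser[of "Pow V" F] by (metis Pow_iff)
  show ?thesis
  proof
    show "V' \<subseteq> V" by fact
    have "induced_edges E V = E" using E unfolding induced_edges_def by auto
    then have "F V = real (card E) - c * real (card V)" unfolding F_def by simp
    moreover have "F V' \<le> real (card (induced_edges E V'))" unfolding F_def using c by simp
    ultimately show "real (card E) - c * real (card V) \<le> real (card (induced_edges E V'))" using V'(2)[of V] by simp
  next
    fix x assume x: "x \<in> V'"
    have finV': "finite V'" using V' finV finite_subset by auto
    let ?N = "nbrs V' (induced_edges E V') x"
    have "induced_edges E V' \<subseteq> induced_edges E (V' - {x}) \<union> (\<lambda>y. {x,y}) ` ?N"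
    proof
      fix e assume e: "e \<in> induced_edges E V'"
      then have e2: "e \<subseteq> V'" "card e = 2" using E unfolding induced_edges_def by auto
      show "e \<in> induced_edges E (V' - {x}) \<union> (\<lambda>y. {x,y}) ` ?N"
      proof (cases "x \<in> e")
        case True
        then obtain y where "e = {x,y}" using e2(2) by (metis card_2_iff doubleton_eq_iff insertE singletonD)
        then show ?thesis using e e2 unfolding nbrs_def by auto
      next
        case False then show ?thesis using e unfolding induced_edges_def by auto
      qed
    qed
    then have "card (induced_edges E V') \<le> card (induced_edges E (V' - {x}) \<union> (\<lambda>y. {x,y}) ` ?N)"
      using finE finV' by (intro card_mono) (auto simp: induced_edges_def nbrs_def)
    also have "\<dots> \<le> card (induced_edges E (V' - {x})) + card ((\<lambda>y. {x,y}) ` ?N)" by (rule card_Un_le)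
    also have "card ((\<lambda>y. {x,y}) ` ?N) \<le> card ?N" by (rule card_image_le) (use finV' in \<open>auto simp: nbrs_def\<close>)
    finally have "card (induced_edges E V') \<le> card (induced_edges E (V' - {x})) + card ?N" by simp
    moreover have "F (V' - {x}) \<le> F V'" using V'(1) by (intro V'(2)) auto
    moreover have "real (card (V' - {x})) = real (card V') - 1"
      using x finV' by (metis One_nat_def card_Diff_singleton card_gt_0_iff empty_iff of_nat_1 of_nat_diff Suc_leI)
    ultimately show "c \<le> real (card ?N)" unfolding F_def by (simp add: algebra_simps)
  qed
qed

section \<open>Weighted sequences of vertices\<close>

text \<open>Extensionality makes every longer sequence a unique one-point update of a shorter one,
  so sums over sequences unfold one time step at a time.\<close>

definition FS :: "'v set \<Rightarrow> nat \<Rightarrow> (nat \<Rightarrow> 'v) set" where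
  "FS V l = PiE {..l} (\<lambda>_. V)"

definition agree :: "nat set \<Rightarrow> (nat \<Rightarrow> 'v) \<Rightarrow> (nat \<Rightarrow> 'v) \<Rightarrow> bool" where
  "agree S z f \<longleftrightarrow> (\<forall>i\<in>S. f i = z i)"

lemma finite_FS: "finite V \<Longrightarrow> finite (FS V l)"
  unfolding FS_def by (auto intro: finite_PiE)

lemma FS_mem: "f \<in> FS V l \<Longrightarrow> i \<le> l \<Longrightarrow> f i \<in> V"
  unfolding FS_def by auto

lemma sum_FS_0: "(\<Sum>f\<in>FS V 0. G f) = (\<Sum>y\<in>V. G ((\<lambda>_. undefined)(0 := y)))"
proof -
  have "FS V 0 = (\<lambda>(y, g). g(0 := y)) ` (V \<times> {\<lambda>_. undefined})"
    using PiE_insert_eq[of 0 "{}" "\<lambda>_. V"] by (simp add: FS_def)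
  then have "FS V 0 = (\<lambda>y. (\<lambda>_. undefined)(0 := y)) ` V" by (simp add: image_image Times_insert_right)
  moreover have inj: "inj_on (\<lambda>y. (\<lambda>_. undefined)(0 := y)) V"
    by (rule inj_onI) (metis fun_upd_same)
  ultimately have "(\<Sum>f\<in>FS V 0. G f) = sum G ((\<lambda>y. (\<lambda>_. undefined)(0 := y)) ` V)" by simp
  also have "\<dots> = (\<Sum>y\<in>V. G ((\<lambda>_. undefined)(0 := y)))"
    by (subst sum.reindex[OF inj]) simp
  finally show ?thesis .
qed

lemma sum_FS_Suc:
  "(\<Sum>f\<in>FS V (Suc l). G f) = (\<Sum>f\<in>FS V l. \<Sum>y\<in>V. G (f(Suc l := y)))"
proof -
  have eq: "FS V (Suc l) = (\<lambda>(y, g). g(Suc l := y)) ` (V \<times> FS V l)"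
    unfolding FS_def using PiE_insert_eq[of "Suc l" "{..l}" "\<lambda>_. V"] by (simp add: atMost_Suc)
  have inj: "inj_on (\<lambda>(y, g). g(Suc l := y)) (V \<times> FS V l)"
    using inj_combinator[of "Suc l" "{..l}" "\<lambda>_. V"] unfolding FS_def by auto
  have "(\<Sum>f\<in>FS V (Suc l). G f) = (\<Sum>(y,g)\<in>V \<times> FS V l. G (g(Suc l := y)))"
    unfolding eq by (subst sum.reindex[OF inj]) (auto intro!: sum.cong)
  also have "\<dots> = (\<Sum>y\<in>V. \<Sum>g\<in>FS V l. G (g(Suc l := y)))"
    by (rule sum.cartesian_product[symmetric])
  finally show ?thesis by (subst sum.swap) simp
qed

lemma sum_FS_Suc_filter:
  assumes "finite V"
  shows "(\<Sum>f\<in>{f\<in>FS V (Suc l). Q f}. G f) =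
    (\<Sum>f\<in>FS V l. \<Sum>y\<in>V. if Q (f(Suc l := y)) then G (f(Suc l := y)) else 0)"
  by (subst sum.inter_filter[OF finite_FS[OF assms]]) (rule sum_FS_Suc)

lemma sum_FS_group:
  fixes G :: "(nat \<Rightarrow> 'v) \<Rightarrow> real"
  assumes "finite V" "i \<le> l"
  shows "(\<Sum>f\<in>{f\<in>FS V l. Q f}. G f) = (\<Sum>y\<in>V. \<Sum>f\<in>{f\<in>FS V l. Q f \<and> f i = y}. G f)"
proof -
  have "(\<Sum>y\<in>V. \<Sum>f\<in>{f\<in>{f\<in>FS V l. Q f}. f i = y}. G f) = (\<Sum>f\<in>{f\<in>FS V l. Q f}. G f)"
    by (rule sum.group) (use assms FS_mem in \<open>auto simp: finite_FS\<close>)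
  moreover have "{f\<in>{f\<in>FS V l. Q f}. f i = y} = {f\<in>FS V l. Q f \<and> f i = y}" for y by auto
  ultimately show ?thesis by simp
qed

lemma agree_upd: "j \<notin> S \<Longrightarrow> agree S z (f(j := y)) = agree S z f"
  unfolding agree_def by auto

lemma agree_Int_atMost_Suc:
  "agree (S \<inter> {..Suc l}) z f \<longleftrightarrow> agree (S \<inter> {..l}) z f \<and> (Suc l \<in> S \<longrightarrow> f (Suc l) = z (Suc l))"
  unfolding agree_def by (auto simp: le_Suc_eq)

lemma agree_Int_lessThan_Suc:
  "agree (S \<inter> {..<Suc l}) z f \<longleftrightarrow> agree (S \<inter> {..<l}) z f \<and> (l \<in> S \<longrightarrow> f l = z l)"
  unfolding agree_def by (auto simp: less_Suc_eq)

text \<open>The kernel may depend on the start \<open>u\<close>, as the zigzag kernels do, and the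
  weight up to time \<open>l0\<close> need not be Markovian, since the zigzag starts from walks
  selected at time \<open>t\<close>. Rows are only substochastic because a zigzag row vanishes where
  its normaliser is zero. The plain walk is the case \<open>l0 = 0\<close>.\<close>

locale chain =
  fixes V :: "'v set" and \<omega> :: "nat \<Rightarrow> (nat \<Rightarrow> 'v) \<Rightarrow> real"
    and K :: "nat \<Rightarrow> 'v \<Rightarrow> 'v \<Rightarrow> 'v \<Rightarrow> real" and l0 :: nat
  assumes finV: "finite V"
    and wstep: "\<And>l f y. l \<ge> l0 \<Longrightarrow> f \<in> FS V l \<Longrightarrow> y \<in> V \<Longrightarrow>
      \<omega> (Suc l) (f(Suc l := y)) = \<omega> l f * K l (f 0) (f l) y"
    and K_nonneg: "\<And>l u x y. 0 \<le> K l u x y"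
    and K_sub: "\<And>l u x. u \<in> V \<Longrightarrow> x \<in> V \<Longrightarrow> (\<Sum>y\<in>V. K l u x y) \<le> 1"
    and base_nonneg: "\<And>f. f \<in> FS V l0 \<Longrightarrow> 0 \<le> \<omega> l0 f"
begin

lemma FS_Suc_E:
  assumes "f \<in> FS V (Suc l)"
  obtains g y where "g \<in> FS V l" "y \<in> V" "f = g(Suc l := y)"
proof -
  have "f \<in> (\<lambda>(y, g). g(Suc l := y)) ` (V \<times> FS V l)"
    using assms PiE_insert_eq[of "Suc l" "{..l}" "\<lambda>_. V"] unfolding FS_def by (simp add: atMost_Suc)
  then show ?thesis using that by auto
qed

lemma weight_nonneg: "l0 \<le> l \<Longrightarrow> f \<in> FS V l \<Longrightarrow> 0 \<le> \<omega> l f"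
proof (induction l arbitrary: f rule: dec_induct)
  case base then show ?case by (rule base_nonneg)
next
  case (step l)
  obtain g y where g: "g \<in> FS V l" "y \<in> V" "f = g(Suc l := y)" using FS_Suc_E step.prems by blast
  then show ?case using step.IH[of g] step.hyps K_nonneg[of l "g 0" "g l" y] wstep[of l g y]
    by (simp del: fun_upd_apply)
qed

text \<open>Times after \<open>l\<close> are summed out, the last one first: a free time contributes
  at most 1 and a prescribed one at most \<open>c\<close>. The event \<open>\<Psi>\<close> is
  decided by time \<open>l\<close>.\<close>

lemma forward_bound:
  assumes c: "\<And>l u x y. l0 \<le> l \<Longrightarrow> u \<in> V \<Longrightarrow> x \<in> V \<Longrightarrow> y \<in> V \<Longrightarrow> K l u x y \<le> c (Suc l)"
    and c0: "\<And>i. 0 \<le> c i" and l: "l0 \<le> l" "l \<le> m"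
    and inv: "\<And>f i y. i > l \<Longrightarrow> \<Psi> (f(i := y)) = \<Psi> f"
  shows "sum (\<omega> m) {f\<in>FS V m. \<Psi> f \<and> agree (S \<inter> {..m}) z f} \<le>
    (\<Prod>i\<in>S \<inter> {l<..m}. c i) * sum (\<omega> l) {f\<in>FS V l. \<Psi> f \<and> agree (S \<inter> {..l}) z f}"
  using l(2)
proof (induction m rule: dec_induct)
  case base then show ?case by simp
next
  case (step m)
  have lm: "l0 \<le> m" using l step by simp
  define C where "C = (if Suc m \<in> S then c (Suc m) else 1)"
  have C0: "0 \<le> C" using c0 by (auto simp: C_def)
  have row: "(\<Sum>y\<in>V. if Suc m \<in> S \<longrightarrow> y = z (Suc m) then K m u x y else 0) \<le> C" if "u \<in> V" "x \<in> V" for u x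
  proof (cases "Suc m \<in> S")
    case True
    then show ?thesis using c[OF lm that] c0 finV by (auto simp: C_def)
  next
    case False then show ?thesis using K_sub[OF that] by (simp add: C_def)
  qed
  have "sum (\<omega> (Suc m)) {f\<in>FS V (Suc m). \<Psi> f \<and> agree (S \<inter> {..Suc m}) z f}
     = (\<Sum>f\<in>FS V m. \<Sum>y\<in>V. if \<Psi> f \<and> agree (S \<inter> {..m}) z f \<and> (Suc m \<in> S \<longrightarrow> y = z (Suc m)) then \<omega> m f * K m (f 0) (f m) y else 0)"
    using inv step.hyps
    by (subst sum_FS_Suc_filter[OF finV]) (auto simp: agree_Int_atMost_Suc agree_upd wstep[OF lm] intro!: sum.cong)
  also have "\<dots> = (\<Sum>f\<in>FS V m. if \<Psi> f \<and> agree (S \<inter> {..m}) z f then \<omega> m f * (\<Sum>y\<in>V. if Suc m \<in> S \<longrightarrow> y = z (Suc m) then K m (f 0) (f m) y else 0) else 0)"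
    by (auto simp: sum_distrib_left intro!: sum.cong)
  also have "\<dots> \<le> (\<Sum>f\<in>FS V m. if \<Psi> f \<and> agree (S \<inter> {..m}) z f then \<omega> m f * C else 0)"
    using weight_nonneg[OF lm] by (intro sum_mono) (auto intro!: mult_left_mono row intro: FS_mem)
  also have "\<dots> = C * sum (\<omega> m) {f\<in>FS V m. \<Psi> f \<and> agree (S \<inter> {..m}) z f}"
    by (subst sum.inter_filter[OF finite_FS[OF finV]]) (auto simp: sum_distrib_left intro!: sum.cong)
  also have "\<dots> \<le> C * ((\<Prod>i\<in>S \<inter> {l<..m}. c i) * sum (\<omega> l) {f\<in>FS V l. \<Psi> f \<and> agree (S \<inter> {..l}) z f})"
    using step.IH C0 by (rule mult_left_mono)
  also have "\<dots> = (C * (\<Prod>i\<in>S \<inter> {l<..m}. c i)) * sum (\<omega> l) {f\<in>FS V l. \<Psi> f \<and> agree (S \<inter> {..l}) z f}"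
    by (simp add: mult.assoc)
  also have "C * (\<Prod>i\<in>S \<inter> {l<..m}. c i) = (\<Prod>i\<in>S \<inter> {l<..Suc m}. c i)"
  proof -
    have "{l<..Suc m} = insert (Suc m) {l<..m}" using step.hyps by auto
    then show ?thesis by (cases "Suc m \<in> S") (auto simp: C_def)
  qed
  finally show ?case .
qed

lemma last_step:
  assumes "l0 \<le> m" "y' \<in> V"
    and inv: "\<And>f y. \<Phi> (f(Suc m := y)) = \<Phi> f"
    and k: "\<And>f. f \<in> FS V m \<Longrightarrow> \<Phi> f \<Longrightarrow> K m (f 0) (f m) y' = k (f m)"
  shows "sum (\<omega> (Suc m)) {f\<in>FS V (Suc m). \<Phi> f \<and> f (Suc m) = y'} =
    (\<Sum>y\<in>V. sum (\<omega> m) {f\<in>FS V m. \<Phi> f \<and> f m = y} * k y)"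
proof -
  have "sum (\<omega> (Suc m)) {f\<in>FS V (Suc m). \<Phi> f \<and> f (Suc m) = y'}
     = (\<Sum>f\<in>FS V m. \<Sum>y\<in>V. if \<Phi> f \<and> y = y' then \<omega> m f * K m (f 0) (f m) y else 0)"
    using inv by (subst sum_FS_Suc_filter[OF finV]) (auto simp: wstep[OF assms(1)] intro!: sum.cong)
  also have "\<dots> = (\<Sum>f\<in>FS V m. if \<Phi> f then \<omega> m f * K m (f 0) (f m) y' else 0)"
    using assms(2) finV by (intro sum.cong) (auto simp: if_distrib cong: if_cong)
  also have "\<dots> = (\<Sum>f\<in>{f\<in>FS V m. \<Phi> f}. \<omega> m f * K m (f 0) (f m) y')"
    by (subst sum.inter_filter[OF finite_FS[OF finV]]) auto
  also have "\<dots> = (\<Sum>f\<in>{f\<in>FS V m. \<Phi> f}. \<omega> m f * k (f m))"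
    using k by (intro sum.cong) auto
  also have "\<dots> = (\<Sum>y\<in>V. \<Sum>f\<in>{f\<in>FS V m. \<Phi> f \<and> f m = y}. \<omega> m f * k (f m))"
    by (rule sum_FS_group[OF finV]) simp
  also have "\<dots> = (\<Sum>y\<in>V. sum (\<omega> m) {f\<in>FS V m. \<Phi> f \<and> f m = y} * k y)"
    by (auto simp: sum_distrib_right intro!: sum.cong)
  finally show ?thesis .
qed

text \<open>
  If \<open>M\<close> evolves under the kernels, then fixing the state at an earlier time \<open>m\<close> costs at most the
  largest transition probability \<open>c m\<close> of the time-reversed chain.
\<close>

lemma reverse_bound:
  assumes k: "\<And>u m y y'. u \<in> U \<Longrightarrow> y \<in> V \<Longrightarrow> y' \<in> V \<Longrightarrow> K m u y y' = k m y y'"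
    and M0: "\<And>m y. 0 \<le> M m y"
    and h1: "\<And>m y'. l0 \<le> m \<Longrightarrow> y' \<in> V \<Longrightarrow> (\<Sum>y\<in>V. M m y * k m y y') \<le> M (Suc m) y'"
    and h2: "\<And>m y y'. l0 \<le> m \<Longrightarrow> y \<in> V \<Longrightarrow> y' \<in> V \<Longrightarrow> M m y * k m y y' \<le> c m * M (Suc m) y'"
    and c0: "\<And>i. 0 \<le> c i" and \<Gamma>: "0 \<le> \<Gamma>"
    and U: "U \<subseteq> V" "U \<noteq> {}"
    and start: "\<And>y. y \<in> V \<Longrightarrow>
      sum (\<omega> l0) {f\<in>FS V l0. (f 0 \<in> U \<and> agree (S \<inter> {..<l0}) z f) \<and> f l0 = y} \<le> \<Gamma> * M l0 y"
    and m: "l0 \<le> m" and y: "y \<in> V"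
  shows "sum (\<omega> m) {f\<in>FS V m. (f 0 \<in> U \<and> agree (S \<inter> {..<m}) z f) \<and> f m = y} \<le>
    \<Gamma> * (\<Prod>i\<in>S \<inter> {l0..<m}. c i) * M m y"
  using m y
proof (induction m arbitrary: y rule: dec_induct)
  case base then show ?case using start by simp
next
  case (step m)
  let ?A = "\<lambda>y. sum (\<omega> m) {f\<in>FS V m. (f 0 \<in> U \<and> agree (S \<inter> {..<m}) z f) \<and> f m = y}"
  let ?P = "\<Gamma> * (\<Prod>i\<in>S \<inter> {l0..<m}. c i)"
  define C where "C = (if m \<in> S then c m else 1)"
  have P0: "0 \<le> ?P" using \<Gamma> c0 by (simp add: prod_nonneg)
  obtain u where u: "u \<in> U" using U by auto
  have k0: "0 \<le> k m y y'" if "y \<in> V" "y' \<in> V" for y y' using k[OF u that, of m] K_nonneg[of m u y y'] by simp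
  have "sum (\<omega> (Suc m)) {f\<in>FS V (Suc m). (f 0 \<in> U \<and> agree (S \<inter> {..<Suc m}) z f) \<and> f (Suc m) = y} =
    (\<Sum>x\<in>V. sum (\<omega> m) {f\<in>FS V m. (f 0 \<in> U \<and> agree (S \<inter> {..<Suc m}) z f) \<and> f m = x} * k m x y)"
    by (rule last_step) (use step.hyps step.prems in \<open>auto simp: agree_upd intro!: k intro: FS_mem\<close>)
  also have "\<dots> = (\<Sum>x\<in>V. (if m \<in> S \<longrightarrow> x = z m then ?A x else 0) * k m x y)"
    by (intro sum.cong arg_cong2[where f="(*)"]) (auto simp: agree_Int_lessThan_Suc intro!: sum.cong sum.neutral)
  also have "\<dots> \<le> (\<Sum>x\<in>V. (if m \<in> S \<longrightarrow> x = z m then ?P * M m x else 0) * k m x y)"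
    using step.IH k0 step.prems by (intro sum_mono mult_right_mono) auto
  also have "\<dots> = ?P * (\<Sum>x\<in>V. if m \<in> S \<longrightarrow> x = z m then M m x * k m x y else 0)"
    by (auto simp: sum_distrib_left intro!: sum.cong)
  also have "\<dots> \<le> ?P * (C * M (Suc m) y)"
  proof (intro mult_left_mono P0)
    show "(\<Sum>x\<in>V. if m \<in> S \<longrightarrow> x = z m then M m x * k m x y else 0) \<le> C * M (Suc m) y"
    \<comment> \<open>Prescribing time \<open>m\<close> leaves a single summand, which
      \<open>h2\<close> bounds; otherwise \<open>h1\<close> controls the whole sum.\<close>
    proof (cases "m \<in> S")
      case True
      then show ?thesis using finV h2[of m "z m" y] step c0 M0 by (auto simp: C_def)
    next
      case False then show ?thesis using h1[of m y] step by (simp add: C_def)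
    qed
  qed
  also have "?P * (C * M (Suc m) y) = \<Gamma> * ((\<Prod>i\<in>S \<inter> {l0..<m}. c i) * C) * M (Suc m) y" by simp
  also have "(\<Prod>i\<in>S \<inter> {l0..<m}. c i) * C = (\<Prod>i\<in>S \<inter> {l0..<Suc m}. c i)"
  proof -
    have "{l0..<Suc m} = insert m {l0..<m}" using step.hyps by auto
    then show ?thesis by (cases "m \<in> S") (auto simp: C_def mult.commute)
  qed
  finally show ?case .
qed

lemma marginal_eq:
  assumes k: "\<And>u m y y'. u \<in> U \<Longrightarrow> y \<in> V \<Longrightarrow> y' \<in> V \<Longrightarrow> K m u y y' = k m y y'"
    and h1: "\<And>m y'. l0 \<le> m \<Longrightarrow> y' \<in> V \<Longrightarrow> (\<Sum>y\<in>V. M m y * k m y y') = M (Suc m) y'"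
    and start: "\<And>y. y \<in> V \<Longrightarrow> sum (\<omega> l0) {f\<in>FS V l0. f 0 \<in> U \<and> f l0 = y} = M l0 y"
    and m: "l0 \<le> m" and y: "y \<in> V"
  shows "sum (\<omega> m) {f\<in>FS V m. f 0 \<in> U \<and> f m = y} = M m y"
  using m y
proof (induction m arbitrary: y rule: dec_induct)
  case base then show ?case using start by simp
next
  case (step m)
  have "sum (\<omega> (Suc m)) {f\<in>FS V (Suc m). f 0 \<in> U \<and> f (Suc m) = y} =
    (\<Sum>x\<in>V. sum (\<omega> m) {f\<in>FS V m. f 0 \<in> U \<and> f m = x} * k m x y)"
    by (rule last_step) (use step.hyps step.prems in \<open>auto intro!: k intro: FS_mem\<close>)
  also have "\<dots> = (\<Sum>x\<in>V. M m x * k m x y)" using step.IH by (intro sum.cong) auto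
  finally show ?case using h1 step by simp
qed

text \<open>The last vertex would have to be the one already chosen at time \<open>i\<close>; given
  the past, this has probability at most \<open>c\<close>.\<close>

lemma collision_bound:
  assumes c: "\<And>u x y. u \<in> V \<Longrightarrow> x \<in> V \<Longrightarrow> y \<in> V \<Longrightarrow> K m u x y \<le> c" and m: "l0 \<le> m" "i \<le> m"
  shows "sum (\<omega> (Suc m)) {f\<in>FS V (Suc m). f i = f (Suc m)} \<le> c * (\<Sum>f\<in>FS V m. \<omega> m f)"
proof -
  have "sum (\<omega> (Suc m)) {f\<in>FS V (Suc m). f i = f (Suc m)}
     = (\<Sum>f\<in>FS V m. \<Sum>y\<in>V. if y = f i then \<omega> m f * K m (f 0) (f m) y else 0)"
    using m by (subst sum_FS_Suc_filter[OF finV]) (auto simp: wstep[OF m(1)] intro!: sum.cong)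
  also have "\<dots> = (\<Sum>f\<in>FS V m. \<omega> m f * K m (f 0) (f m) (f i))"
    using finV m FS_mem by (intro sum.cong) auto
  also have "\<dots> \<le> (\<Sum>f\<in>FS V m. \<omega> m f * c)"
    using weight_nonneg[OF m(1)] m by (intro sum_mono mult_left_mono c) (auto intro: FS_mem)
  finally show ?thesis by (simp add: sum_distrib_left mult.commute)
qed

lemma total_le:
  assumes "l0 \<le> l" "l \<le> m"
    and inv: "\<And>f i y. i > l \<Longrightarrow> \<Psi> (f(i := y)) = \<Psi> f"
  shows "sum (\<omega> m) {f\<in>FS V m. \<Psi> f} \<le> sum (\<omega> l) {f\<in>FS V l. \<Psi> f}"
proof -
  have "K l u x y \<le> 1" if "u \<in> V" "x \<in> V" "y \<in> V" for l u x y
    using member_le_sum[of y V "K l u x"] K_sub[of u x l] K_nonneg finV that by fastforce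
  then show ?thesis
    using forward_bound[of "\<lambda>_. 1" l m \<Psi> "{}"] assms by (simp add: agree_def)
qed

end

section \<open>The random walk\<close>

locale walk_graph =
  fixes V :: "'v set" and E :: "'v set set" and \<kappa> \<rho> :: real and b :: nat
  assumes finV: "finite V" and V_ne: "V \<noteq> {}"
    and edges: "\<And>e. e \<in> E \<Longrightarrow> e \<subseteq> V \<and> card e = 2"
    and mindeg: "\<And>x. x \<in> V \<Longrightarrow> \<kappa> * \<rho> / 2 \<le> real (card (nbrs V E x))"
    and \<kappa>1: "1 \<le> \<kappa>" and \<rho>1: "1 \<le> \<rho>" and card_V: "real (card V) \<le> \<kappa> * \<rho> ^ b" and b2: "2 \<le> b"
begin

definition deg :: "'v \<Rightarrow> real" where "deg x = real (card (nbrs V E x))"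
definition M :: real where "M = (\<Sum>x\<in>V. deg x)"
definition P :: "'v \<Rightarrow> 'v \<Rightarrow> real" where "P x y = (if {x, y} \<in> E then 1 / deg x else 0)"
definition st :: "'v \<Rightarrow> real" where "st x = deg x / M"
definition sq :: "'v \<Rightarrow> real" where "sq x = sqrt (deg x)"

fun Pn :: "nat \<Rightarrow> 'v \<Rightarrow> 'v \<Rightarrow> real" where
  "Pn 0 x y = (if x = y then 1 else 0)"
| "Pn (Suc g) x y = (\<Sum>z\<in>V. Pn g x z * P z y)"

definition W :: "nat \<Rightarrow> (nat \<Rightarrow> 'v) \<Rightarrow> real" where
  "W l f = st (f 0) * (\<Prod>i<l. P (f i) (f (Suc i)))"

text \<open>
  \<open>sq y / sq x * Pn g y x\<close> is symmetric in \<open>x\<close>, \<open>y\<close>; comparing \<open>Pn g\<close> with \<open>thr g\<close> is thus insensitive to the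
  direction of the walk, which is what makes vertices of large degree harmless.
\<close>

definition thr :: "nat \<Rightarrow> 'v \<Rightarrow> 'v \<Rightarrow> real" where
  "thr g x y = sq y / (sq x * (\<kappa> * \<rho> ^ g))"

lemma \<kappa>\<rho>_pos: "0 < \<kappa> * \<rho>" "0 < \<kappa>" "0 < \<rho>" using \<kappa>1 \<rho>1 by auto

lemma deg_ge: "x \<in> V \<Longrightarrow> \<kappa> * \<rho> / 2 \<le> deg x"
  unfolding deg_def by (rule mindeg)

lemma deg_pos: "x \<in> V \<Longrightarrow> 0 < deg x"
  using deg_ge[of x] \<kappa>\<rho>_pos by linarith

lemma deg_nonneg: "0 \<le> deg x" unfolding deg_def by simp

lemma M_pos: "0 < M"
  unfolding M_def using finV V_ne deg_pos by (intro sum_pos) auto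

lemma sq_pos: "x \<in> V \<Longrightarrow> 0 < sq x" unfolding sq_def using deg_pos by simp
lemma sq_sq: "sq x * sq x = deg x" unfolding sq_def using deg_nonneg by simp

lemma P_nonneg: "0 \<le> P x y" unfolding P_def using deg_nonneg by simp

lemma P_le: "x \<in> V \<Longrightarrow> P x y \<le> 2 / (\<kappa> * \<rho>)"
  unfolding P_def using frac_le[of 1 1 "\<kappa> * \<rho> / 2" "deg x"] deg_ge[of x] \<kappa>\<rho>_pos by simp

lemma P_sum: "x \<in> V \<Longrightarrow> (\<Sum>y\<in>V. P x y) = 1"
proof -
  assume x: "x \<in> V"
  have "(\<Sum>y\<in>V. P x y) = (\<Sum>y\<in>nbrs V E x. 1 / deg x)"
    unfolding P_def nbrs_def by (rule sum.inter_filter[OF finV, symmetric])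
  then show ?thesis using deg_pos[OF x] by (simp add: deg_def)
qed

lemma st_nonneg: "0 \<le> st x" unfolding st_def using deg_nonneg M_pos by simp
lemma st_sum: "(\<Sum>x\<in>V. st x) = 1"
  unfolding st_def using M_pos by (simp add: sum_divide_distrib[symmetric] M_def)

text \<open>Each orientation of an edge carries the same flow \<open>1 / M\<close>. This is
  reversibility, and \<open>1 / M\<close> is also the price of a fixed edge in the later spread
  bounds.\<close>

lemma flow: "x \<in> V \<Longrightarrow> st x * P x y = (if {x, y} \<in> E then 1 / M else 0)"
  unfolding st_def P_def using deg_pos[of x] M_pos by auto

lemma flow_sym: "x \<in> V \<Longrightarrow> y \<in> V \<Longrightarrow> st x * P x y = st y * P y x"
  by (simp add: flow insert_commute)

lemma flow_le: "x \<in> V \<Longrightarrow> st x * P x y \<le> 1 / M"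
  using M_pos by (simp add: flow)

lemma stationary: "y \<in> V \<Longrightarrow> (\<Sum>x\<in>V. st x * P x y) = st y"
proof -
  assume y: "y \<in> V"
  have "(\<Sum>x\<in>V. st x * P x y) = (\<Sum>x\<in>V. st y * P y x)" using flow_sym y by (intro sum.cong) auto
  then show ?thesis using P_sum[OF y] by (simp add: sum_distrib_left[symmetric])
qed

lemma Pn_nonneg: "0 \<le> Pn g x y"
  by (induction g arbitrary: y) (auto intro!: sum_nonneg mult_nonneg_nonneg P_nonneg)

lemma Pn_sum: "x \<in> V \<Longrightarrow> (\<Sum>y\<in>V. Pn g x y) = 1"
proof (induction g)
  case 0 then show ?case using finV by simp
next
  case (Suc g)
  have "(\<Sum>y\<in>V. Pn (Suc g) x y) = (\<Sum>z\<in>V. \<Sum>y\<in>V. Pn g x z * P z y)" by (simp, rule sum.swap)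
  also have "\<dots> = 1" using Suc P_sum by (simp add: sum_distrib_left[symmetric])
  finally show ?case .
qed

lemma Pn_le: "x \<in> V \<Longrightarrow> Pn (Suc g) x y \<le> 2 / (\<kappa> * \<rho>)"
proof -
  assume x: "x \<in> V"
  have "Pn (Suc g) x y \<le> (\<Sum>z\<in>V. Pn g x z * (2 / (\<kappa> * \<rho>)))"
    unfolding Pn.simps using P_le Pn_nonneg by (intro sum_mono mult_left_mono) auto
  also have "\<dots> = 2 / (\<kappa> * \<rho>)" unfolding sum_distrib_right[symmetric] using Pn_sum[OF x] by simp
  finally show ?thesis .
qed

lemma W_nonneg: "0 \<le> W l f"
  unfolding W_def by (intro mult_nonneg_nonneg st_nonneg prod_nonneg) (auto intro: P_nonneg)

sublocale walk: chain V W "\<lambda>l u x y. P x y" 0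
proof
  show "finite V" by (rule finV)
  show "0 \<le> P x y" for x y by (rule P_nonneg)
  show "(\<Sum>y\<in>V. P x y) \<le> 1" if "x \<in> V" for x using P_sum[OF that] by simp
  show "W (Suc l) (f(Suc l := y)) = W l f * P (f l) y" if "f \<in> FS V l" for l f y
    unfolding W_def by (auto intro!: prod.cong)
  show "0 \<le> W 0 f" for f by (rule W_nonneg)
qed

lemma walk_split:
  assumes "y \<in> V" and inv: "\<And>f i y. i > j \<Longrightarrow> \<Phi> (f(i := y)) = \<Phi> f"
  shows "sum (W (j + g)) {f\<in>FS V (j + g). (\<Phi> f \<and> f j = x) \<and> f (j + g) = y} =
    sum (W j) {f\<in>FS V j. \<Phi> f \<and> f j = x} * Pn g x y"
  using assms(1)
proof (induction g arbitrary: y)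
  case 0
  have "{f \<in> FS V j. (\<Phi> f \<and> f j = x) \<and> f j = y} = (if x = y then {f\<in>FS V j. \<Phi> f \<and> f j = x} else {})" by auto
  then show ?case by simp
next
  case (Suc g)
  have "(\<Sum>f\<in>{f\<in>FS V (Suc (j + g)). (\<Phi> f \<and> f j = x) \<and> f (Suc (j + g)) = y}. W (Suc (j + g)) f) =
    (\<Sum>a\<in>V. sum (W (j + g)) {f\<in>FS V (j + g). (\<Phi> f \<and> f j = x) \<and> f (j + g) = a} * P a y)"
    by (rule walk.last_step) (use Suc inv in auto)
  also have "\<dots> = (\<Sum>a\<in>V. sum (W j) {f\<in>FS V j. \<Phi> f \<and> f j = x} * Pn g x a * P a y)"
    using Suc.IH by (intro sum.cong) auto
  finally show ?case by (simp add: sum_distrib_left mult.assoc)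
qed

lemma walk_marginal: "y \<in> V \<Longrightarrow> sum (W j) {f\<in>FS V j. f j = y} = st y"
proof -
  assume y: "y \<in> V"
  have "{f\<in>FS V j. f 0 \<in> V \<and> f j = y} = {f\<in>FS V j. f j = y}" using FS_mem by blast
  moreover have "sum (W j) {f\<in>FS V j. f 0 \<in> V \<and> f j = y} = st y"
  proof (rule walk.marginal_eq[of V "\<lambda>m. P" "\<lambda>m. st"])
    fix x assume x: "x \<in> V"
    have "sum (W 0) {f\<in>FS V 0. f 0 \<in> V \<and> f 0 = x} = (\<Sum>y\<in>V. if y = x then st y else 0)"
      using finV by (subst sum.inter_filter[OF finite_FS[OF finV]], subst sum_FS_0) (auto simp: W_def intro!: sum.cong)
    then show "sum (W 0) {f\<in>FS V 0. f 0 \<in> V \<and> f 0 = x} = st x" using x finV by simp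
  qed (use stationary y in auto)
  ultimately show ?thesis by simp
qed

lemma walk_pair: "x \<in> V \<Longrightarrow> y \<in> V \<Longrightarrow>
    sum (W (j + g)) {f\<in>FS V (j + g). f j = x \<and> f (j + g) = y} = st x * Pn g x y"
  using walk_split[of y j "\<lambda>_. True" g x] walk_marginal[of x j] by simp

lemma walk_pair_event:
  "sum (W (j + g)) {f\<in>FS V (j + g). Q (f j) (f (j + g))} =
    (\<Sum>x\<in>V. \<Sum>y\<in>V. if Q x y then st x * Pn g x y else 0)"
proof -
  have "sum (W (j + g)) {f\<in>FS V (j + g). Q (f j) (f (j + g))} =
    (\<Sum>x\<in>V. \<Sum>y\<in>V. \<Sum>f\<in>{f\<in>FS V (j + g). (Q (f j) (f (j + g)) \<and> f j = x) \<and> f (j + g) = y}. W (j + g) f)"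
    by (subst sum_FS_group[OF finV, of j], simp, intro sum.cong refl sum_FS_group[OF finV, of "j + g"]) auto
  also have "\<dots> = (\<Sum>x\<in>V. \<Sum>y\<in>V. if Q x y then \<Sum>f\<in>{f\<in>FS V (j + g). f j = x \<and> f (j + g) = y}. W (j + g) f else 0)"
    by (auto intro!: sum.cong sum.neutral)
  also have "\<dots> = (\<Sum>x\<in>V. \<Sum>y\<in>V. if Q x y then st x * Pn g x y else 0)"
    using walk_pair by (intro sum.cong) auto
  finally show ?thesis .
qed

lemma walk_pair_event_le:
  assumes "j + g \<le> m"
  shows "sum (W m) {f\<in>FS V m. Q (f j) (f (j + g))} \<le>
    (\<Sum>x\<in>V. \<Sum>y\<in>V. if Q x y then st x * Pn g x y else 0)"
  using walk.forward_bound[of "\<lambda>_. 2 / (\<kappa> * \<rho>)" "j + g" m "\<lambda>f. Q (f j) (f (j + g))" "{}"]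
    walk_pair_event[of j g Q] P_le \<kappa>\<rho>_pos assms
  by (simp add: agree_def)

section \<open>Concentration, and walks that avoid it before time \<open>t\<close>\<close>

definition conc :: "nat \<Rightarrow> 'v \<Rightarrow> 'v \<Rightarrow> bool" where
  "conc g x y \<longleftrightarrow> thr g x y / 4 \<le> Pn g x y"

definition prob_conc :: "nat \<Rightarrow> real" where
  "prob_conc g = (\<Sum>x\<in>V. \<Sum>y\<in>V. if conc g x y then st x * Pn g x y else 0)"

lemma thr_pos: "x \<in> V \<Longrightarrow> y \<in> V \<Longrightarrow> 0 < thr g x y"
  unfolding thr_def using sq_pos \<kappa>\<rho>_pos by simp

text \<open>Below the threshold, the mass of a pair is at most
  \<open>sq x * sq y / (4 * M * (\<kappa> * \<rho> ^ b))\<close>. By Cauchy-Schwarz these bounds add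
  up to at most \<open>card V / (4 * (\<kappa> * \<rho> ^ b))\<close>, which is at most
  \<open>1 / 4\<close>; this is where the factor 4 in \<open>conc\<close> is spent.\<close>

lemma prob_conc_top: "3 / 4 \<le> prob_conc b"
proof -
  have "(\<Sum>x\<in>V. \<Sum>y\<in>V. if conc b x y then 0 else st x * Pn b x y) \<le> (\<Sum>x\<in>V. \<Sum>y\<in>V. sq x * sq y / (4 * M * (\<kappa> * \<rho> ^ b)))"
  proof (intro sum_mono)
    fix x y assume xy: "x \<in> V" "y \<in> V"
    have "st x * (thr b x y / 4) = sq x * sq y / (4 * M * (\<kappa> * \<rho> ^ b))"
      unfolding st_def thr_def sq_sq[symmetric, of x] using sq_pos[OF xy(1)] by simp
    moreover have "0 \<le> sq x * sq y / (4 * M * (\<kappa> * \<rho> ^ b))"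
      using sq_pos xy M_pos \<kappa>\<rho>_pos by (intro divide_nonneg_pos) (auto simp: less_imp_le)
    ultimately show "(if conc b x y then 0 else st x * Pn b x y) \<le> sq x * sq y / (4 * M * (\<kappa> * \<rho> ^ b))"
      using mult_left_mono[of "Pn b x y" "thr b x y / 4" "st x"] st_nonneg[of x] by (auto simp: conc_def not_le)
  qed
  also have "\<dots> = (\<Sum>x\<in>V. sq x)\<^sup>2 / (4 * M * (\<kappa> * \<rho> ^ b))"
    unfolding power2_eq_square sum_product by (simp add: sum_divide_distrib)
  also have "\<dots> \<le> (real (card V) * M) / (4 * M * (\<kappa> * \<rho> ^ b))"
  proof (rule divide_right_mono)
    have "(\<Sum>x\<in>V. (sq x)\<^sup>2) = M" unfolding M_def power2_eq_square sq_sq by simp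
    then show "(\<Sum>x\<in>V. sq x)\<^sup>2 \<le> real (card V) * M"
      using sum_squared_le_sum_of_squares[of sq V] by (simp add: mult.commute)
    show "0 \<le> 4 * M * (\<kappa> * \<rho> ^ b)" using M_pos \<kappa>\<rho>_pos by simp
  qed
  also have "\<dots> \<le> 1 / 4"
    using M_pos \<kappa>\<rho>_pos card_V by (simp add: field_simps)
  finally have "(\<Sum>x\<in>V. \<Sum>y\<in>V. if conc b x y then 0 else st x * Pn b x y) \<le> 1 / 4" .
  moreover have "prob_conc b + (\<Sum>x\<in>V. \<Sum>y\<in>V. if conc b x y then 0 else st x * Pn b x y) = (\<Sum>x\<in>V. \<Sum>y\<in>V. st x * Pn b x y)"
    unfolding prob_conc_def sum.distrib[symmetric] by (intro sum.cong) auto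
  moreover have "(\<Sum>x\<in>V. \<Sum>y\<in>V. st x * Pn b x y) = 1"
    using Pn_sum st_sum by (simp add: sum_distrib_left[symmetric])
  ultimately show ?thesis by linarith
qed

text \<open>The demanded probability grows by a factor \<open>1 / \<eta>\<close> per level, and
  \<open>t\<close> is the least level that meets its demand. Hence concentration at any earlier gap
  is less likely than at \<open>t\<close> by a factor \<open>\<eta>\<close>, and discarding all
  walks with an early concentrated pair costs only a small fraction of the mass at
  \<open>t\<close>.\<close>

lemma concentration_level:
  assumes "0 < \<eta>"
  obtains t where "2 \<le> t" "t \<le> b" "\<eta> ^ (b - t) / 2 \<le> prob_conc t"
    "\<And>g. 2 \<le> g \<Longrightarrow> g < t \<Longrightarrow> prob_conc g \<le> \<eta> ^ (b - g) / 2"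
proof -
  let ?Q = "\<lambda>t. 2 \<le> t \<and> t \<le> b \<and> \<eta> ^ (b - t) / 2 \<le> prob_conc t"
  have Qb: "?Q b" using prob_conc_top b2 by simp
  show ?thesis
  proof (rule that[of "LEAST t. ?Q t"])
    show "2 \<le> (LEAST t. ?Q t)" "(LEAST t. ?Q t) \<le> b" "\<eta> ^ (b - (LEAST t. ?Q t)) / 2 \<le> prob_conc (LEAST t. ?Q t)"
      using LeastI[of ?Q b, OF Qb] by auto
    fix g assume g: "2 \<le> g" "g < (LEAST t. ?Q t)"
    then show "prob_conc g \<le> \<eta> ^ (b - g) / 2"
      using not_less_Least[of g ?Q] Least_le[of ?Q b, OF Qb] by auto
  qed
qed

text \<open>The factor 2 makes gap 1 tame in every case, by \<open>P_le_thr\<close>. Gap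
  \<open>t\<close> is exempt because there \<open>good_walk\<close> asks for a lower bound, through
  \<open>conc\<close>.\<close>

definition tame :: "nat \<Rightarrow> nat \<Rightarrow> 'v \<Rightarrow> 'v \<Rightarrow> bool" where
  "tame t g x y \<longleftrightarrow> (g < t \<longrightarrow> Pn g x y \<le> 2 * thr g x y)"

definition good_walk :: "nat \<Rightarrow> (nat \<Rightarrow> 'v) \<Rightarrow> bool" where
  "good_walk t f \<longleftrightarrow> conc t (f 0) (f t) \<and>
     (\<forall>i g. 1 \<le> g \<longrightarrow> i + g \<le> t \<longrightarrow> tame t g (f i) (f (i + g)) \<and> f i \<noteq> f (i + g))"

text \<open>Both degrees are at least \<open>\<kappa> * \<rho> / 2\<close>, hence so is
  \<open>sq x * sq y\<close>; this is exactly the inequality between \<open>1 / deg x\<close> and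
  the symmetric threshold.\<close>

lemma P_le_thr: "x \<in> V \<Longrightarrow> y \<in> V \<Longrightarrow> P x y \<le> 2 * thr 1 x y"
proof -
  assume xy: "x \<in> V" "y \<in> V"
  have "sqrt (\<kappa> * \<rho> / 2) \<le> sq x" "sqrt (\<kappa> * \<rho> / 2) \<le> sq y"
    unfolding sq_def using deg_ge xy by auto
  then have "sqrt (\<kappa> * \<rho> / 2) * sqrt (\<kappa> * \<rho> / 2) \<le> sq x * sq y"
    using \<kappa>\<rho>_pos sq_pos[OF xy(1)] by (intro mult_mono) auto
  then have "\<kappa> * \<rho> \<le> 2 * (sq x * sq y)" using \<kappa>\<rho>_pos by simp
  then have "1 / (sq x * sq x) \<le> 2 * thr 1 x y"
    unfolding thr_def using sq_pos[OF xy(1)] sq_pos[OF xy(2)] \<kappa>\<rho>_pos by (simp add: field_simps)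
  moreover have "P x y \<le> 1 / (sq x * sq x)" unfolding P_def sq_sq using deg_nonneg by simp
  ultimately show ?thesis by linarith
qed

lemma Pn_1: "x \<in> V \<Longrightarrow> Pn 1 x y = P x y"
  using finV by (simp add: if_distrib[of "\<lambda>c. c * _"] cong: if_cong)

text \<open>Union bound: among the walks with concentrated ends, each of at most
  \<open>b\<^sup>2\<close> pairs of times is untame with mass at most \<open>\<epsilon>'\<close> and
  coincides with mass at most \<open>2 / \<kappa>\<close>.\<close>

lemma good_walk_mass:
  assumes t: "2 \<le> t" "t \<le> b" and \<epsilon>: "\<epsilon> \<le> prob_conc t"
    and low: "\<And>g. 2 \<le> g \<Longrightarrow> g < t \<Longrightarrow> prob_conc g \<le> \<epsilon>'"
    and eps: "real (b\<^sup>2) * (\<epsilon>' + 2 / \<kappa>) \<le> \<epsilon> / 2" "0 \<le> \<epsilon>'"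
  shows "\<epsilon> / 2 \<le> sum (W t) {f\<in>FS V t. good_walk t f}"
proof -
  let ?I = "{(i, g). 1 \<le> g \<and> i + g \<le> t}"
  let ?bad = "\<lambda>(i, g). {f\<in>FS V t. \<not> tame t g (f i) (f (i + g))}"
  let ?col = "\<lambda>(i, g). {f\<in>FS V t. f i = f (i + g)}"
  have Isub: "?I \<subseteq> {..<b} \<times> {1..b}" using t by auto
  then have finI: "finite ?I" by (rule finite_subset) auto
  have cardI: "card ?I \<le> b\<^sup>2" using card_mono[OF _ Isub] by (simp add: power2_eq_square card_cartesian_product)
  have fin: "finite {f\<in>FS V t. Q f}" for Q using finite_FS[OF finV] by auto
  have "prob_conc t = sum (W t) {f\<in>FS V t. conc t (f 0) (f t)}"
    unfolding prob_conc_def using walk_pair_event[of 0 t "conc t"] by simp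
  also have "\<dots> \<le> (\<Sum>f\<in>{f\<in>FS V t. good_walk t f} \<union> ((\<Union>p\<in>?I. ?bad p) \<union> (\<Union>p\<in>?I. ?col p)). W t f)"
  proof (rule sum_mono2)
    show "finite ({f\<in>FS V t. good_walk t f} \<union> ((\<Union>p\<in>?I. ?bad p) \<union> (\<Union>p\<in>?I. ?col p)))"
      using finI fin by (auto simp: split_beta)
    show "{f\<in>FS V t. conc t (f 0) (f t)} \<subseteq> {f\<in>FS V t. good_walk t f} \<union> ((\<Union>p\<in>?I. ?bad p) \<union> (\<Union>p\<in>?I. ?col p))"
      unfolding good_walk_def by auto
  qed (rule W_nonneg)
  also have "\<dots> \<le> sum (W t) {f\<in>FS V t. good_walk t f} + ((\<Sum>f\<in>(\<Union>p\<in>?I. ?bad p). W t f) + (\<Sum>f\<in>(\<Union>p\<in>?I. ?col p). W t f))"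
  proof -
    have "finite (\<Union>p\<in>?I. ?bad p)" "finite (\<Union>p\<in>?I. ?col p)" using finI fin by (auto simp: split_beta)
    then show ?thesis using fin W_nonneg by (intro order_trans[OF sum_Un_le] add_left_mono sum_Un_le) auto
  qed
  also have "(\<Sum>f\<in>(\<Union>p\<in>?I. ?bad p). W t f) \<le> (\<Sum>p\<in>?I. sum (W t) (?bad p))"
    by (rule sum_UN_le) (use finI fin W_nonneg in \<open>auto simp: split_beta\<close>)
  also have "\<dots> \<le> (\<Sum>p\<in>?I. \<epsilon>')"
  proof (rule sum_mono, clarify)
    fix i g assume ig: "1 \<le> g" "i + g \<le> t"
    show "sum (W t) {f\<in>FS V t. \<not> tame t g (f i) (f (i + g))} \<le> \<epsilon>'"
    proof (cases "2 \<le> g \<and> g < t")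
      case True
      have "sum (W t) {f\<in>FS V t. \<not> tame t g (f i) (f (i + g))} \<le> (\<Sum>x\<in>V. \<Sum>y\<in>V. if \<not> tame t g x y then st x * Pn g x y else 0)"
        by (rule walk_pair_event_le[OF ig(2)])
      \<comment> \<open>Exceeding twice the threshold implies \<open>conc\<close>; by stationarity
        the time \<open>i\<close> at which the gap begins does not matter.\<close>
      also have "\<dots> \<le> prob_conc g"
        unfolding prob_conc_def
      proof (intro sum_mono)
        fix x y assume "x \<in> V" "y \<in> V"
        then show "(if \<not> tame t g x y then st x * Pn g x y else 0) \<le> (if conc g x y then st x * Pn g x y else 0)"
          using thr_pos[of x y g] st_nonneg[of x] Pn_nonneg[of g x y] by (auto simp: tame_def conc_def)
      qed
      finally show ?thesis using low[of g] True by simp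
    next
      case False
      \<comment> \<open>Only the gaps 1 and \<open>t\<close> remain: the former is always tame, and
        for the latter \<open>tame\<close> is vacuous.\<close>
      have "{f\<in>FS V t. \<not> tame t g (f i) (f (i + g))} = {}"
      proof (cases "g = 1")
        case True
        show ?thesis unfolding tame_def True using P_le_thr Pn_1 FS_mem[of _ V t i] FS_mem[of _ V t "i + 1"] ig True by fastforce
      next
        case False then show ?thesis using \<open>\<not> (2 \<le> g \<and> g < t)\<close> ig unfolding tame_def by auto
      qed
      then show ?thesis using eps by (simp only: sum.empty)
    qed
  qed
  also have "(\<Sum>f\<in>(\<Union>p\<in>?I. ?col p). W t f) \<le> (\<Sum>p\<in>?I. sum (W t) (?col p))"
    by (rule sum_UN_le) (use finI fin W_nonneg in \<open>auto simp: split_beta\<close>)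
  also have "\<dots> \<le> (\<Sum>p\<in>?I. 2 / \<kappa>)"
  proof (rule sum_mono, clarify)
    fix i g assume ig: "1 \<le> g" "i + g \<le> t"
    obtain g' where g': "g = Suc g'" using ig by (cases g) auto
    have "sum (W t) {f\<in>FS V t. f i = f (i + g)} \<le> (\<Sum>x\<in>V. \<Sum>y\<in>V. if x = y then st x * Pn g x y else 0)"
      by (rule walk_pair_event_le[OF ig(2)])
    also have "\<dots> = (\<Sum>x\<in>V. st x * Pn g x x)" using finV by (intro sum.cong) auto
    also have "\<dots> \<le> (\<Sum>x\<in>V. st x * (2 / (\<kappa> * \<rho>)))"
      unfolding g' using Pn_le st_nonneg by (intro sum_mono mult_left_mono) auto
    also have "\<dots> = 2 / (\<kappa> * \<rho>)" unfolding sum_distrib_right[symmetric] using st_sum by simp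
    also have "\<dots> \<le> 2 / \<kappa>" using \<kappa>1 \<rho>1 by (intro divide_left_mono) (auto simp: mult_le_cancel_left1)
    finally show "sum (W t) {f\<in>FS V t. f i = f (i + g)} \<le> 2 / \<kappa>" .
  qed
  finally have "prob_conc t \<le> sum (W t) {f\<in>FS V t. good_walk t f} + (real (card ?I) * (\<epsilon>' + 2 / \<kappa>))"
    by (simp add: algebra_simps)
  also have "real (card ?I) * (\<epsilon>' + 2 / \<kappa>) \<le> real (b\<^sup>2) * (\<epsilon>' + 2 / \<kappa>)"
    using cardI eps(2) \<kappa>1 by (intro mult_right_mono) (auto simp del: of_nat_power)
  finally show ?thesis using \<epsilon> eps by linarith
qed

text \<open>The thresholds multiply along consecutive gaps, each fixed intermediate vertex costing \<open>2 / \<kappa>\<close>.\<close>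

lemma gap_bound:
  assumes "finite S" "0 \<notin> S" "\<And>i. i \<in> insert 0 S \<Longrightarrow> z i \<in> V"
    "\<And>i l. i \<in> insert 0 S \<Longrightarrow> l \<in> S \<Longrightarrow> i < l \<Longrightarrow> Pn (l - i) (z i) (z l) \<le> 2 * thr (l - i) (z i) (z l)"
  shows "(\<Sum>f\<in>{f\<in>FS V (Max (insert 0 S)). agree (insert 0 S) z f}. W (Max (insert 0 S)) f) \<le>
    st (z 0) * (2 / \<kappa>) ^ card S * (sq (z (Max (insert 0 S))) / (sq (z 0) * \<rho> ^ Max (insert 0 S)))"
  using assms
proof (induction S rule: finite_linorder_max_induct)
  case empty
  have "{f\<in>FS V 0. agree {0} z f} = {f\<in>FS V 0. f 0 = z 0}" by (auto simp: agree_def)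
  then show ?case using walk_marginal[of "z 0" 0] empty sq_pos[of "z 0"] by simp
next
  case (insert c A)
  define j where "j = Max (insert 0 A)"
  have jin: "j \<in> insert 0 A" unfolding j_def using insert.hyps by (intro Max_in) auto
  have jc: "j < c" using jin insert.hyps insert.prems(1) by (auto simp: gr0I)
  define g where "g = c - j"
  have c: "c = j + g" using jc g_def by simp
  have mx: "Max (insert 0 (insert c A)) = c"
    using insert.hyps by (intro Max_eqI) auto
  have zV: "z j \<in> V" "z c \<in> V" "z 0 \<in> V" using insert.prems jin by auto
  have set: "{f\<in>FS V c. agree (insert 0 (insert c A)) z f} = {f\<in>FS V (j + g). (agree (insert 0 A) z f \<and> f j = z j) \<and> f (j + g) = z c}"
    using jin c by (auto simp: agree_def)
  have set': "{f\<in>FS V j. agree (insert 0 A) z f \<and> f j = z j} = {f\<in>FS V j. agree (insert 0 A) z f}"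
    using jin by (auto simp: agree_def)
  have inv: "agree (insert 0 A) z (f(i := y)) = agree (insert 0 A) z f" if "i > j" for f i y
    using that insert.hyps unfolding j_def by (intro agree_upd) auto
  have "sum (W c) {f\<in>FS V c. agree (insert 0 (insert c A)) z f} =
    sum (W j) {f\<in>FS V j. agree (insert 0 A) z f} * Pn g (z j) (z c)"
    unfolding set set'[symmetric] using walk_split[of "z c" j "agree (insert 0 A) z" g "z j"] inv zV c by simp
  also have "\<dots> \<le> (st (z 0) * (2 / \<kappa>) ^ card A * (sq (z j) / (sq (z 0) * \<rho> ^ j))) * (2 * thr g (z j) (z c))"
  proof (rule mult_mono)
    show "sum (W j) {f\<in>FS V j. agree (insert 0 A) z f} \<le> st (z 0) * (2 / \<kappa>) ^ card A * (sq (z j) / (sq (z 0) * \<rho> ^ j))"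
      unfolding j_def by (rule insert.IH) (use insert.prems in auto)
    show "Pn g (z j) (z c) \<le> 2 * thr g (z j) (z c)" unfolding g_def using insert.prems jin jc by auto
    show "0 \<le> st (z 0) * (2 / \<kappa>) ^ card A * (sq (z j) / (sq (z 0) * \<rho> ^ j))"
      using st_nonneg \<kappa>\<rho>_pos sq_pos[OF zV(1)] sq_pos[OF zV(3)] by simp
  qed (rule Pn_nonneg)
  \<comment> \<open>The factor \<open>sq (z j)\<close> cancels and the powers of
    \<open>\<rho>\<close> add up, while every gap brings its own
    \<open>1 / \<kappa>\<close>.\<close>
  also have "\<dots> = st (z 0) * (2 / \<kappa>) ^ card (insert c A) * (sq (z c) / (sq (z 0) * \<rho> ^ c))"
  proof -
    have "c \<notin> A" using insert.hyps by auto
    then show ?thesis unfolding thr_def c power_add using insert.hyps sq_pos[OF zV(1)] sq_pos[OF zV(3)] \<kappa>\<rho>_pos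
      by (simp add: field_simps)
  qed
  finally show ?case unfolding mx .
qed

text \<open>The last gap closes the telescoping product of thresholds to \<open>thr t u y\<close>,
  the quantity that \<open>conc\<close> compares with \<open>Pn t u y\<close>. \<open>S\<close> must
  be nonempty: otherwise the only gap has length \<open>t\<close>, where tameness gives no upper
  bound.\<close>

lemma gap_bound_ends:
  assumes S: "S \<subseteq> {1..<t}" "S \<noteq> {}" and z: "\<And>i. i \<in> S \<Longrightarrow> z i \<in> V" and u: "u \<in> V" and y: "y \<in> V"
    and tame: "\<And>i. i \<in> S \<Longrightarrow> tame t i u (z i)" "\<And>i. i \<in> S \<Longrightarrow> tame t (t - i) (z i) y"
      "\<And>i l. i \<in> S \<Longrightarrow> l \<in> S \<Longrightarrow> i < l \<Longrightarrow> tame t (l - i) (z i) (z l)"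
  shows "sum (W t) {f\<in>FS V t. f 0 = u \<and> f t = y \<and> agree S z f} \<le>
    st u * (2 / \<kappa>) ^ card S * (2 * thr t u y)"
proof -
  define z' where "z' = z(0 := u)"
  define j where "j = Max (insert 0 S)"
  have S0: "0 \<notin> S" and finS: "finite S" using S by (auto intro: finite_subset)
  have z'S: "z' i = z i" if "i \<in> S" for i using that S0 by (auto simp: z'_def)
  have jS: "j \<in> S"
  proof -
    have "j \<in> insert 0 S" unfolding j_def using finS by (intro Max_in) auto
    moreover obtain s where "s \<in> S" using S by auto
    then have "j \<ge> s" "s \<ge> 1" unfolding j_def using finS S by auto
    ultimately show ?thesis by auto
  qed
  have jt: "1 \<le> j" "j < t" using jS S by auto
  define g where "g = t - j"
  have t: "t = j + g" using jt g_def by simp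
  have set: "{f\<in>FS V t. f 0 = u \<and> f t = y \<and> agree S z f} = {f\<in>FS V (j + g). (agree (insert 0 S) z' f \<and> f j = z' j) \<and> f (j + g) = y}"
    using jS t z'S by (auto simp: agree_def z'_def)
  have set': "{f\<in>FS V j. agree (insert 0 S) z' f \<and> f j = z' j} = {f\<in>FS V j. agree (insert 0 S) z' f}"
    using jS by (auto simp: agree_def)
  have inv: "agree (insert 0 S) z' (f(i := y)) = agree (insert 0 S) z' f" if "i > j" for f i y
    using that finS unfolding j_def by (intro agree_upd) auto
  have gap: "sum (W j) {f\<in>FS V j. agree (insert 0 S) z' f} \<le> st (z' 0) * (2 / \<kappa>) ^ card S * (sq (z' j) / (sq (z' 0) * \<rho> ^ j))"
    unfolding j_def
  proof (rule gap_bound[OF finS S0])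
    show "z' i \<in> V" if "i \<in> insert 0 S" for i using that z u by (auto simp: z'_def)
    fix i l assume il: "i \<in> insert 0 S" "l \<in> S" "i < l"
    have "l < t" using il S by auto
    then show "Pn (l - i) (z' i) (z' l) \<le> 2 * thr (l - i) (z' i) (z' l)"
      using tame(1)[of l] tame(3)[of i l] il S0 by (auto simp: z'_def tame_def)
  qed
  have "sum (W t) {f\<in>FS V t. f 0 = u \<and> f t = y \<and> agree S z f} =
    sum (W j) {f\<in>FS V j. agree (insert 0 S) z' f} * Pn g (z' j) y"
    unfolding set set'[symmetric] using walk_split[of y j "agree (insert 0 S) z'" g "z' j"] inv y t by simp
  also have "\<dots> \<le> (st (z' 0) * (2 / \<kappa>) ^ card S * (sq (z' j) / (sq (z' 0) * \<rho> ^ j))) * (2 * thr g (z' j) y)"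
  proof (rule mult_mono[OF gap _ _ Pn_nonneg])
    show "Pn g (z' j) y \<le> 2 * thr g (z' j) y"
      using tame(2)[OF jS] z'S[OF jS] jt unfolding g_def tame_def by auto
    show "0 \<le> st (z' 0) * (2 / \<kappa>) ^ card S * (sq (z' j) / (sq (z' 0) * \<rho> ^ j))"
      using st_nonneg \<kappa>\<rho>_pos sq_pos[OF u] sq_pos[OF z[OF jS]] z'S[OF jS] by (simp add: z'_def)
  qed
  also have "\<dots> = st u * (2 / \<kappa>) ^ card S * (2 * thr t u y)"
    using sq_pos[OF u] sq_pos[OF z[OF jS]] z'S[OF jS] \<kappa>\<rho>_pos unfolding thr_def t power_add
    by (simp add: z'_def field_simps)
  finally show ?thesis .
qed

end

section \<open>Zigzag walks\<close>

text \<open>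
  \<open>Ys\<close> and \<open>Zs\<close> are the admissible pairs of the start vertex with the vertex at time \<open>t - 1\<close> and \<open>t\<close>.
  After time \<open>t\<close> the walk moves back and forth between these two levels, along the
  reversible chain with edge weights \<open>q\<close>.
\<close>

locale zigzag = walk_graph +
  fixes t :: nat and Ys Zs :: "('a \<times> 'a) set" and c2 :: real
  assumes t2: "2 \<le> t" and tb: "t \<le> b" and c2: "0 < c2" "c2 \<le> 1"
    and Ylow: "\<And>u y. (u, y) \<in> Ys \<Longrightarrow> c2 * (st u * Pn (t - 1) u y) \<le>
      (\<Sum>f\<in>{f\<in>{f\<in>FS V t. good_walk t f}. (f 0, f (t - 1)) \<in> Ys \<and> (f 0, f t) \<in> Zs \<and> (f 0, f (t - 1)) = (u, y)}. W t f)"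
    and Zlow: "\<And>u y. (u, y) \<in> Zs \<Longrightarrow> c2 * (st u * Pn t u y) \<le>
      (\<Sum>f\<in>{f\<in>{f\<in>FS V t. good_walk t f}. (f 0, f (t - 1)) \<in> Ys \<and> (f 0, f t) \<in> Zs \<and> (f 0, f t) = (u, y)}. W t f)"
begin

section \<open>The zigzag chain between the two levels\<close>

definition adm :: "(nat \<Rightarrow> 'a) \<Rightarrow> bool" where
  "adm f \<longleftrightarrow> good_walk t f \<and> (f 0, f (t - 1)) \<in> Ys \<and> (f 0, f t) \<in> Zs"

definition q :: "'a \<Rightarrow> 'a \<Rightarrow> 'a \<Rightarrow> real" where
  "q u y z = sum (W t) {f\<in>FS V t. adm f \<and> f 0 = u \<and> f (t - 1) = y \<and> f t = z}"

text \<open>For fixed \<open>u\<close>, \<open>q u\<close> weights the edges of a bipartite graph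
  between the levels \<open>t - 1\<close> and \<open>t\<close>; \<open>Yw\<close> and
  \<open>Zw\<close> are the weighted degrees, hence reversing measures for the zigzag.\<close>

definition Yw :: "'a \<Rightarrow> 'a \<Rightarrow> real" where "Yw u y = (\<Sum>z\<in>V. q u y z)"
definition Zw :: "'a \<Rightarrow> 'a \<Rightarrow> real" where "Zw u z = (\<Sum>y\<in>V. q u y z)"

text \<open>At times of even distance from \<open>t\<close> the walk is on level \<open>t\<close>
  and steps back; otherwise it steps forward. Division by zero gives a zero row at vertices of
  weighted degree zero.\<close>

definition Kz :: "nat \<Rightarrow> 'a \<Rightarrow> 'a \<Rightarrow> 'a \<Rightarrow> real" where
  "Kz l u x y = (if even (l - t) then q u y x / Zw u x else q u x y / Yw u x)"

text \<open>Unnormalised law of the zigzag from \<open>u\<close> at time \<open>l\<close>; since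
  weighted degrees are preserved by the steps, it merely alternates between the two levels.\<close>

definition Mz :: "'a \<Rightarrow> nat \<Rightarrow> 'a \<Rightarrow> real" where
  "Mz u l x = (if even (l - t) then Zw u x else Yw u x)"

definition zw :: "nat \<Rightarrow> (nat \<Rightarrow> 'a) \<Rightarrow> real" where
  "zw l f = (if adm f then W t f * (\<Prod>i=t..<l. Kz i (f 0) (f i) (f (Suc i))) else 0)"

text \<open>The 16 is \<open>2 * 2 * 4\<close>: two thresholds exceeded by at most a factor 2, and
  the factor 4 in \<open>conc\<close>. The forward steps, which need only 2, share the constant so
  that both costs are \<open>C1\<close> over a power.\<close>

definition cK :: real where "cK = 16 / (c2 * \<kappa>)"
definition cF :: real where "cF = 16 / (c2 * (\<kappa> * \<rho>))"

text \<open>Price of prescribing the vertex at time \<open>l\<close>, whether it is reached from the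
  time before or, in the reversed chain, from the time after. The cheap times are those on level
  \<open>t\<close>, reached by forward steps from either side; for \<open>l < b\<close> they are the
  positions collected in \<open>F_set\<close>.\<close>

definition cost :: "nat \<Rightarrow> real" where
  "cost l = (if t \<le> l \<and> even (l - t) then cF else cK)"

lemma cKF: "0 < cF" "cF \<le> cK" "0 < cK" "2 / (\<kappa> * \<rho>) \<le> cF"
proof -
  show "0 < cF" "0 < cK" unfolding cF_def cK_def using c2 \<kappa>\<rho>_pos by auto
  have "\<kappa> \<le> \<kappa> * \<rho>" using \<kappa>1 \<rho>1 by (simp add: mult_le_cancel_left1)
  then show "cF \<le> cK" unfolding cF_def cK_def using c2 \<kappa>\<rho>_pos by (intro divide_left_mono mult_left_mono) auto
  have "2 * c2 \<le> 16" using c2 by simp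
  then show "2 / (\<kappa> * \<rho>) \<le> cF" unfolding cF_def using c2 \<kappa>\<rho>_pos by (simp add: field_simps)
qed

lemma cost_bounds: "0 < cost l" "cost l \<le> cK" "0 \<le> cost l"
  unfolding cost_def using cKF by auto

lemma finFS: "finite {f\<in>FS V l. Q f}" using finite_FS[OF finV] by auto

lemma q_nonneg: "0 \<le> q u y z" unfolding q_def by (intro sum_nonneg W_nonneg)
lemma Yw_nonneg: "0 \<le> Yw u y" unfolding Yw_def by (intro sum_nonneg q_nonneg)
lemma Zw_nonneg: "0 \<le> Zw u y" unfolding Zw_def by (intro sum_nonneg q_nonneg)

lemma Yw_eq: "Yw u y = sum (W t) {f\<in>FS V t. adm f \<and> f 0 = u \<and> f (t - 1) = y}"
  unfolding Yw_def q_def by (subst sum_FS_group[OF finV, of t]) (auto intro!: sum.cong)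

lemma Zw_eq: "Zw u z = sum (W t) {f\<in>FS V t. adm f \<and> f 0 = u \<and> f t = z}"
  unfolding Zw_def q_def by (subst sum_FS_group[OF finV, of "t - 1"]) (auto intro!: sum.cong)

lemma Ylow': "(u, y) \<in> Ys \<Longrightarrow> c2 * (st u * Pn (t - 1) u y) \<le> Yw u y"
  unfolding Yw_eq by (rule order_trans[OF Ylow], assumption, rule sum_mono2[OF finFS]) (auto simp: adm_def W_nonneg)

lemma Zlow': "(u, y) \<in> Zs \<Longrightarrow> c2 * (st u * Pn t u y) \<le> Zw u y"
  unfolding Zw_eq by (rule order_trans[OF Zlow], assumption, rule sum_mono2[OF finFS]) (auto simp: adm_def W_nonneg)

lemma q_pos_E:
  assumes "q u y z \<noteq> 0"
  obtains f where "f \<in> FS V t" "adm f" "f 0 = u" "f (t - 1) = y" "f t = z" "W t f \<noteq> 0"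
proof -
  have "\<exists>f\<in>{f\<in>FS V t. adm f \<and> f 0 = u \<and> f (t - 1) = y \<and> f t = z}. W t f \<noteq> 0"
    using assms unfolding q_def by (metis (no_types, lifting) sum.neutral)
  then show ?thesis using that by auto
qed

lemma walk_last_two:
  assumes "y \<in> V" "z \<in> V"
  shows "sum (W t) {f\<in>FS V t. f 0 = u \<and> f (t - 1) = y \<and> f t = z} \<le> st u * Pn (t - 1) u y * P y z"
proof (cases "u \<in> V")
  case True
  obtain s where s: "t = Suc s" "s \<ge> 1" using t2 by (cases t) auto
  have "sum (W (s + 1)) {f\<in>FS V (s + 1). (f 0 = u \<and> f s = y) \<and> f (s + 1) = z} =
    sum (W s) {f\<in>FS V s. f 0 = u \<and> f s = y} * Pn 1 y z"
    by (rule walk_split) (use assms s in auto)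
  moreover have "sum (W s) {f\<in>FS V s. f 0 = u \<and> f s = y} = st u * Pn s u y"
    using walk_pair[of u y 0 s] True assms by simp
  ultimately show ?thesis using Pn_1[OF assms(1)] by (simp add: s conj_assoc del: Pn.simps)
next
  case False
  then have "{f\<in>FS V t. f 0 = u \<and> f (t - 1) = y \<and> f t = z} = {}" using FS_mem by blast
  then show ?thesis using st_nonneg Pn_nonneg P_nonneg by (simp only: sum.empty) simp
qed

lemma q_le_walk: "y \<in> V \<Longrightarrow> z \<in> V \<Longrightarrow> q u y z \<le> st u * Pn (t - 1) u y * P y z"
  unfolding q_def by (rule order_trans[OF sum_mono2 walk_last_two]) (auto intro!: finFS W_nonneg)

lemma thr_mult: "u \<in> V \<Longrightarrow> y \<in> V \<Longrightarrow> z \<in> V \<Longrightarrow> thr (t - 1) u y * thr 1 y z = thr t u z / \<kappa>"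
proof -
  assume V: "u \<in> V" "y \<in> V" "z \<in> V"
  obtain s where s: "t = Suc s" using t2 by (cases t) auto
  show ?thesis unfolding thr_def s using sq_pos[OF V(1)] sq_pos[OF V(2)] \<kappa>\<rho>_pos by (simp add: field_simps)
qed

text \<open>A forward step has probability at most \<open>2 / (\<kappa> * \<rho>)\<close> in the
  plain walk, and passing to admissible walks shrinks the mass at \<open>y\<close> by at most the
  factor \<open>c2\<close>.\<close>

lemma q_le_Y:
  assumes "y \<in> V" "z \<in> V"
  shows "q u y z \<le> cF * Yw u y"
proof (cases "q u y z = 0")
  case True then show ?thesis using Yw_nonneg cKF by simp
next
  case False
  then have "(u, y) \<in> Ys" using q_pos_E unfolding adm_def by metis
  then have Y: "c2 * (st u * Pn (t - 1) u y) \<le> Yw u y" by (rule Ylow')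
  have "q u y z \<le> (st u * Pn (t - 1) u y) * P y z" using q_le_walk[OF assms] by simp
  also have "\<dots> \<le> (Yw u y / c2) * (2 / (\<kappa> * \<rho>))"
    using Y c2 P_le[OF assms(1)] P_nonneg Yw_nonneg by (intro mult_mono) (auto simp: field_simps)
  also have "\<dots> \<le> cF * Yw u y"
    unfolding cF_def using Yw_nonneg[of u y] c2 \<kappa>\<rho>_pos by (simp add: field_simps)
  finally show ?thesis .
qed

text \<open>Here concentration is used. A walk to \<open>z\<close> through \<open>y\<close> is a
  tame stretch of length \<open>t - 1\<close> followed by one step, so its mass is at most
  \<open>4 * st u * thr t u z / \<kappa>\<close>: two thresholds carry one
  \<open>1 / \<kappa>\<close> more than one. By \<open>conc\<close>, and up to constants, all walks
  from \<open>u\<close> to \<open>z\<close> have mass at least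
  \<open>st u * thr t u z\<close>.\<close>

lemma q_le_Z:
  assumes "u \<in> V" "y \<in> V" "z \<in> V"
  shows "q u y z \<le> cK * Zw u z"
proof (cases "q u y z = 0")
  case True then show ?thesis using Zw_nonneg cKF by simp
next
  case False
  then obtain f where f: "f \<in> FS V t" "adm f" "f 0 = u" "f (t - 1) = y" "f t = z" using q_pos_E by metis
  have Z: "c2 * (st u * Pn t u z) \<le> Zw u z" using f Zlow' unfolding adm_def by auto
  have conc: "thr t u z / 4 \<le> Pn t u z" using f unfolding adm_def good_walk_def conc_def by auto
  have "tame t (t - 1) (f 0) (f (0 + (t - 1)))"
    using f(2) t2 unfolding adm_def good_walk_def by (metis add_0 diff_le_self le_diff_conv2 one_add_one add_leD2)
  then have tame: "Pn (t - 1) u y \<le> 2 * thr (t - 1) u y" using f t2 unfolding tame_def by auto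
  have "q u y z \<le> st u * Pn (t - 1) u y * P y z" using q_le_walk assms by simp
  also have "\<dots> \<le> st u * (2 * thr (t - 1) u y) * (2 * thr 1 y z)"
    using tame P_le_thr[of y z] assms st_nonneg Pn_nonneg P_nonneg thr_pos[of u y "t - 1"]
    by (intro mult_mono mult_left_mono) auto
  also have "\<dots> = 4 * st u * (thr (t - 1) u y * thr 1 y z)" by simp
  also have "\<dots> = 16 / \<kappa> * (st u * (thr t u z / 4))" unfolding thr_mult[OF assms] by simp
  also have "\<dots> \<le> 16 / \<kappa> * (st u * Pn t u z)"
    using conc st_nonneg \<kappa>\<rho>_pos by (intro mult_left_mono) auto
  also have "\<dots> \<le> 16 / \<kappa> * (Zw u z / c2)"
    using Z c2 \<kappa>\<rho>_pos by (intro mult_left_mono) (auto simp: field_simps)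
  also have "\<dots> = cK * Zw u z" unfolding cK_def by simp
  finally show ?thesis .
qed

lemma Mz_nonneg: "0 \<le> Mz u l x" unfolding Mz_def using Yw_nonneg Zw_nonneg by simp

lemma Zw_zero: "Zw u z = 0 \<Longrightarrow> y \<in> V \<Longrightarrow> q u y z = 0"
  unfolding Zw_def using sum_nonneg_eq_0_iff[OF finV, of "\<lambda>y. q u y z"] q_nonneg by auto

lemma Yw_zero: "Yw u y = 0 \<Longrightarrow> z \<in> V \<Longrightarrow> q u y z = 0"
  unfolding Yw_def using sum_nonneg_eq_0_iff[OF finV, of "q u y"] q_nonneg by auto

lemma Mz_Kz: "x \<in> V \<Longrightarrow> y \<in> V \<Longrightarrow> Mz u l x * Kz l u x y = (if even (l - t) then q u y x else q u x y)"
  unfolding Mz_def Kz_def using Zw_zero[of u x y] Yw_zero[of u x y] by auto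

lemma Mz_step: "t \<le> l \<Longrightarrow> y \<in> V \<Longrightarrow> (\<Sum>x\<in>V. Mz u l x * Kz l u x y) = Mz u (Suc l) y"
  by (simp add: Mz_Kz Suc_diff_le) (simp add: Mz_def Yw_def Zw_def Suc_diff_le)

text \<open>\<open>Mz\<close> times \<open>Kz\<close> is an edge weight \<open>q\<close>, which does
  not depend on the direction of the step; comparing it with the weighted degree at the far end
  bounds the reversed transition.\<close>

lemma Mz_reverse_cost: "t \<le> l \<Longrightarrow> u \<in> V \<Longrightarrow> x \<in> V \<Longrightarrow> y \<in> V \<Longrightarrow> Mz u l x * Kz l u x y \<le> cost l * Mz u (Suc l) y"
  using q_le_Y[of y x u] q_le_Z[of u x y] unfolding Mz_Kz
  by (auto simp: Mz_def Suc_diff_le cost_def)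

lemma Kz_le: "t \<le> l \<Longrightarrow> u \<in> V \<Longrightarrow> x \<in> V \<Longrightarrow> y \<in> V \<Longrightarrow> Kz l u x y \<le> cost (Suc l)"
proof -
  assume a: "t \<le> l" "u \<in> V" "x \<in> V" "y \<in> V"
  have div: "c \<le> d * e \<Longrightarrow> 0 \<le> d \<Longrightarrow> 0 \<le> e \<Longrightarrow> c / e \<le> d" for c d e :: real
    by (cases "e = 0") (auto simp: divide_le_eq)
  show ?thesis
    using a q_le_Y[of x y u] q_le_Z[of u y x] cKF Zw_nonneg Yw_nonneg
    by (auto simp: Kz_def cost_def Suc_diff_le intro!: div)
qed

lemma adm_upd: "i > t \<Longrightarrow> adm (f(i := y)) = adm f"
  unfolding adm_def good_walk_def by auto

lemma W_upd: "i > l \<Longrightarrow> W l (f(i := y)) = W l f"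
  unfolding W_def by (auto intro!: prod.cong)

sublocale zz: chain V zw Kz t
proof
  show "finite V" by (rule finV)
  show K0: "0 \<le> Kz l u x y" for l u x y unfolding Kz_def using q_nonneg Yw_nonneg Zw_nonneg by auto
  show "(\<Sum>y\<in>V. Kz l u x y) \<le> 1" for l u x
    by (cases "even (l - t)") (simp_all only: Kz_def if_True if_False sum_divide_distrib[symmetric] Yw_def[symmetric] Zw_def[symmetric], simp_all)
  show "zw (Suc l) (f(Suc l := y)) = zw l f * Kz l (f 0) (f l) y" if "t \<le> l" for l f y
    using that by (auto simp: zw_def adm_upd W_upd intro!: prod.cong)
  show "0 \<le> zw t f" for f unfolding zw_def using W_nonneg by simp
qed

lemma zw_t: "zw t f = (if adm f then W t f else 0)" unfolding zw_def by simp

lemma zw_t_sum: "sum (zw t) {f\<in>FS V t. Q f} = sum (W t) {f\<in>FS V t. Q f \<and> adm f}"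
  unfolding zw_t by (subst sum.inter_filter[OF finFS, symmetric]) (auto intro!: sum.cong)

section \<open>Mass of the zigzag, and its spread given both ends\<close>

definition pz :: "'a \<Rightarrow> 'a \<Rightarrow> real" where
  "pz u v = sum (zw b) {f\<in>FS V b. f 0 = u \<and> f b = v}"

lemma pz_eq: "v \<in> V \<Longrightarrow> pz u v = Mz u b v"
proof -
  assume v: "v \<in> V"
  have "sum (zw b) {f\<in>FS V b. f 0 \<in> {u} \<and> f b = v} = Mz u b v"
  proof (rule zz.marginal_eq[of "{u}" "\<lambda>l. Kz l u"])
    show "sum (zw t) {f\<in>FS V t. f 0 \<in> {u} \<and> f t = y} = Mz u t y" for y
      unfolding zw_t_sum by (simp add: Mz_def Zw_eq conj_ac)
  qed (use v tb Mz_step in auto)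
  then show ?thesis by (simp add: pz_def)
qed

text \<open>No mass is lost after time \<open>t\<close>: vertices with a zero row carry none, and
  \<open>Yw\<close> and \<open>Zw\<close> have the same total.\<close>

lemma zw_mass: "(\<Sum>f\<in>FS V b. zw b f) = sum (W t) {f\<in>FS V t. adm f}"
proof -
  have "(\<Sum>f\<in>FS V b. zw b f) = (\<Sum>u\<in>V. \<Sum>v\<in>V. pz u v)"
    using sum_FS_group[OF finV, of 0 b "zw b" "\<lambda>_. True"] sum_FS_group[OF finV, of b b "zw b" "\<lambda>f. f 0 = _"]
    by (simp add: pz_def)
  also have "\<dots> = (\<Sum>u\<in>V. \<Sum>v\<in>V. Mz u b v)" using pz_eq by simp
  also have "\<dots> = (\<Sum>u\<in>V. \<Sum>v\<in>V. Zw u v)"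
  proof -
    have "(\<Sum>v\<in>V. Yw u v) = (\<Sum>v\<in>V. Zw u v)" for u unfolding Yw_def Zw_def by (rule sum.swap)
    then show ?thesis by (cases "even (b - t)") (simp_all only: Mz_def if_True if_False)
  qed
  also have "\<dots> = sum (W t) {f\<in>FS V t. adm f}"
  proof -
    have "sum (W t) {f\<in>FS V t. adm f} = (\<Sum>u\<in>V. \<Sum>f\<in>{f\<in>FS V t. adm f \<and> f 0 = u}. W t f)"
      by (rule sum_FS_group[OF finV]) simp
    also have "\<dots> = (\<Sum>u\<in>V. \<Sum>v\<in>V. \<Sum>f\<in>{f\<in>FS V t. (adm f \<and> f 0 = u) \<and> f t = v}. W t f)"
      by (intro sum.cong refl sum_FS_group[OF finV]) simp
    finally show ?thesis by (simp add: Zw_eq conj_ac)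
  qed
  finally show ?thesis .
qed

lemma zw_nonneg: "f \<in> FS V b \<Longrightarrow> 0 \<le> zw b f"
  using zz.weight_nonneg tb by simp

lemma zw_mass_le: "t \<le> l \<Longrightarrow> (\<Sum>f\<in>FS V l. zw l f) \<le> 1"
proof -
  assume l: "t \<le> l"
  have "(\<Sum>f\<in>FS V l. zw l f) \<le> (\<Sum>f\<in>FS V t. zw t f)"
    using zz.total_le[of t l "\<lambda>_. True"] l by simp
  also have "\<dots> \<le> (\<Sum>f\<in>FS V t. W t f)" unfolding zw_t using W_nonneg by (intro sum_mono) auto
  also have "\<dots> = (\<Sum>y\<in>V. st y)"
    using sum_FS_group[OF finV, of t t "W t" "\<lambda>_. True"] walk_marginal by simp
  finally show ?thesis using st_sum by simp
qed

lemma zw_edges: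
  assumes "f \<in> FS V b" "zw b f \<noteq> 0" "i < b"
  shows "{f i, f (Suc i)} \<in> E"
proof (cases "i < t")
  case True
  have "W t f \<noteq> 0" using assms unfolding zw_def by (auto split: if_splits)
  then have "P (f i) (f (Suc i)) \<noteq> 0" using True unfolding W_def by auto
  then show ?thesis unfolding P_def by (auto split: if_splits)
next
  case False
  \<comment> \<open>After time \<open>t\<close> a step needs a nonzero \<open>q\<close>, and then
    its edge is the last edge of an actual walk of length \<open>t\<close>.\<close>
  have "Kz i (f 0) (f i) (f (Suc i)) \<noteq> 0" using assms False unfolding zw_def by (auto split: if_splits)
  then have "q (f 0) (f (Suc i)) (f i) \<noteq> 0 \<or> q (f 0) (f i) (f (Suc i)) \<noteq> 0" unfolding Kz_def by (auto split: if_splits)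
  moreover have "{y, z} \<in> E" if nz: "q u y z \<noteq> 0" for u y z
  proof -
    obtain g where g: "g (t - 1) = y" "g t = z" "W t g \<noteq> 0" by (rule q_pos_E[OF nz])
    obtain s where s: "t = Suc s" using t2 by (cases t) auto
    have "P (g s) (g (Suc s)) \<noteq> 0" using g(3) unfolding W_def s by simp
    then show ?thesis using g s unfolding P_def by (auto split: if_splits)
  qed
  ultimately show ?thesis by (metis insert_commute)
qed

text \<open>This is the reverse estimate at time \<open>t\<close>, before which the weight is not
  Markovian. The product of thresholds from \<open>gap_bound_ends\<close> is compared with
  \<open>Zw u y\<close> through \<open>conc\<close> and the retained fraction
  \<open>c2\<close>.\<close>

lemma initial_bound:
  assumes y: "y \<in> V" and u: "u \<in> V" and S: "S \<subseteq> {1..<t}"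
  shows "sum (zw t) {f\<in>FS V t. (f 0 \<in> {u} \<and> agree S z f) \<and> f t = y} \<le> cK ^ card S * Mz u t y"
proof (cases "S = {} \<or> {f\<in>FS V t. f 0 = u \<and> f t = y \<and> agree S z f \<and> adm f} = {}")
  case True
  then show ?thesis
  proof
    assume "S = {}"
    then show ?thesis unfolding zw_t_sum by (simp add: Mz_def Zw_eq agree_def conj_ac)
  next
    assume e: "{f\<in>FS V t. f 0 = u \<and> f t = y \<and> agree S z f \<and> adm f} = {}"
    have "{f\<in>FS V t. ((f 0 \<in> {u} \<and> agree S z f) \<and> f t = y) \<and> adm f} = {}" using e by blast
    then show ?thesis unfolding zw_t_sum using cKF Mz_nonneg by (simp only: sum.empty) simp
  qed
next
  case False
  \<comment> \<open>A single admissible walk through the prescribed vertices makes all their pairs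
    tame and its ends concentrated.\<close>
  then obtain f where f: "f \<in> FS V t" "f 0 = u" "f t = y" "agree S z f" "adm f" by auto
  have fz: "f i = z i" if "i \<in> S" for i using f that unfolding agree_def by auto
  have good: "tame t g (f i) (f (i + g))" if "1 \<le> g" "i + g \<le> t" for i g
    using f that unfolding adm_def good_walk_def by auto
  have "sum (zw t) {f\<in>FS V t. (f 0 \<in> {u} \<and> agree S z f) \<and> f t = y} \<le>
      sum (W t) {f\<in>FS V t. f 0 = u \<and> f t = y \<and> agree S z f}"
    unfolding zw_t_sum by (rule sum_mono2[OF finFS]) (auto intro: W_nonneg)
  also have "\<dots> \<le> st u * (2 / \<kappa>) ^ card S * (2 * thr t u y)"
  proof (rule gap_bound_ends[OF S _ _ u y])
    show "S \<noteq> {}" using False by auto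
    show "z i \<in> V" if "i \<in> S" for i using FS_mem[OF f(1), of i] fz[OF that] that S by auto
    show "tame t i u (z i)" if "i \<in> S" for i using good[of i 0] fz that S f by auto
    show "tame t (t - i) (z i) y" if "i \<in> S" for i
    proof -
      have "i < t" using that S by auto
      then show ?thesis using good[of "t - i" i] fz[OF that] f by simp
    qed
    show "tame t (l - i) (z i) (z l)" if "i \<in> S" "l \<in> S" "i < l" for i l
      using good[of "l - i" i] fz[of i] fz[of l] that S by auto
  qed
  also have "\<dots> = (2 / \<kappa>) ^ card S * 8 * (st u * (thr t u y / 4))" by simp
  also have "\<dots> \<le> (2 / \<kappa>) ^ card S * 8 * (Zw u y / c2)"
  proof (intro mult_left_mono)
    have "thr t u y / 4 \<le> Pn t u y" using f unfolding adm_def good_walk_def conc_def by auto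
    then have "c2 * (st u * (thr t u y / 4)) \<le> c2 * (st u * Pn t u y)"
      using c2 st_nonneg by (intro mult_left_mono) auto
    also have "\<dots> \<le> Zw u y" using Zlow' f unfolding adm_def by auto
    finally show "st u * (thr t u y / 4) \<le> Zw u y / c2" using c2 by (simp add: field_simps)
  qed (use \<kappa>\<rho>_pos in auto)
  also have "\<dots> = (2 / \<kappa>) ^ card S * (8 / c2) * Zw u y" by simp
  \<comment> \<open>As \<open>S\<close> is nonempty, the stray constant fits into the factors of
    \<open>cK\<close>; the exact identity for empty \<open>S\<close> was treated apart.\<close>
  also have "\<dots> \<le> (2 / \<kappa>) ^ card S * (8 / c2) ^ card S * Zw u y"
  proof (intro mult_right_mono mult_left_mono Zw_nonneg)
    have "card S \<ge> 1" using False S by (metis One_nat_def Suc_leI card_gt_0_iff finite_subset finite_atLeastLessThan)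
    moreover have "1 \<le> 8 / c2" using c2 by (simp add: field_simps)
    ultimately show "8 / c2 \<le> (8 / c2) ^ card S" using power_increasing[of 1 "card S" "8 / c2"] by simp
  qed (use \<kappa>\<rho>_pos in auto)
  also have "\<dots> = cK ^ card S * Mz u t y"
    unfolding cK_def by (simp add: Mz_def power_mult_distrib[symmetric] mult.commute)
  finally show ?thesis .
qed

lemma zw_reverse:
  assumes u: "u \<in> V" and y: "y \<in> V" and S: "0 \<notin> S" and m: "t \<le> m"
  shows "sum (zw m) {f\<in>FS V m. (f 0 \<in> {u} \<and> agree (S \<inter> {..<m}) z f) \<and> f m = y} \<le>
    (\<Prod>i\<in>S \<inter> {..<m}. cost i) * Mz u m y"
proof -
  have St: "S \<inter> {..<t} \<subseteq> {1..<t}" using S by (auto simp: Suc_le_eq intro: gr0I)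
  have "sum (zw m) {f\<in>FS V m. (f 0 \<in> {u} \<and> agree (S \<inter> {..<m}) z f) \<and> f m = y} \<le>
    cK ^ card (S \<inter> {..<t}) * (\<Prod>i\<in>S \<inter> {t..<m}. cost i) * Mz u m y"
    by (rule zz.reverse_bound[of "{u}" "\<lambda>l. Kz l u" "Mz u" cost])
       (use Mz_nonneg Mz_step Mz_reverse_cost cost_bounds cKF u initial_bound[OF _ u St] m y in auto)
  also have "cK ^ card (S \<inter> {..<t}) = (\<Prod>i\<in>S \<inter> {..<t}. cost i)"
    by (simp add: cost_def)
  also have "(\<Prod>i\<in>S \<inter> {..<t}. cost i) * (\<Prod>i\<in>S \<inter> {t..<m}. cost i) = (\<Prod>i\<in>S \<inter> {..<m}. cost i)"
  proof -
    have "(\<Prod>i\<in>S \<inter> {..<m}. cost i) = (\<Prod>i\<in>(S \<inter> {..<t}) \<union> (S \<inter> {t..<m}). cost i)"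
      using m by (intro prod.cong) auto
    also have "\<dots> = (\<Prod>i\<in>S \<inter> {..<t}. cost i) * (\<Prod>i\<in>S \<inter> {t..<m}. cost i)"
      by (rule prod.union_disjoint) auto
    finally show ?thesis by simp
  qed
  finally show ?thesis .
qed

text \<open>The bound from the reversed chain is relative to \<open>Mz u b v\<close>, which is
  \<open>pz u v\<close>. Dividing by it gives the conditional probability given both ends, however
  small \<open>pz u v\<close> may be.\<close>

lemma conditional_spread:
  assumes S: "S \<subseteq> {1..<b}" and uv: "u \<in> V" "v \<in> V"
  shows "sum (zw b) {f\<in>FS V b. f 0 = u \<and> f b = v \<and> agree S z f} \<le> (\<Prod>i\<in>S. cost i) * pz u v"
proof -
  have "S \<inter> {..<b} = S" "0 \<notin> S" using S by auto
  then show ?thesis using zw_reverse[OF uv, of S b z] tb pz_eq[OF uv(2)] by (simp add: conj_ac)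
qed

text \<open>The first edge carries flow at most \<open>1 / M\<close>, the next \<open>t - 1\<close>
  steps are plain forward steps, and each later step is charged to the time it reaches. This prices
  the path that a cycle fixes completely.\<close>

lemma zw_full_le:
  assumes f: "f \<in> FS V b"
  shows "zw b f \<le> 1 / M * (2 / (\<kappa> * \<rho>)) ^ (t - 1) * (\<Prod>l=Suc t..b. cost l)"
proof -
  have fV: "f i \<in> V" if "i \<le> b" for i using FS_mem[OF f that] .
  obtain s where s: "t = Suc s" using t2 by (cases t) auto
  have "W t f = (st (f 0) * P (f 0) (f 1)) * (\<Prod>i<s. P (f (Suc i)) (f (Suc (Suc i))))"
    unfolding W_def s by (subst prod.lessThan_Suc_shift) simp
  also have "\<dots> \<le> 1 / M * (2 / (\<kappa> * \<rho>)) ^ s"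
  proof (rule mult_mono)
    show "st (f 0) * P (f 0) (f 1) \<le> 1 / M" using flow_le fV by simp
    have "(\<Prod>i<s. P (f (Suc i)) (f (Suc (Suc i)))) \<le> (\<Prod>i<s. 2 / (\<kappa> * \<rho>))"
      using P_le P_nonneg fV s tb by (intro prod_mono) auto
    then show "(\<Prod>i<s. P (f (Suc i)) (f (Suc (Suc i)))) \<le> (2 / (\<kappa> * \<rho>)) ^ s" by simp
  qed (use M_pos P_nonneg in \<open>auto intro!: prod_nonneg\<close>)
  finally have Wt: "W t f \<le> 1 / M * (2 / (\<kappa> * \<rho>)) ^ (t - 1)" by (simp add: s)
  have "(\<Prod>i=t..<b. Kz i (f 0) (f i) (f (Suc i))) \<le> (\<Prod>i=t..<b. cost (Suc i))"
    using Kz_le fV zz.K_nonneg by (intro prod_mono) auto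
  also have "\<dots> = (\<Prod>l=Suc t..b. cost l)"
    using prod.shift_bounds_Suc_ivl[of cost t b] by (simp add: atLeastLessThanSuc_atLeastAtMost)
  finally have K: "(\<Prod>i=t..<b. Kz i (f 0) (f i) (f (Suc i))) \<le> (\<Prod>l=Suc t..b. cost l)" .
  have R: "0 \<le> 1 / M * (2 / (\<kappa> * \<rho>)) ^ (t - 1) * (\<Prod>l=Suc t..b. cost l)"
    using M_pos \<kappa>\<rho>_pos cost_bounds by (intro mult_nonneg_nonneg prod_nonneg) auto
  show ?thesis
  proof (cases "adm f")
    case True
    have "W t f * (\<Prod>i=t..<b. Kz i (f 0) (f i) (f (Suc i))) \<le>
      1 / M * (2 / (\<kappa> * \<rho>)) ^ (t - 1) * (\<Prod>l=Suc t..b. cost l)"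
      by (rule mult_mono[OF Wt K]) (use M_pos \<kappa>\<rho>_pos zz.K_nonneg in \<open>auto intro!: prod_nonneg\<close>)
    then show ?thesis unfolding zw_def using True by simp
  qed (use R in \<open>auto simp: zw_def\<close>)
qed

text \<open>Admissible walks have no repetition up to time \<open>t\<close>, so the later of two
  coinciding times exceeds \<open>t\<close>, and its vertex was drawn by a kernel bounded by
  \<open>cK\<close>.\<close>

lemma zw_noninjective:
  "sum (zw b) {f\<in>FS V b. \<not> inj_on f {..b}} \<le> real (b\<^sup>2) * cK"
proof -
  let ?I = "{(i, l). i < l \<and> t < l \<and> l \<le> b}"
  have Isub: "?I \<subseteq> {..<b} \<times> {1..b}" by auto
  then have finI: "finite ?I" by (rule finite_subset) auto
  have cardI: "card ?I \<le> b\<^sup>2" using card_mono[OF _ Isub] by (simp add: power2_eq_square card_cartesian_product)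
  have "sum (zw b) {f\<in>FS V b. \<not> inj_on f {..b}} = sum (zw b) {f\<in>FS V b. \<not> inj_on f {..b} \<and> adm f}"
    by (rule sum.mono_neutral_right[OF finFS]) (auto simp: zw_def)
  also have "\<dots> \<le> (\<Sum>f\<in>(\<Union>p\<in>?I. {f\<in>FS V b. f (fst p) = f (snd p)}). zw b f)"
  proof (rule sum_mono2)
    show "{f\<in>FS V b. \<not> inj_on f {..b} \<and> adm f} \<subseteq> (\<Union>p\<in>?I. {f\<in>FS V b. f (fst p) = f (snd p)})"
    proof
      fix f assume f: "f \<in> {f\<in>FS V b. \<not> inj_on f {..b} \<and> adm f}"
      then obtain i' l' where "i' \<noteq> l'" "i' \<le> b" "l' \<le> b" "f i' = f l'" unfolding inj_on_def by auto
      then obtain i l where il: "i < l" "l \<le> b" "f i = f l" by (metis linorder_neqE_nat)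
      have "t < l"
      proof (rule ccontr)
        assume "\<not> t < l"
        have "good_walk t f" using f unfolding adm_def by simp
        moreover have "1 \<le> l - i" "i + (l - i) \<le> t" using il \<open>\<not> t < l\<close> by auto
        ultimately have "f i \<noteq> f (i + (l - i))" unfolding good_walk_def by blast
        then show False using il by simp
      qed
      then show "f \<in> (\<Union>p\<in>?I. {f\<in>FS V b. f (fst p) = f (snd p)})" using f il by auto
    qed
  qed (use finI finFS zw_nonneg in auto)
  also have "\<dots> \<le> (\<Sum>p\<in>?I. \<Sum>f\<in>{f\<in>FS V b. f (fst p) = f (snd p)}. zw b f)"
    by (rule sum_UN_le) (use finI finFS zw_nonneg in auto)
  also have "\<dots> \<le> (\<Sum>p\<in>?I. cK)"
  proof (rule sum_mono, clarify)
    fix i l assume il: "i < l" "t < l" "l \<le> b"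
    then obtain m where m: "l = Suc m" "t \<le> m" "i \<le> m" by (cases l) auto
    have "sum (zw b) {f\<in>FS V b. f i = f l} \<le> sum (zw l) {f\<in>FS V l. f i = f l}"
      by (rule zz.total_le) (use il in auto)
    also have "\<dots> \<le> cK * (\<Sum>f\<in>FS V m. zw m f)"
      unfolding m(1) by (rule zz.collision_bound) (use m order_trans[OF Kz_le cost_bounds(2)] in auto)
    also have "\<dots> \<le> cK * 1" using zw_mass_le[OF m(2)] cKF by (intro mult_left_mono) auto
    finally show "sum (zw b) {f\<in>FS V b. f (fst (i, l)) = f (snd (i, l))} \<le> cK" by simp
  qed
  also have "\<dots> = real (card ?I) * cK" by simp
  also have "\<dots> \<le> real (b\<^sup>2) * cK" using cardI cKF by (intro mult_right_mono) (auto simp del: of_nat_power)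
  finally show ?thesis .
qed

lemma agree_empty_outside:
  assumes "i \<in> T" "T \<subseteq> {..b}" "z i \<notin> V"
  shows "sum (zw b) {f\<in>FS V b. agree T z f} = 0"
proof -
  have "{f\<in>FS V b. agree T z f} = {}"
    using assms FS_mem[of _ V b i] unfolding agree_def by force
  then show ?thesis by (simp only: sum.empty)
qed

section \<open>Spread when an edge of a path is fixed\<close>

lemma card_split3:
  assumes T: "T \<subseteq> {..b}" "i \<in> T" "Suc i \<in> T"
  shows "card (T \<inter> {..<i}) + card (T \<inter> {Suc i<..b}) = card T - 2"
proof -
  have fin: "finite T" using T finite_subset by blast
  have "T = insert i (insert (Suc i) ((T \<inter> {..<i}) \<union> (T \<inter> {Suc i<..b})))" using T by auto
  then have "card T = Suc (Suc (card ((T \<inter> {..<i}) \<union> (T \<inter> {Suc i<..b}))))"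
    (is "_ = Suc (Suc (card ?R))")
  proof -
    have "i \<notin> insert (Suc i) ?R" "Suc i \<notin> ?R" "finite ?R" using fin by auto
    then have "card (insert i (insert (Suc i) ?R)) = Suc (Suc (card ?R))" by simp
    then show ?thesis using \<open>T = insert i (insert (Suc i) ?R)\<close> by simp
  qed
  also have "card ((T \<inter> {..<i}) \<union> (T \<inter> {Suc i<..b})) = card (T \<inter> {..<i}) + card (T \<inter> {Suc i<..b})"
    using fin by (intro card_Un_disjoint) auto
  finally show ?thesis by simp
qed

text \<open>The fixed edge costs its flow. Earlier vertices are charged to the reversed walk, which
  by reversibility has the same transition probabilities.\<close>

lemma walk_edge_spread:
  assumes T: "i \<in> T" "Suc i \<in> T" and z: "z i \<in> V" "z (Suc i) \<in> V"
  shows "sum (W (Suc i)) {f\<in>FS V (Suc i). agree (T \<inter> {..Suc i}) z f} \<le> 1 / M * cK ^ card (T \<inter> {..<i})"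
proof -
  let ?A = "\<lambda>y. \<Sum>f\<in>{f\<in>FS V i. agree (T \<inter> {..i}) z f \<and> f i = y}. W i f"
  have "sum (W (Suc i)) {f\<in>FS V (Suc i). agree (T \<inter> {..Suc i}) z f} =
    sum (W (Suc i)) {f\<in>FS V (Suc i). agree (T \<inter> {..i}) z f \<and> f (Suc i) = z (Suc i)}"
    using T by (simp add: agree_Int_atMost_Suc)
  also have "\<dots> = (\<Sum>y\<in>V. ?A y * P y (z (Suc i)))"
    by (rule walk.last_step) (use z in \<open>auto simp: agree_upd\<close>)
  also have "\<dots> = (\<Sum>y\<in>V. if y = z i then ?A (z i) * P (z i) (z (Suc i)) else 0)"
    using T by (intro sum.cong refl) (auto simp: agree_def intro!: sum.neutral)
  also have "\<dots> = ?A (z i) * P (z i) (z (Suc i))" using z finV by simp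
  also have "?A (z i) = sum (W i) {f\<in>FS V i. (f 0 \<in> V \<and> agree (T \<inter> {..<i}) z f) \<and> f i = z i}"
    by (rule arg_cong[where f="sum _"]) (auto simp: agree_def le_less intro: FS_mem)
  also have "\<dots> \<le> 1 * (\<Prod>l\<in>T \<inter> {0..<i}. 2 / (\<kappa> * \<rho>)) * st (z i)"
  proof (rule walk.reverse_bound[of V "\<lambda>_. P" "\<lambda>_. st"])
    show "st y * P y y' \<le> 2 / (\<kappa> * \<rho>) * st y'" if "y \<in> V" "y' \<in> V" for y y'
      using flow_sym[OF that] mult_left_mono[OF P_le[OF that(2), of y] st_nonneg[of y']] by (simp add: mult.commute)
    show "sum (W 0) {f\<in>FS V 0. (f 0 \<in> V \<and> agree (T \<inter> {..<0}) z f) \<and> f 0 = y} \<le> 1 * st y" if "y \<in> V" for y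
    proof -
      have "{f\<in>FS V 0. (f 0 \<in> V \<and> agree (T \<inter> {..<0}) z f) \<and> f 0 = y} = {f\<in>FS V 0. f 0 = y}"
        using that by (auto simp: agree_def)
      then show ?thesis using walk_marginal[OF that, of 0] by simp
    qed
  qed (use stationary st_nonneg \<kappa>\<rho>_pos V_ne z in auto)
  finally have "sum (W (Suc i)) {f\<in>FS V (Suc i). agree (T \<inter> {..Suc i}) z f} \<le>
      (2 / (\<kappa> * \<rho>)) ^ card (T \<inter> {0..<i}) * (st (z i) * P (z i) (z (Suc i)))"
    using P_nonneg[of "z i" "z (Suc i)"] by (simp add: mult_right_mono mult.assoc)
  also have "\<dots> \<le> cK ^ card (T \<inter> {0..<i}) * (1 / M)"
    using cKF \<kappa>\<rho>_pos flow_le z st_nonneg P_nonneg by (intro mult_mono power_mono) auto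
  finally show ?thesis by (simp add: atLeast0LessThan mult.commute)
qed

text \<open>Times before the edge are handled by reversal in \<open>walk_edge_spread\<close>, times
  after it by forward bounds, first for the plain walk up to \<open>t\<close> and then for the
  zigzag.\<close>

lemma edge_spread_initial:
  assumes T: "T \<subseteq> {..b}" "i \<in> T" "Suc i \<in> T" and i: "Suc i \<le> t"
  shows "sum (zw b) {f\<in>FS V b. agree T z f} \<le> 1 / M * cK ^ (card T - 2)"
proof (cases "z i \<in> V \<and> z (Suc i) \<in> V")
  case True
  have Tb: "T \<inter> {..b} = T" using T by auto
  have "sum (zw b) {f\<in>FS V b. agree T z f} \<le>
      cK ^ card (T \<inter> {t<..b}) * sum (zw t) {f\<in>FS V t. agree (T \<inter> {..t}) z f}"
    using zz.forward_bound[of "\<lambda>_. cK" t b "\<lambda>_. True" T z] tb order_trans[OF Kz_le cost_bounds(2)] cKF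
    by (simp add: Tb)
  also have "\<dots> \<le> cK ^ card (T \<inter> {t<..b}) * (cK ^ card (T \<inter> {Suc i<..t}) * (1 / M * cK ^ card (T \<inter> {..<i})))"
  proof (intro mult_left_mono)
    have "sum (zw t) {f\<in>FS V t. agree (T \<inter> {..t}) z f} \<le> sum (W t) {f\<in>FS V t. agree (T \<inter> {..t}) z f}"
      unfolding zw_t using W_nonneg by (intro sum_mono) auto
    also have "\<dots> \<le> cK ^ card (T \<inter> {Suc i<..t}) * sum (W (Suc i)) {f\<in>FS V (Suc i). agree (T \<inter> {..Suc i}) z f}"
      using walk.forward_bound[of "\<lambda>_. cK" "Suc i" t "\<lambda>_. True" T z] i order_trans[OF P_le] cKF by force
    also have "\<dots> \<le> cK ^ card (T \<inter> {Suc i<..t}) * (1 / M * cK ^ card (T \<inter> {..<i}))"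
      using walk_edge_spread T True cKF by (intro mult_left_mono) auto
    finally show "sum (zw t) {f\<in>FS V t. agree (T \<inter> {..t}) z f} \<le>
      cK ^ card (T \<inter> {Suc i<..t}) * (1 / M * cK ^ card (T \<inter> {..<i}))" .
  qed (use cKF in auto)
  also have "\<dots> = 1 / M * cK ^ (card (T \<inter> {..<i}) + (card (T \<inter> {Suc i<..t}) + card (T \<inter> {t<..b})))"
    by (simp add: power_add)
  also have "card (T \<inter> {Suc i<..t}) + card (T \<inter> {t<..b}) = card (T \<inter> {Suc i<..b})"
  proof -
    have "T \<inter> {Suc i<..b} = (T \<inter> {Suc i<..t}) \<union> (T \<inter> {t<..b})" using i tb by auto
    then show ?thesis by (simp only:) (rule card_Un_disjoint[symmetric], auto)
  qed
  finally show ?thesis using card_split3[OF T] by simp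
next
  case False
  then have "sum (zw b) {f\<in>FS V b. agree T z f} = 0" using agree_empty_outside T by blast
  then show ?thesis using M_pos cKF by simp
qed

text \<open>Forgetting the start turns \<open>q\<close> into at most the stationary flow through the
  edge from \<open>y\<close> to \<open>z\<close>.\<close>

lemma q_sum_le: "y \<in> V \<Longrightarrow> z \<in> V \<Longrightarrow> (\<Sum>u\<in>V. q u y z) \<le> 1 / M"
proof -
  assume yz: "y \<in> V" "z \<in> V"
  have "(\<Sum>u\<in>V. q u y z) = sum (W t) {f\<in>FS V t. adm f \<and> f (t - 1) = y \<and> f t = z}"
    unfolding q_def by (subst sum_FS_group[OF finV, of 0 t "W t" "\<lambda>f. adm f \<and> f (t - 1) = y \<and> f t = z"]) (auto simp: conj_ac intro!: sum.cong)
  also have "\<dots> \<le> (\<Sum>f\<in>{f\<in>FS V (t - 1 + 1). f (t - 1) = y \<and> f (t - 1 + 1) = z}. W (t - 1 + 1) f)"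
    using t2 by (auto intro!: sum_mono2 finFS W_nonneg)
  also have "\<dots> = st y * P y z" using walk_pair[OF yz, of "t - 1" 1] Pn_1[OF yz(1)] by (simp del: Pn.simps)
  also have "\<dots> \<le> 1 / M" using flow_le yz by simp
  finally show ?thesis .
qed

text \<open>The kernels depend on the start, so the price \<open>1 / M\<close> of the edge appears
  only after summing over all starts; hence time 0 must not be prescribed.\<close>

lemma edge_spread_zigzag:
  assumes T: "T \<subseteq> {..b}" "i \<in> T" "Suc i \<in> T" and i: "t \<le> i" and T0: "0 \<notin> T"
  shows "sum (zw b) {f\<in>FS V b. agree T z f} \<le> 1 / M * cK ^ (card T - 2)"
proof (cases "z i \<in> V \<and> z (Suc i) \<in> V")
  case True
  have Tb: "T \<inter> {..b} = T" and ib: "Suc i \<le> b" using T by auto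
  let ?A = "\<lambda>u y. \<Sum>f\<in>{f\<in>FS V i. (agree (T \<inter> {..i}) z f \<and> f 0 = u) \<and> f i = y}. zw i f"
  have A: "?A u (z i) \<le> cK ^ card (T \<inter> {..<i}) * Mz u i (z i)" if u: "u \<in> V" for u
  proof -
    have "?A u (z i) = sum (zw i) {f\<in>FS V i. (f 0 \<in> {u} \<and> agree (T \<inter> {..<i}) z f) \<and> f i = z i}"
      by (rule arg_cong[where f="sum _"]) (auto simp: agree_def le_less)
    also have "\<dots> \<le> (\<Prod>l\<in>T \<inter> {..<i}. cost l) * Mz u i (z i)"
      by (rule zw_reverse) (use u True T0 i in auto)
    also have "\<dots> \<le> (\<Prod>l\<in>T \<inter> {..<i}. cK) * Mz u i (z i)"
      using cost_bounds Mz_nonneg by (intro mult_right_mono prod_mono) auto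
    finally show ?thesis by simp
  qed
  have "sum (zw b) {f\<in>FS V b. agree T z f} \<le>
      cK ^ card (T \<inter> {Suc i<..b}) * sum (zw (Suc i)) {f\<in>FS V (Suc i). agree (T \<inter> {..Suc i}) z f}"
    using zz.forward_bound[of "\<lambda>_. cK" "Suc i" b "\<lambda>_. True" T z] ib i order_trans[OF Kz_le cost_bounds(2)] cKF
    by (simp add: Tb)
  also have "\<dots> \<le> cK ^ card (T \<inter> {Suc i<..b}) * (cK ^ card (T \<inter> {..<i}) * (1 / M))"
  proof (intro mult_left_mono)
    have "sum (zw (Suc i)) {f\<in>FS V (Suc i). agree (T \<inter> {..Suc i}) z f} =
      (\<Sum>u\<in>V. \<Sum>f\<in>{f\<in>FS V (Suc i). (agree (T \<inter> {..i}) z f \<and> f 0 = u) \<and> f (Suc i) = z (Suc i)}. zw (Suc i) f)"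
      by (subst sum_FS_group[OF finV, of 0]) (use T in \<open>auto simp: agree_Int_atMost_Suc conj_ac intro!: sum.cong\<close>)
    also have "\<dots> = (\<Sum>u\<in>V. \<Sum>y\<in>V. ?A u y * Kz i u y (z (Suc i)))"
      by (intro sum.cong refl zz.last_step) (use True i in \<open>auto simp: agree_upd\<close>)
    also have "\<dots> = (\<Sum>u\<in>V. \<Sum>y\<in>V. if y = z i then ?A u (z i) * Kz i u (z i) (z (Suc i)) else 0)"
      using T by (intro sum.cong refl) (auto simp: agree_def intro!: sum.neutral)
    also have "\<dots> = (\<Sum>u\<in>V. ?A u (z i) * Kz i u (z i) (z (Suc i)))" using True finV by simp
    also have "\<dots> \<le> (\<Sum>u\<in>V. cK ^ card (T \<inter> {..<i}) * Mz u i (z i) * Kz i u (z i) (z (Suc i)))"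
      using A zz.K_nonneg by (intro sum_mono mult_right_mono) auto
    also have "\<dots> = cK ^ card (T \<inter> {..<i}) * (\<Sum>u\<in>V. if even (i - t) then q u (z (Suc i)) (z i) else q u (z i) (z (Suc i)))"
      using True by (simp add: mult.assoc Mz_Kz sum_distrib_left)
    also have "\<dots> \<le> cK ^ card (T \<inter> {..<i}) * (1 / M)"
      using q_sum_le[of "z (Suc i)" "z i"] q_sum_le[of "z i" "z (Suc i)"] True cKF
      by (intro mult_left_mono; cases "even (i - t)") (auto simp only: if_True if_False zero_le_power less_imp_le)
    finally show "sum (zw (Suc i)) {f\<in>FS V (Suc i). agree (T \<inter> {..Suc i}) z f} \<le> cK ^ card (T \<inter> {..<i}) * (1 / M)" .
  qed (use cKF in auto)
  also have "\<dots> = 1 / M * cK ^ (card (T \<inter> {..<i}) + card (T \<inter> {Suc i<..b}))" by (simp add: power_add)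
  finally show ?thesis using card_split3[OF T] by simp
next
  case False
  then have "sum (zw b) {f\<in>FS V b. agree T z f} = 0" using agree_empty_outside T by blast
  then show ?thesis using M_pos cKF by simp
qed

end

section \<open>Choice of the level and of the admissible pairs\<close>

context walk_graph
begin

text \<open>\<open>\<epsilon>0\<close> is the smallest probability that
  \<open>concentration_level\<close> can give, so later constants do not depend on \<open>t\<close>.
  Good walks have mass at least \<open>\<epsilon>0 / 2\<close>; cleaning the pairs at times
  \<open>t - 1\<close> and \<open>t\<close> costs \<open>\<epsilon>0 / 8\<close> each and leaves
  every admissible pair at least the fraction \<open>\<epsilon>0 / 8\<close> of its original
  mass.\<close>

lemma exists_zigzag:
  fixes \<epsilon>0 :: real
  defines "\<epsilon>0 \<equiv> (1 / (8 * real (b\<^sup>2))) ^ b / 2"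
  assumes large: "real (b\<^sup>2) * (2 / \<kappa>) \<le> \<epsilon>0 / 4"
  obtains t Ys Zs where "zigzag V E \<kappa> \<rho> b t Ys Zs (\<epsilon>0 / 8)"
    "\<epsilon>0 / 4 \<le> sum (W t) {f\<in>FS V t. zigzag.adm V E \<kappa> \<rho> t Ys Zs f}"
proof -
  \<comment> \<open>With this choice the untame pairs lose at most \<open>\<epsilon> / 8\<close>;
    the hypothesis \<open>large\<close> limits the collisions to \<open>\<epsilon> / 4\<close>, so
    at least half of \<open>\<epsilon>\<close> remains.\<close>
  define \<eta> where "\<eta> = 1 / (8 * real (b\<^sup>2))"
  have bb: "real (b\<^sup>2) \<ge> 1" using b2 by (metis one_le_power of_nat_1 of_nat_le_iff order_trans one_le_numeral)
  then have bpos: "0 < real (b\<^sup>2)" by linarith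
  have \<eta>: "0 < \<eta>" "\<eta> \<le> 1" "real (b\<^sup>2) * \<eta> = 1 / 8" proof -
    show "0 < \<eta>" "real (b\<^sup>2) * \<eta> = 1 / 8" unfolding \<eta>_def using bpos by (simp_all del: of_nat_power)
    have "1 \<le> 8 * real (b\<^sup>2)" using bb by linarith
    then show "\<eta> \<le> 1" unfolding \<eta>_def by (simp add: divide_le_eq del: of_nat_power)
  qed
  have \<epsilon>0: "\<epsilon>0 = \<eta> ^ b / 2" "0 < \<epsilon>0" "\<epsilon>0 \<le> 1" unfolding \<epsilon>0_def \<eta>_def[symmetric] using \<eta> power_le_one[of \<eta> b] by auto
  obtain t where t: "2 \<le> t" "t \<le> b" "\<eta> ^ (b - t) / 2 \<le> prob_conc t"
    "\<And>g. 2 \<le> g \<Longrightarrow> g < t \<Longrightarrow> prob_conc g \<le> \<eta> ^ (b - g) / 2"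
    using concentration_level[OF \<eta>(1)] by metis
  define \<epsilon> where "\<epsilon> = \<eta> ^ (b - t) / 2"
  have \<epsilon>: "\<epsilon>0 \<le> \<epsilon>" unfolding \<epsilon>_def \<epsilon>0 using \<eta> by (simp add: power_decreasing)
  have good: "\<epsilon> / 2 \<le> sum (W t) {f\<in>FS V t. good_walk t f}"
  proof (rule good_walk_mass[OF t(1,2), where \<epsilon>' = "\<eta> * \<epsilon>"])
    show "\<epsilon> \<le> prob_conc t" using t by (simp add: \<epsilon>_def)
    fix g assume g: "2 \<le> g" "g < t"
    have "\<eta> ^ (b - g) \<le> \<eta> ^ Suc (b - t)" using g t \<eta> by (intro power_decreasing) auto
    then show "prob_conc g \<le> \<eta> * \<epsilon>" using t(4)[OF g] by (simp add: \<epsilon>_def)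
  next
    have "real (b\<^sup>2) * (\<eta> * \<epsilon> + 2 / \<kappa>) = (real (b\<^sup>2) * \<eta>) * \<epsilon> + real (b\<^sup>2) * (2 / \<kappa>)" by (simp add: algebra_simps)
    also have "\<dots> \<le> \<epsilon> / 8 + \<epsilon> / 4" unfolding \<eta>(3) using large \<epsilon> by linarith
    finally show "real (b\<^sup>2) * (\<eta> * \<epsilon> + 2 / \<kappa>) \<le> \<epsilon> / 2" using \<epsilon> \<epsilon>0 by simp
    show "0 \<le> \<eta> * \<epsilon>" using \<eta> \<epsilon> \<epsilon>0 by simp
  qed
  let ?G = "{f\<in>FS V t. good_walk t f}"
  let ?A = "\<lambda>g (u, y). \<epsilon>0 / 8 * (st u * Pn g u y)"
  have sumA: "sum (?A g) (V \<times> V) = \<epsilon>0 / 8" for g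
  proof -
    have "sum (?A g) (V \<times> V) = (\<Sum>u\<in>V. \<Sum>y\<in>V. \<epsilon>0 / 8 * (st u * Pn g u y))" by (simp add: sum.cartesian_product)
    also have "\<dots> = \<epsilon>0 / 8 * (\<Sum>u\<in>V. st u * (\<Sum>y\<in>V. Pn g u y))" by (simp only: sum_distrib_left)
    finally show ?thesis using Pn_sum st_sum by simp
  qed
  obtain Ys Zs where YZ: "Ys \<subseteq> V \<times> V" "Zs \<subseteq> V \<times> V"
    "sum (W t) {f\<in>?G. (f 0, f (t - 1)) \<in> Ys \<and> (f 0, f t) \<in> Zs} \<ge> sum (W t) ?G - sum (?A (t - 1)) (V \<times> V) - sum (?A t) (V \<times> V)"
    "\<And>p. p \<in> Ys \<Longrightarrow> ?A (t - 1) p \<le> sum (W t) {f\<in>?G. (f 0, f (t - 1)) \<in> Ys \<and> (f 0, f t) \<in> Zs \<and> (f 0, f (t - 1)) = p}"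
    "\<And>p. p \<in> Zs \<Longrightarrow> ?A t p \<le> sum (W t) {f\<in>?G. (f 0, f (t - 1)) \<in> Ys \<and> (f 0, f t) \<in> Zs \<and> (f 0, f t) = p}"
  proof (rule bipartite_cleaning[of ?G "V \<times> V" "V \<times> V" "\<lambda>f. (f 0, f (t - 1))" "\<lambda>f. (f 0, f t)" "?A (t - 1)" "?A t" "W t"])
    show "finite ?G" using finite_FS[OF finV] by auto
    show "finite (V \<times> V)" "finite (V \<times> V)" using finV by auto
    show "(f 0, f (t - 1)) \<in> V \<times> V" "(f 0, f t) \<in> V \<times> V" if "f \<in> ?G" for f using that FS_mem by auto
    show "0 \<le> ?A (t - 1) p" "0 \<le> ?A t p" if "p \<in> V \<times> V" for p
      using \<epsilon>0 st_nonneg Pn_nonneg by (simp_all add: split_beta)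
  qed (rule that, assumption+)
  have zz: "zigzag V E \<kappa> \<rho> b t Ys Zs (\<epsilon>0 / 8)"
  proof (unfold_locales)
    show "\<epsilon>0 / 8 * (st u * Pn (t - 1) u y) \<le> sum (W t) {f\<in>?G. (f 0, f (t - 1)) \<in> Ys \<and> (f 0, f t) \<in> Zs \<and> (f 0, f (t - 1)) = (u, y)}"
      if "(u, y) \<in> Ys" for u y using YZ(4)[OF that] by simp
    show "\<epsilon>0 / 8 * (st u * Pn t u y) \<le> sum (W t) {f\<in>?G. (f 0, f (t - 1)) \<in> Ys \<and> (f 0, f t) \<in> Zs \<and> (f 0, f t) = (u, y)}"
      if "(u, y) \<in> Zs" for u y using YZ(5)[OF that] by simp
  qed (use t \<epsilon>0 in auto)
  interpret Z: zigzag V E \<kappa> \<rho> b t Ys Zs "\<epsilon>0 / 8" by (rule zz)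
  have "{f\<in>?G. (f 0, f (t - 1)) \<in> Ys \<and> (f 0, f t) \<in> Zs} = {f\<in>FS V t. Z.adm f}" unfolding Z.adm_def by auto
  then have "\<epsilon>0 / 4 \<le> sum (W t) {f\<in>FS V t. Z.adm f}"
    using YZ(3) good \<epsilon> unfolding sumA by (simp only:)
  then show ?thesis using that zz by blast
qed

end

section \<open>Random theta graphs\<close>

definition ppos :: "nat \<Rightarrow> nat \<Rightarrow> theta_vertex set \<Rightarrow> nat set" where
  "ppos b j \<nu> = {i. i \<le> b \<and> path_vertex b i j \<in> \<nu>}"

fun phi :: "('v \<times> 'v) \<times> (nat \<Rightarrow> nat \<Rightarrow> 'v) \<Rightarrow> theta_vertex \<Rightarrow> 'v" where
  "phi ((u, v), F) U_end = u"
| "phi ((u, v), F) V_end = v"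
| "phi ((u, v), F) (W i j) = F j i"

context zigzag
begin

definition Pth :: "'a \<Rightarrow> 'a \<Rightarrow> (nat \<Rightarrow> 'a) set" where
  "Pth u v = {f\<in>FS V b. f 0 = u \<and> f b = v}"

text \<open>Given its two ends, the \<open>r\<close> paths of the random theta graph are independent.\<close>

definition thI :: "nat \<Rightarrow> (('a \<times> 'a) \<times> (nat \<Rightarrow> nat \<Rightarrow> 'a)) set" where
  "thI r = Sigma (V \<times> V) (\<lambda>(u, v). PiE {1..r} (\<lambda>_. Pth u v))"

definition tm :: "nat \<Rightarrow> ('a \<times> 'a) \<times> (nat \<Rightarrow> nat \<Rightarrow> 'a) \<Rightarrow> real" where
  "tm r = (\<lambda>((u, v), F). pz u v * (\<Prod>j=1..r. zw b (F j) / pz u v))"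

lemma finite_Pth: "finite (Pth u v)" unfolding Pth_def by (rule finFS)

lemma thI_mem: "x \<in> thI r \<Longrightarrow> i \<le> b \<Longrightarrow> j \<in> {1..r} \<Longrightarrow> snd x j i \<in> V"
proof -
  assume x: "x \<in> thI r" and ij: "i \<le> b" "j \<in> {1..r}"
  have "snd x j \<in> FS V b" using x ij(2) unfolding thI_def Pth_def by fastforce
  then show ?thesis using ij(1) by (rule FS_mem)
qed

lemma finite_Pth_PiE: "finite (PiE {1..r::nat} (\<lambda>_. Pth u v))"
  by (intro finite_PiE) (auto simp: finite_Pth)

lemma finite_thI: "finite (thI r)"
  unfolding thI_def using finV finite_Pth_PiE by (intro finite_SigmaI) auto

lemma pz_nonneg: "0 \<le> pz u v" unfolding pz_def using zw_nonneg by (intro sum_nonneg) auto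

lemma pz_Pth: "pz u v = (\<Sum>f\<in>Pth u v. zw b f)" unfolding pz_def Pth_def ..

lemma tm_nonneg: "x \<in> thI r \<Longrightarrow> 0 \<le> tm r x"
  unfolding tm_def thI_def Pth_def
  by (auto intro!: mult_nonneg_nonneg prod_nonneg divide_nonneg_nonneg pz_nonneg zw_nonneg simp: PiE_iff)

lemma sum_thI:
  "(\<Sum>x\<in>{x\<in>thI r. R x}. tm r x) =
    (\<Sum>u\<in>V. \<Sum>v\<in>V. \<Sum>F\<in>{F\<in>PiE {1..r} (\<lambda>_. Pth u v). R ((u, v), F)}. tm r ((u, v), F))"
proof -
  have "{x\<in>thI r. R x} = Sigma (V \<times> V) (\<lambda>p. {F\<in>PiE {1..r} (\<lambda>_. Pth (fst p) (snd p)). R (p, F)})"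
    unfolding thI_def by auto
  then have "(\<Sum>x\<in>{x\<in>thI r. R x}. tm r x) = (\<Sum>p\<in>V \<times> V. \<Sum>F\<in>{F\<in>PiE {1..r} (\<lambda>_. Pth (fst p) (snd p)). R (p, F)}. tm r (p, F))"
    using finV finite_Pth_PiE by (simp add: sum.Sigma split_def del: One_nat_def)
  then show ?thesis by (simp add: sum.cartesian_product split_def)
qed

lemma fiber_sum:
  "(\<Sum>F\<in>{F\<in>PiE {1..r} (\<lambda>_. Pth u v). \<forall>j\<in>{1..r}. Q j (F j)}. tm r ((u, v), F)) =
    pz u v * (\<Prod>j=1..r. (\<Sum>f\<in>{f\<in>Pth u v. Q j f}. zw b f) / pz u v)"
proof -
  have "{F\<in>PiE {1..r} (\<lambda>_. Pth u v). \<forall>j\<in>{1..r}. Q j (F j)} = PiE {1..r} (\<lambda>j. {f\<in>Pth u v. Q j f})"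
  proof (rule set_eqI)
    fix F
    show "F \<in> {F\<in>PiE {1..r} (\<lambda>_. Pth u v). \<forall>j\<in>{1..r}. Q j (F j)} \<longleftrightarrow> F \<in> PiE {1..r} (\<lambda>j. {f\<in>Pth u v. Q j f})"
      unfolding mem_Collect_eq PiE_iff by blast
  qed
  then show ?thesis
    unfolding tm_def using prod_sum_PiE[of "{1..r}" "\<lambda>j. {f\<in>Pth u v. Q j f}" "\<lambda>j f. zw b f / pz u v"] finite_Pth
    by (simp add: sum_distrib_left sum_divide_distrib)
qed

text \<open>The factor \<open>pz u v\<close> in the weight cancels one denominator. So the path
  \<open>j0\<close> keeps the law of a single zigzag, random ends included, while every other path
  contributes a probability conditional on those ends.\<close>

lemma path_event_bound:
  assumes j0: "j0 \<in> {1..r}"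
    and \<gamma>: "\<And>j u v. j \<in> {1..r} - {j0} \<Longrightarrow> u \<in> V \<Longrightarrow> v \<in> V \<Longrightarrow> (\<Sum>f\<in>{f\<in>Pth u v. Q j f}. zw b f) \<le> \<gamma> j * pz u v"
    and \<gamma>0: "\<And>j. 0 \<le> \<gamma> j"
  shows "(\<Sum>x\<in>{x\<in>thI r. \<forall>j\<in>{1..r}. Q j (snd x j)}. tm r x) \<le>
    sum (zw b) {f\<in>FS V b. Q j0 f} * (\<Prod>j\<in>{1..r} - {j0}. \<gamma> j)"
proof -
  let ?A = "\<lambda>u v j. (\<Sum>f\<in>{f\<in>Pth u v. Q j f}. zw b f)"
  have A0: "0 \<le> ?A u v j" for u v j using zw_nonneg unfolding Pth_def by (intro sum_nonneg) auto
  have "(\<Sum>x\<in>{x\<in>thI r. \<forall>j\<in>{1..r}. Q j (snd x j)}. tm r x) =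
    (\<Sum>u\<in>V. \<Sum>v\<in>V. pz u v * (\<Prod>j=1..r. ?A u v j / pz u v))"
    unfolding sum_thI by (simp only: fiber_sum snd_conv)
  also have "\<dots> \<le> (\<Sum>u\<in>V. \<Sum>v\<in>V. ?A u v j0 * (\<Prod>j\<in>{1..r} - {j0}. \<gamma> j))"
  proof (intro sum_mono)
    fix u v assume uv: "u \<in> V" "v \<in> V"
    have "(\<Prod>j=1..r. ?A u v j / pz u v) = ?A u v j0 / pz u v * (\<Prod>j\<in>{1..r} - {j0}. ?A u v j / pz u v)"
      using j0 by (subst prod.remove[of "{1..r}" j0]) auto
    also have "\<dots> \<le> ?A u v j0 / pz u v * (\<Prod>j\<in>{1..r} - {j0}. \<gamma> j)"
    proof (intro mult_left_mono prod_mono)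
      fix j assume j: "j \<in> {1..r} - {j0}"
      show "0 \<le> ?A u v j / pz u v \<and> ?A u v j / pz u v \<le> \<gamma> j"
        using \<gamma>[OF j uv] A0[of u v j] pz_nonneg[of u v] \<gamma>0[of j] by (cases "pz u v = 0") (auto simp: divide_le_eq)
    qed (use A0 pz_nonneg in auto)
    finally have "pz u v * (\<Prod>j=1..r. ?A u v j / pz u v) \<le> pz u v * (?A u v j0 / pz u v * (\<Prod>j\<in>{1..r} - {j0}. \<gamma> j))"
      using pz_nonneg by (intro mult_left_mono) auto
    also have "\<dots> \<le> ?A u v j0 * (\<Prod>j\<in>{1..r} - {j0}. \<gamma> j)"
      using A0 \<gamma>0 by (cases "pz u v = 0") (auto intro!: mult_nonneg_nonneg prod_nonneg)
    finally show "pz u v * (\<Prod>j=1..r. ?A u v j / pz u v) \<le> ?A u v j0 * (\<Prod>j\<in>{1..r} - {j0}. \<gamma> j)" .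
  qed
  also have "\<dots> = (\<Sum>u\<in>V. \<Sum>v\<in>V. ?A u v j0) * (\<Prod>j\<in>{1..r} - {j0}. \<gamma> j)"
    by (simp add: sum_distrib_right)
  also have "(\<Sum>u\<in>V. \<Sum>v\<in>V. ?A u v j0) = sum (zw b) {f\<in>FS V b. Q j0 f}"
  proof -
    have "sum (zw b) {f\<in>FS V b. Q j0 f} = (\<Sum>u\<in>V. \<Sum>f\<in>{f\<in>FS V b. Q j0 f \<and> f 0 = u}. zw b f)"
      by (rule sum_FS_group[OF finV]) simp
    also have "\<dots> = (\<Sum>u\<in>V. \<Sum>v\<in>V. \<Sum>f\<in>{f\<in>FS V b. (Q j0 f \<and> f 0 = u) \<and> f b = v}. zw b f)"
      by (intro sum.cong refl sum_FS_group[OF finV]) simp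
    finally show ?thesis unfolding Pth_def by (simp add: conj_ac)
  qed
  finally show ?thesis .
qed

lemma tm_mass: "(\<Sum>x\<in>thI r. tm r x) = (\<Sum>f\<in>FS V b. zw b f)"
proof -
  have "(\<Sum>x\<in>thI r. tm r x) = (\<Sum>u\<in>V. \<Sum>v\<in>V. pz u v * (\<Prod>j=1..r. pz u v / pz u v))"
    using sum_thI[of r "\<lambda>_. True"] fiber_sum[of r _ _ "\<lambda>_ _. True"] by (simp add: pz_Pth)
  also have "\<dots> = (\<Sum>u\<in>V. \<Sum>v\<in>V. pz u v)" by (intro sum.cong refl) (auto simp: prod_constant)
  also have "\<dots> = (\<Sum>f\<in>FS V b. zw b f)"
    using sum_FS_group[OF finV, of 0 b "zw b" "\<lambda>_. True"] sum_FS_group[OF finV, of b b "zw b" "\<lambda>f. f 0 = _"]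
    by (simp add: pz_def)
  finally show ?thesis .
qed

lemma path_noninjective:
  assumes "j \<in> {1..r}"
  shows "(\<Sum>x\<in>{x\<in>thI r. \<not> inj_on (snd x j) {..b}}. tm r x) \<le> real (b\<^sup>2) * cK"
proof -
  have "{x\<in>thI r. \<not> inj_on (snd x j) {..b}} = {x\<in>thI r. \<forall>i\<in>{1..r}. (\<lambda>i f. i = j \<longrightarrow> \<not> inj_on f {..b}) i (snd x i)}"
    using assms by auto
  then have "(\<Sum>x\<in>{x\<in>thI r. \<not> inj_on (snd x j) {..b}}. tm r x) \<le>
    sum (zw b) {f\<in>FS V b. \<not> inj_on f {..b}} * (\<Prod>i\<in>{1..r} - {j}. 1)"
    using path_event_bound[OF assms, of "\<lambda>i f. i = j \<longrightarrow> \<not> inj_on f {..b}" "\<lambda>_. 1"] by (simp add: pz_Pth)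
  then show ?thesis using zw_noninjective by simp
qed

text \<open>Fix the vertex \<open>z\<close> at which path \<open>j'\<close> stands; given the ends,
  path \<open>j\<close> passes through \<open>z\<close> at its inner position \<open>i\<close> with
  probability at most \<open>cK\<close>. Position \<open>i\<close> must be inner because the paths
  share their ends.\<close>

lemma path_collision:
  assumes j: "j \<in> {1..r}" "j' \<in> {1..r}" "j \<noteq> j'" and i: "i \<in> {1..<b}" "i' \<le> b"
  shows "(\<Sum>x\<in>{x\<in>thI r. snd x j i = snd x j' i'}. tm r x) \<le> cK"
proof -
  have mem: "snd x j i \<in> V" if "x \<in> thI r" for x
    using thI_mem[OF that _ j(1)] i by simp
  have "(\<Sum>x\<in>{x\<in>thI r. snd x j i = snd x j' i'}. tm r x) =
     (\<Sum>z\<in>V. \<Sum>x\<in>{x\<in>{x\<in>thI r. snd x j i = snd x j' i'}. snd x j i = z}. tm r x)"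
  proof (rule sum.group[symmetric])
    show "finite {x\<in>thI r. snd x j i = snd x j' i'}" using finite_thI by simp
    show "(\<lambda>x. snd x j i) ` {x\<in>thI r. snd x j i = snd x j' i'} \<subseteq> V" using mem by blast
  qed (rule finV)
  also have "\<dots> \<le> (\<Sum>z\<in>V. sum (zw b) {f\<in>FS V b. f i' = z} * cK)"
  proof (rule sum_mono)
    fix z assume z: "z \<in> V"
    let ?Q = "\<lambda>l f. (l = j \<longrightarrow> f i = z) \<and> (l = j' \<longrightarrow> f i' = z)"
    have "{x\<in>{x\<in>thI r. snd x j i = snd x j' i'}. snd x j i = z} = {x\<in>thI r. \<forall>l\<in>{1..r}. ?Q l (snd x l)}"
      using j by auto
    moreover have "(\<Sum>x\<in>{x\<in>thI r. \<forall>l\<in>{1..r}. ?Q l (snd x l)}. tm r x) \<le>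
      sum (zw b) {f\<in>FS V b. ?Q j' f} * (\<Prod>l\<in>{1..r} - {j'}. if l = j then cK else 1)"
    proof (rule path_event_bound[OF j(2)])
      fix l u v assume l: "l \<in> {1..r} - {j'}" and uv: "u \<in> V" "v \<in> V"
      show "(\<Sum>f\<in>{f\<in>Pth u v. ?Q l f}. zw b f) \<le> (if l = j then cK else 1) * pz u v"
      proof (cases "l = j")
        case True
        have "(\<Sum>f\<in>{f\<in>Pth u v. f i = z}. zw b f) \<le> cost i * pz u v"
          using conditional_spread[of "{i}" u v "\<lambda>_. z"] i uv by (simp add: agree_def Pth_def conj_ac)
        also have "\<dots> \<le> cK * pz u v" using cost_bounds pz_nonneg by (intro mult_right_mono) auto
        finally show ?thesis using True j by simp
      next
        case False then show ?thesis using l by (simp add: pz_Pth)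
      qed
    qed (use cKF in auto)
    moreover have "(\<Prod>l\<in>{1..r} - {j'}. if l = j then cK else 1) = cK" using j by simp
    ultimately show "(\<Sum>x\<in>{x\<in>{x\<in>thI r. snd x j i = snd x j' i'}. snd x j i = z}. tm r x) \<le>
        sum (zw b) {f\<in>FS V b. f i' = z} * cK" using j by simp
  qed
  also have "\<dots> = (\<Sum>f\<in>FS V b. zw b f) * cK"
    using sum_FS_group[OF finV i(2), of "zw b" "\<lambda>_. True"] by (simp add: sum_distrib_right)
  also have "\<dots> \<le> 1 * cK" using zw_mass_le[OF tb] cKF by (intro mult_right_mono) auto
  finally show ?thesis by simp
qed

text \<open>Nonzero weight is what guarantees that consecutive vertices of the paths are adjacent;
  indices of weight zero are dropped at no loss of mass.\<close>

definition thJ :: "nat \<Rightarrow> (('a \<times> 'a) \<times> (nat \<Rightarrow> nat \<Rightarrow> 'a)) set" where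
  "thJ r = {x\<in>thI r. tm r x \<noteq> 0 \<and> inj_on (phi x) (theta_verts r b)}"

lemma phi_path_vertex:
  assumes "x \<in> thI r" "i \<le> b" "j \<in> {1..r}"
  shows "phi x (path_vertex b i j) = snd x j i"
  using assms unfolding thI_def Pth_def path_vertex_def by (auto simp: PiE_iff)

lemma theta_vert_path:
  assumes "w \<in> theta_verts r b" "1 \<le> r"
  obtains i j where "i \<le> b" "j \<in> {1..r}" "w = path_vertex b i j"
proof (cases w)
  case U_end then show ?thesis using that[of 0 1] assms by (auto simp: path_vertex_def)
next
  case V_end then show ?thesis using that[of b 1] assms b2 by (auto simp: path_vertex_def)
next
  case (W i j) then show ?thesis using that[of i j] assms by (auto simp: path_vertex_def theta_verts_def)
qed

text \<open>A coincidence involving an end can be moved into a single path, as all paths share both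
  ends; only inner vertices can collide across paths.\<close>

lemma noninjective_cases:
  assumes x: "x \<in> thI r" and r: "1 \<le> r" and ni: "\<not> inj_on (phi x) (theta_verts r b)"
  shows "(\<exists>j\<in>{1..r}. \<not> inj_on (snd x j) {..b}) \<or>
    (\<exists>j\<in>{1..r}. \<exists>j'\<in>{1..r}. \<exists>i\<in>{1..<b}. \<exists>i'\<in>{1..<b}. j \<noteq> j' \<and> snd x j i = snd x j' i')"
proof (rule ccontr)
  assume neg: "\<not> ?thesis"
  then have inj: "inj_on (snd x j) {..b}" if "j \<in> {1..r}" for j using that by blast
  have "inj_on (phi x) (theta_verts r b)"
  proof (rule inj_onI)
    fix w w' assume w: "w \<in> theta_verts r b" "w' \<in> theta_verts r b" "phi x w = phi x w'"
    obtain i j where ij: "i \<le> b" "j \<in> {1..r}" "w = path_vertex b i j" using theta_vert_path[OF w(1) r] by metis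
    obtain i' j' where ij': "i' \<le> b" "j' \<in> {1..r}" "w' = path_vertex b i' j'" using theta_vert_path[OF w(2) r] by metis
    have eq: "snd x j i = snd x j' i'" using w phi_path_vertex[OF x] ij ij' by simp
    have end0: "snd x j 0 = snd x l 0" "snd x j b = snd x l b" if "j \<in> {1..r}" "l \<in> {1..r}" for j l
      using phi_path_vertex[OF x _ that(1), of 0] phi_path_vertex[OF x _ that(2), of 0]
        phi_path_vertex[OF x _ that(1), of b] phi_path_vertex[OF x _ that(2), of b] b2 by (auto simp: path_vertex_def)
    consider "i' = 0 \<or> i' = b" | "i = 0 \<or> i = b" | "i \<in> {1..<b}" "i' \<in> {1..<b}" using ij ij' by fastforce
    then show "w = w'"
    proof cases
      case 1
      then have "snd x j' i' = snd x j i'" using end0[OF ij'(2) ij(2)] by auto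
      then have "i = i'" using eq inj[OF ij(2)] ij ij' unfolding inj_on_def by auto
      then show ?thesis using 1 ij ij' by (auto simp: path_vertex_def)
    next
      case 2
      then have "snd x j i = snd x j' i" using end0[OF ij(2) ij'(2)] by auto
      then have "i = i'" using eq inj[OF ij'(2)] ij ij' unfolding inj_on_def by auto
      then show ?thesis using 2 ij ij' by (auto simp: path_vertex_def)
    next
      case 3
      then have "j = j'" using neg eq ij ij' by blast
      moreover have "i = i'" using eq inj[OF ij(2)] ij ij' \<open>j = j'\<close> unfolding inj_on_def by auto
      ultimately show ?thesis using ij ij' by simp
    qed
  qed
  then show False using ni by simp
qed

text \<open>Each failure listed in \<open>noninjective_cases\<close> has mass at most a constant
  times \<open>cK\<close>, which tends to zero as \<open>\<kappa>\<close> grows.\<close>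

lemma thJ_mass:
  assumes r: "1 \<le> r"
  shows "(\<Sum>f\<in>FS V b. zw b f) - 2 * real ((r * b)\<^sup>2) * cK \<le> (\<Sum>x\<in>thJ r. tm r x)"
proof -
  let ?C = "{(j, j', i, i'). j \<in> {1..r} \<and> j' \<in> {1..r} \<and> j \<noteq> j' \<and> i \<in> {1..<b} \<and> i' \<in> {1..<b}}"
  let ?N = "\<lambda>j. {x\<in>thI r. \<not> inj_on (snd x j) {..b}}"
  let ?M = "\<lambda>(j, j', i, i'). {x\<in>thI r. snd x j i = snd x j' i'}"
  have Csub: "?C \<subseteq> {1..r} \<times> {1..r} \<times> {1..b} \<times> {1..b}" by auto
  then have finC: "finite ?C" by (rule finite_subset) auto
  have cardC: "card ?C \<le> (r * b)\<^sup>2"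
    using card_mono[OF _ Csub] by (simp add: power2_eq_square card_cartesian_product mult_ac)
  have fin: "finite {x\<in>thI r. R x}" for R using finite_thI by auto
  let ?J = "{x\<in>thI r. inj_on (phi x) (theta_verts r b)}"
  have "(\<Sum>x\<in>thI r. tm r x) \<le> sum (tm r) (?J \<union> ((\<Union>j\<in>{1..r}. ?N j) \<union> (\<Union>p\<in>?C. ?M p)))"
  proof (rule sum_mono2)
    show "thI r \<subseteq> ?J \<union> ((\<Union>j\<in>{1..r}. ?N j) \<union> (\<Union>p\<in>?C. ?M p))"
    proof
      fix x assume x: "x \<in> thI r"
      show "x \<in> ?J \<union> ((\<Union>j\<in>{1..r}. ?N j) \<union> (\<Union>p\<in>?C. ?M p))"
      proof (cases "inj_on (phi x) (theta_verts r b)")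
        case False
        from noninjective_cases[OF x r False] show ?thesis
        proof
          assume "\<exists>j\<in>{1..r}. \<not> inj_on (snd x j) {..b}" then show ?thesis using x by auto
        next
          assume "\<exists>j\<in>{1..r}. \<exists>j'\<in>{1..r}. \<exists>i\<in>{1..<b}. \<exists>i'\<in>{1..<b}. j \<noteq> j' \<and> snd x j i = snd x j' i'"
          then obtain j j' i i' where "(j, j', i, i') \<in> ?C" "snd x j i = snd x j' i'" by blast
          then have "x \<in> (\<Union>p\<in>?C. ?M p)" using x by (intro UN_I[of "(j, j', i, i')"]) auto
          then show ?thesis by blast
        qed
      qed (use x in auto)
    qed
  qed (use finC finite_thI tm_nonneg in auto)
  also have "\<dots> \<le> sum (tm r) ?J + (sum (tm r) (\<Union>j\<in>{1..r}. ?N j) + sum (tm r) (\<Union>p\<in>?C. ?M p))"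
    using finite_thI tm_nonneg finC
    by (intro order_trans[OF sum_Un_le] add_left_mono sum_Un_le) auto
  also have "sum (tm r) (\<Union>j\<in>{1..r}. ?N j) \<le> (\<Sum>j\<in>{1..r}. sum (tm r) (?N j))"
    by (rule sum_UN_le) (use fin tm_nonneg in auto)
  also have "\<dots> \<le> (\<Sum>j\<in>{1..r}. real (b\<^sup>2) * cK)" by (intro sum_mono path_noninjective)
  also have "sum (tm r) (\<Union>p\<in>?C. ?M p) \<le> (\<Sum>p\<in>?C. sum (tm r) (?M p))"
    by (rule sum_UN_le) (use finC fin tm_nonneg in auto)
  also have "\<dots> \<le> (\<Sum>p\<in>?C. cK)" by (rule sum_mono) (auto intro!: path_collision)
  also have "\<dots> \<le> real ((r * b)\<^sup>2) * cK" using cardC cKF by (simp del: of_nat_power of_nat_mult)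
  also have "(\<Sum>j\<in>{1..r}. real (b\<^sup>2) * cK) \<le> real ((r * b)\<^sup>2) * cK"
  proof -
    have "r * b\<^sup>2 \<le> (r * b)\<^sup>2" using r by (simp add: power2_eq_square)
    then have "real (r * b\<^sup>2) * cK \<le> real ((r * b)\<^sup>2) * cK" using cKF by (intro mult_right_mono) (auto simp del: of_nat_power of_nat_mult)
    then show ?thesis by simp
  qed
  finally have "(\<Sum>x\<in>thI r. tm r x) \<le> sum (tm r) ?J + 2 * real ((r * b)\<^sup>2) * cK" by linarith
  moreover have "sum (tm r) ?J = (\<Sum>x\<in>thJ r. tm r x)"
    unfolding thJ_def by (rule sum.mono_neutral_right) (use fin in auto)
  ultimately show ?thesis unfolding tm_mass by simp
qed

definition hyp :: "nat \<Rightarrow> ('a \<times> 'a) \<times> (nat \<Rightarrow> nat \<Rightarrow> 'a) \<Rightarrow> (theta_vertex \<times> 'a) set" where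
  "hyp r x = (\<lambda>w. (w, phi x w)) ` theta_verts r b"

lemma hyp_valid:
  assumes x: "x \<in> thJ r" and r: "1 \<le> r"
  shows "valid_set r b V E (hyp r x)" "card (hyp r x) = card (theta_verts r b)"
proof -
  have xI: "x \<in> thI r" and inj: "inj_on (phi x) (theta_verts r b)" and nz: "tm r x \<noteq> 0" using x unfolding thJ_def by auto
  show c: "card (hyp r x) = card (theta_verts r b)" unfolding hyp_def by (rule card_image) (auto simp: inj_on_def)
  have fs: "fst ` hyp r x = theta_verts r b" unfolding hyp_def by force
  have sn: "snd ` hyp r x = phi x ` theta_verts r b" unfolding hyp_def by force
  have zw: "zw b (snd x j) \<noteq> 0" if "j \<in> {1..r}" for j
    using nz that unfolding tm_def by (auto simp: split_beta)
  show "valid_set r b V E (hyp r x)"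
    unfolding valid_set_def
  proof (intro conjI allI impI)
    show "hyp r x \<subseteq> theta_verts r b \<times> V"
    proof
      fix p assume "p \<in> hyp r x"
      then obtain w where w: "w \<in> theta_verts r b" "p = (w, phi x w)" unfolding hyp_def by auto
      obtain i j where "i \<le> b" "j \<in> {1..r}" "w = path_vertex b i j" using theta_vert_path[OF w(1) r] by metis
      then show "p \<in> theta_verts r b \<times> V" using w phi_path_vertex[OF xI] thI_mem[OF xI] by simp
    qed
    show "card (hyp r x) = card (fst ` hyp r x)" using c fs by simp
    show "card (hyp r x) = card (snd ` hyp r x)" using c sn card_image[OF inj] by simp
    fix w z w' z' assume a: "(w, z) \<in> hyp r x \<and> (w', z') \<in> hyp r x \<and> {w, w'} \<in> theta_edges r b"
    then have z: "z = phi x w" "z' = phi x w'" unfolding hyp_def by auto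
    obtain i j where ij: "{w, w'} = {path_vertex b i j, path_vertex b (i + 1) j}" "i < b" "1 \<le> j" "j \<le> r"
      using a unfolding theta_edges_def by auto
    have j: "j \<in> {1..r}" using ij by simp
    have f: "snd x j \<in> FS V b" using xI j unfolding thI_def Pth_def by (auto simp: PiE_iff)
    have "{z, z'} = phi x ` {w, w'}" using z by simp
    also have "\<dots> = {snd x j i, snd x j (Suc i)}"
      unfolding ij(1) using phi_path_vertex[OF xI _ j, of i] phi_path_vertex[OF xI _ j, of "i + 1"] ij by simp
    also have "\<dots> \<in> E" using zw_edges[OF f zw[OF j]] ij by simp
    finally show "{z, z'} \<in> E" .
  qed
qed

text \<open>Only \<open>j0\<close> keeps its prescribed ends; the other paths are bounded
  conditionally on the ends, so just their inner positions are charged. \<open>V'\<close> and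
  \<open>E'\<close> are left free because \<open>\<chi>\<close> is valid in the original graph,
  whereas the walk lives in a subgraph.\<close>

lemma theta_spread:
  assumes j0: "j0 \<in> {1..r}" and \<chi>: "valid_set r b V' E' \<chi>" "finite V'"
    and z: "z = (\<lambda>w. THE y. (w, y) \<in> \<chi>)"
  shows "(\<Sum>x\<in>{x\<in>thJ r. \<chi> \<subseteq> hyp r x}. tm r x) \<le>
    sum (zw b) {f\<in>FS V b. agree (ppos b j0 (fst ` \<chi>)) (\<lambda>i. z (path_vertex b i j0)) f} *
    (\<Prod>j\<in>{1..r} - {j0}. \<Prod>i\<in>ppos b j (fst ` \<chi>) \<inter> {1..<b}. cost i)"
proof -
  let ?\<nu> = "fst ` \<chi>"
  let ?S = "\<lambda>j. if j = j0 then ppos b j ?\<nu> else ppos b j ?\<nu> \<inter> {1..<b}"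
  let ?Q = "\<lambda>j. agree (?S j) (\<lambda>i. z (path_vertex b i j))"
  have zw: "z w = y" if "(w, y) \<in> \<chi>" for w y
    unfolding z
  proof (rule the_equality)
    show "(w, y) \<in> \<chi>" by (rule that)
    fix y' assume "(w, y') \<in> \<chi>"
    then have "(w, y') = (w, y)" using inj_onD[OF valid_set_inj_fst[OF \<chi>], of "(w, y')" "(w, y)"] that by simp
    then show "y' = y" by simp
  qed
  have "(\<Sum>x\<in>{x\<in>thJ r. \<chi> \<subseteq> hyp r x}. tm r x) \<le> (\<Sum>x\<in>{x\<in>thI r. \<forall>j\<in>{1..r}. ?Q j (snd x j)}. tm r x)"
  proof (rule sum_mono2)
    show "finite {x\<in>thI r. \<forall>j\<in>{1..r}. ?Q j (snd x j)}" using finite_thI by auto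
    show "{x\<in>thJ r. \<chi> \<subseteq> hyp r x} \<subseteq> {x\<in>thI r. \<forall>j\<in>{1..r}. ?Q j (snd x j)}"
    proof (clarify, intro conjI ballI)
      fix u v F assume x: "((u, v), F) \<in> thJ r" "\<chi> \<subseteq> hyp r ((u, v), F)"
      let ?x = "((u, v), F)"
      show xI: "?x \<in> thI r" using x unfolding thJ_def by simp
      fix j assume j: "j \<in> {1..r}"
      have "snd ?x j i = z (path_vertex b i j)" if i: "i \<in> ppos b j ?\<nu>" for i
      proof -
        obtain y where y: "(path_vertex b i j, y) \<in> \<chi>" using i unfolding ppos_def by auto
        then have "y = phi ?x (path_vertex b i j)" using x unfolding hyp_def by auto
        then show ?thesis using zw[OF y] phi_path_vertex[OF xI _ j, of i] i unfolding ppos_def by simp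
      qed
      then show "?Q j (snd ?x j)" unfolding agree_def by (auto split: if_splits)
    qed
  qed (use tm_nonneg in auto)
  also have "\<dots> \<le> sum (zw b) {f\<in>FS V b. ?Q j0 f} * (\<Prod>j\<in>{1..r} - {j0}. \<Prod>i\<in>ppos b j ?\<nu> \<inter> {1..<b}. cost i)"
  proof (rule path_event_bound[OF j0])
    fix j u v assume "j \<in> {1..r} - {j0}" and uv: "u \<in> V" "v \<in> V"
    then have "j \<noteq> j0" by simp
    then show "(\<Sum>f\<in>{f\<in>Pth u v. ?Q j f}. zw b f) \<le> (\<Prod>i\<in>ppos b j ?\<nu> \<inter> {1..<b}. cost i) * pz u v"
      using conditional_spread[OF _ uv, of "ppos b j ?\<nu> \<inter> {1..<b}" "\<lambda>i. z (path_vertex b i j)"]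
      by (simp add: Pth_def conj_ac)
  qed (auto intro!: prod_nonneg cost_bounds)
  finally show ?thesis by simp
qed

end

section \<open>Cycles and paths in theta graphs\<close>

lemma cycle_neighbours:
  assumes c: "cycle_in E xs" and x: "x \<in> set xs"
  obtains y z where "y \<noteq> z" "y \<in> set xs" "z \<in> set xs" "{x, y} \<in> E" "{x, z} \<in> E"
proof -
  let ?n = "length xs"
  have n: "3 \<le> ?n" and d: "distinct xs" and e: "\<And>i. i < ?n \<Longrightarrow> {xs ! i, xs ! ((i + 1) mod ?n)} \<in> E"
    using c unfolding cycle_in_def by auto
  obtain i where i: "i < ?n" "xs ! i = x" using x by (auto simp: in_set_conv_nth)
  define l where "l = (if i = 0 then ?n - 1 else i - 1)"
  define m where "m = (i + 1) mod ?n"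
  have l: "l < ?n" "(l + 1) mod ?n = i" using i n unfolding l_def by auto
  have m: "m < ?n" unfolding m_def using i(1) by (intro mod_less_divisor) linarith
  have "m \<noteq> l"
  proof (cases "i + 1 = ?n")
    case True then show ?thesis using n unfolding m_def l_def by auto
  next
    case False then have "m = i + 1" using i unfolding m_def by simp
    then show ?thesis using i n False unfolding l_def by auto
  qed
  then have "xs ! m \<noteq> xs ! l" using d m l nth_eq_iff_index_eq by blast
  moreover have "{x, xs ! m} \<in> E" using e[OF i(1)] i m_def by simp
  moreover have "{x, xs ! l} \<in> E" using e[OF l(1)] i l by (simp add: insert_commute)
  ultimately show ?thesis using that m l by auto
qed

lemma theta_edge_at_W:
  assumes "{W i j, y} \<in> theta_edges a b"
  shows "1 \<le> i \<and> i < b \<and> 1 \<le> j \<and> j \<le> a \<and> (y = path_vertex b (i - 1) j \<or> y = path_vertex b (i + 1) j)"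
proof -
  obtain i' j' where ij: "{W i j, y} = {path_vertex b i' j', path_vertex b (i' + 1) j'}" "i' < b" "1 \<le> j'" "j' \<le> a"
    using assms unfolding theta_edges_def by auto
  then have "W i j = path_vertex b i' j' \<and> y = path_vertex b (i' + 1) j' \<or> W i j = path_vertex b (i' + 1) j' \<and> y = path_vertex b i' j'"
    by (auto simp: doubleton_eq_iff)
  then show ?thesis using ij(2-4) by (auto simp: path_vertex_def split: if_splits)
qed

text \<open>A cycle has at least three vertices, so it meets the inside of a path. Inner vertices
  have only two neighbours, both of which must then lie on the cycle; this spreads in both
  directions up to the ends.\<close>

lemma cycle_contains_path:
  assumes c: "cycle_in (induced_edges (theta_edges a b) \<nu>) xs"
  obtains j where "j \<in> {1..a}" "ppos b j \<nu> = {..b}"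
proof -
  let ?E = "induced_edges (theta_edges a b) \<nu>"
  have sub: "set xs \<subseteq> \<nu>"
  proof
    fix x assume "x \<in> set xs"
    then obtain y where "{x, y} \<in> ?E" using cycle_neighbours[OF c] by metis
    then show "x \<in> \<nu>" unfolding induced_edges_def by auto
  qed
  have "\<exists>i j. W i j \<in> set xs"
  proof (rule ccontr)
    assume "\<nexists>i j. W i j \<in> set xs"
    then have "set xs \<subseteq> {U_end, V_end}" by (metis insert_iff subsetI theta_vertex.exhaust)
    then have "card (set xs) \<le> card {U_end, V_end}" by (intro card_mono) auto
    then show False using c distinct_card[of xs] unfolding cycle_in_def by simp
  qed
  then obtain i j where ij: "W i j \<in> set xs" by auto
  have both: "1 \<le> i \<and> i < b \<and> 1 \<le> j \<and> j \<le> a \<and> path_vertex b (i - 1) j \<in> set xs \<and> path_vertex b (i + 1) j \<in> set xs"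
    if w: "W i j \<in> set xs" for i j
  proof -
    obtain y z where yz: "y \<noteq> z" "y \<in> set xs" "z \<in> set xs" "{W i j, y} \<in> ?E" "{W i j, z} \<in> ?E"
      by (rule cycle_neighbours[OF c w])
    then show ?thesis using theta_edge_at_W[of i j y a b] theta_edge_at_W[of i j z a b] unfolding induced_edges_def by auto
  qed
  have up: "m \<le> b \<longrightarrow> path_vertex b m j \<in> set xs" if "i \<le> m" for m
    using that
  proof (induction m rule: dec_induct)
    case base then show ?case using both[OF ij] ij by (auto simp: path_vertex_def)
  next
    case (step m)
    show ?case
    proof
      assume "Suc m \<le> b"
      then have "W m j \<in> set xs" using step both[OF ij] by (auto simp: path_vertex_def split: if_splits)
      then show "path_vertex b (Suc m) j \<in> set xs" using both[of m j] by simp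
    qed
  qed
  have down: "path_vertex b m j \<in> set xs" if "m \<le> i" for m
    using that
  proof (induction m rule: inc_induct)
    case base then show ?case using up[of i] both[OF ij] by simp
  next
    case (step m)
    then have "W (Suc m) j \<in> set xs" using both[OF ij] by (auto simp: path_vertex_def split: if_splits)
    then show ?case using both[of "Suc m" j] by simp
  qed
  have "path_vertex b m j \<in> \<nu>" if "m \<le> b" for m using up[of m] down[of m] that sub by (cases "i \<le> m") auto
  then have "ppos b j \<nu> = {..b}" unfolding ppos_def by auto
  then show ?thesis using that both[OF ij] by auto
qed

lemma two_paths_cycle:
  assumes j: "j \<in> {1..a}" "j' \<in> {1..a}" "j \<noteq> j'" and full: "ppos b j \<nu> = {..b}" "ppos b j' \<nu> = {..b}" and b: "2 \<le> b"
  shows "\<not> forest (induced_edges (theta_edges a b) \<nu>)"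
proof -
  \<comment> \<open>Up along path \<open>j\<close> and back along path \<open>j'\<close>; the two
    ends are visited once each.\<close>
  define g where "g i = (if i < b then path_vertex b i j else path_vertex b (2 * b - i) j')" for i
  have inj: "inj_on g {..<2 * b}"
    unfolding inj_on_def g_def path_vertex_def using j(3) b by (auto split: if_splits)
  have mem: "path_vertex b i j \<in> \<nu>" "path_vertex b i j' \<in> \<nu>" if "i \<le> b" for i
    using full that unfolding ppos_def by auto
  have edge: "{path_vertex b i l, path_vertex b (i + 1) l} \<in> induced_edges (theta_edges a b) \<nu>" if "i < b" "l = j \<or> l = j'" for i l
    unfolding induced_edges_def theta_edges_def using that mem[of i] mem[of "i + 1"] j by auto
  have wrap: "g ((i + 1) mod (2 * b)) = g (i + 1)" if "i < 2 * b" for i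
  proof (cases "i + 1 = 2 * b")
    case True then show ?thesis using b by (simp add: g_def path_vertex_def)
  qed (use that in simp)
  have gedge: "{g i, g (i + 1)} \<in> induced_edges (theta_edges a b) \<nu>" if "i < 2 * b" for i
  proof (cases "i < b")
    case True
    then have "g i = path_vertex b i j" "g (i + 1) = path_vertex b (i + 1) j" unfolding g_def path_vertex_def by auto
    then show ?thesis using edge[OF True] by simp
  next
    case False
    define l where "l = 2 * b - (i + 1)"
    have "g i = path_vertex b (l + 1) j'" "g (i + 1) = path_vertex b l j'" "l < b"
      using False that unfolding g_def l_def by (auto simp: Suc_diff_Suc)
    then show ?thesis using edge[of l j'] by (simp add: insert_commute)
  qed
  have "cycle_in (induced_edges (theta_edges a b) \<nu>) (map g [0..<2 * b])"
    unfolding cycle_in_def using b inj gedge wrap by (auto simp: distinct_map atLeast0LessThan)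
  then show ?thesis unfolding forest_def by blast
qed

section \<open>Counting edges by positions on the paths\<close>

definition ecount :: "nat set \<Rightarrow> nat" where
  "ecount T = card {i. i \<in> T \<and> Suc i \<in> T}"

text \<open>Sending each edge to its upper end is injective and misses the least position.\<close>

lemma ecount_le_card:
  assumes "finite T" "T \<noteq> {}"
  shows "ecount T + 1 \<le> card T"
proof -
  have "Suc ` {i. i \<in> T \<and> Suc i \<in> T} \<subseteq> T - {Min T}"
    using assms Min_le by fastforce
  then have "card (Suc ` {i. i \<in> T \<and> Suc i \<in> T}) \<le> card (T - {Min T})" using assms by (intro card_mono) auto
  also have "card (T - {Min T}) = card T - 1" using assms Min_in by simp
  finally have "ecount T \<le> card T - 1" unfolding ecount_def by (simp add: card_image)
  moreover have "card T \<ge> 1" using assms by (simp add: Suc_le_eq card_gt_0_iff)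
  ultimately show ?thesis by linarith
qed

text \<open>Send each edge to its end nearer to a missing position \<open>m\<close>. On either side
  of \<open>m\<close> this is injective, and the chosen end is never 0 or \<open>b\<close>.\<close>

lemma ecount_le_interior:
  assumes T: "T \<subseteq> {..b}" "T \<noteq> {..b}"
  shows "ecount T \<le> card (T \<inter> {1..<b})"
proof -
  obtain m where m: "m \<le> b" "m \<notin> T" using T by auto
  let ?A = "{i. i \<in> T \<and> Suc i \<in> T}"
  let ?g = "\<lambda>i. if i < m then Suc i else i"
  have "inj_on ?g ?A"
  proof (rule inj_onI)
    fix x y assume xy: "x \<in> ?A" "y \<in> ?A" "?g x = ?g y"
    have "Suc x \<noteq> m" "Suc y \<noteq> m" using xy m by auto
    then show "x = y" using xy(3) by (auto split: if_splits)
  qed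
  moreover have "?g ` ?A \<subseteq> T \<inter> {1..<b}"
  proof
    fix y assume "y \<in> ?g ` ?A"
    then obtain x where x: "x \<in> T" "Suc x \<in> T" "y = ?g x" by auto
    have "x \<noteq> m" "Suc x \<noteq> m" "Suc x \<le> b" using x m T by auto
    then show "y \<in> T \<inter> {1..<b}" using x m by auto
  qed
  ultimately show ?thesis unfolding ecount_def by (intro card_inj_on_le[of ?g]) auto
qed

lemma card_induced_le:
  "card (induced_edges (theta_edges a b) \<nu>) \<le> (\<Sum>j=1..a. ecount (ppos b j \<nu>))"
proof -
  let ?A = "\<lambda>j. {i. i \<in> ppos b j \<nu> \<and> Suc i \<in> ppos b j \<nu>}"
  let ?e = "\<lambda>j i. {path_vertex b i j, path_vertex b (i + 1) j}"
  have fin: "finite (?A j)" for j by (rule finite_subset[of _ "{..b}"]) (auto simp: ppos_def)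
  have "induced_edges (theta_edges a b) \<nu> \<subseteq> (\<Union>j\<in>{1..a}. ?e j ` ?A j)"
    unfolding induced_edges_def theta_edges_def ppos_def by force
  then have "card (induced_edges (theta_edges a b) \<nu>) \<le> card (\<Union>j\<in>{1..a}. ?e j ` ?A j)"
    using fin by (intro card_mono) auto
  also have "\<dots> \<le> (\<Sum>j=1..a. card (?e j ` ?A j))" by (rule card_UN_le) simp
  also have "\<dots> \<le> (\<Sum>j=1..a. card (?A j))" by (intro sum_mono card_image_le fin)
  finally show ?thesis unfolding ecount_def .
qed

lemma card_W_Sigma:
  fixes S :: "nat \<Rightarrow> nat set"
  assumes "\<And>j. finite (S j)"
  shows "card {W i j | i j. j \<in> {1..a} \<and> i \<in> S j} = (\<Sum>j=1..a. card (S j))"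
proof -
  have "{W i j | i j. j \<in> {1..a} \<and> i \<in> S j} = (\<lambda>(j, i). W i j) ` Sigma {1..a} S" by auto
  moreover have "inj_on (\<lambda>(j, i). W i j) (Sigma {1..a} S)" by (auto simp: inj_on_def)
  ultimately show ?thesis using assms by (simp add: card_image)
qed

lemma card_theta_subset:
  assumes \<nu>: "\<nu> \<subseteq> theta_verts a b" and ends: "U_end \<in> \<nu>" "V_end \<in> \<nu>"
  shows "card \<nu> = 2 + (\<Sum>j=1..a. card (ppos b j \<nu> \<inter> {1..<b}))"
proof -
  let ?X = "{W i j | i j. j \<in> {1..a} \<and> i \<in> ppos b j \<nu> \<inter> {1..<b}}"
  have interior: "i \<in> ppos b j \<nu> \<inter> {1..<b} \<longleftrightarrow> W i j \<in> \<nu> \<and> i \<in> {1..<b}" for i j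
    unfolding ppos_def path_vertex_def by auto
  have "\<nu> = {U_end, V_end} \<union> ?X"
    using \<nu> ends unfolding theta_verts_def interior by auto
  moreover have "finite ?X" using \<nu> finite_theta_verts[of a b] calculation by (metis (no_types, lifting) finite_Un finite_subset)
  moreover have "{U_end, V_end} \<inter> ?X = {}" by auto
  ultimately have "card \<nu> = card {U_end, V_end} + card ?X" by (metis (no_types, lifting) card_Un_disjoint finite.emptyI finite.insertI)
  then show ?thesis using card_W_Sigma[of "\<lambda>j. ppos b j \<nu> \<inter> {1..<b}" a] by simp
qed

definition fcount :: "nat \<Rightarrow> nat set \<Rightarrow> nat" where
  "fcount t S = card {i\<in>S. t \<le> i \<and> even (i - t)}"

lemma card_F_set:
  assumes t: "1 \<le> t"
  shows "card (\<nu> \<inter> F_set a b t) = (\<Sum>j=1..a. fcount t (ppos b j \<nu> \<inter> {1..<b}))"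
proof -
  have "\<nu> \<inter> F_set a b t = {W i j | i j. j \<in> {1..a} \<and> i \<in> {i \<in> ppos b j \<nu> \<inter> {1..<b}. t \<le> i \<and> even (i - t)}}"
  proof -
    have interior: "i \<in> ppos b j \<nu> \<inter> {1..<b} \<longleftrightarrow> W i j \<in> \<nu> \<and> i \<in> {1..<b}" for i j
      unfolding ppos_def path_vertex_def by auto
    show ?thesis using t unfolding F_set_def mem_Collect_eq interior by auto
  qed
  then show ?thesis
    using card_W_Sigma[of "\<lambda>j. {i \<in> ppos b j \<nu> \<inter> {1..<b}. t \<le> i \<and> even (i - t)}" a]
    unfolding fcount_def by simp
qed

text \<open>\<open>fcount t {t..<b}\<close> is half of \<open>b - t\<close>, rounded up. Shifting
  the window by one drops time \<open>t\<close> and adds time \<open>b\<close>, which counts exactly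
  when \<open>b - t\<close> is even.\<close>

lemma parity_counts:
  assumes "t \<le> b"
  shows "fcount t {Suc t..b} + of_bool (odd (b - t)) = fcount t {t..<b}"
    and "b - t + of_bool (odd (b - t)) = 2 * fcount t {t..<b}"
  using assms
proof (induction b rule: dec_induct)
  case base { case 1 show ?case by (simp add: fcount_def) next case 2 show ?case by (simp add: fcount_def) }
next
  case (step b)
  have A: "{i\<in>{t..<Suc b}. t \<le> i \<and> even (i - t)} = (if even (b - t) then insert b {i\<in>{t..<b}. t \<le> i \<and> even (i - t)} else {i\<in>{t..<b}. t \<le> i \<and> even (i - t)})"
    using step by (auto simp: less_Suc_eq)
  have B: "{i\<in>{Suc t..Suc b}. t \<le> i \<and> even (i - t)} = (if even (Suc b - t) then insert (Suc b) {i\<in>{Suc t..b}. t \<le> i \<and> even (i - t)} else {i\<in>{Suc t..b}. t \<le> i \<and> even (i - t)})"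
    using step by (auto simp: le_Suc_eq)
  have A': "fcount t {t..<Suc b} = fcount t {t..<b} + of_bool (even (b - t))" unfolding fcount_def A by simp
  have B': "fcount t {Suc t..Suc b} = fcount t {Suc t..b} + of_bool (even (Suc b - t))" unfolding fcount_def B by simp
  { case 1 show ?case using step A' B' by (auto simp: Suc_diff_le) next case 2 show ?case using step A' by (auto simp: Suc_diff_le) }
qed

section \<open>Spread of the random theta graph\<close>

context zigzag
begin

definition C1 :: real where "C1 = 16 / c2"

lemma C1: "2 \<le> C1" "1 \<le> C1" "cK = C1 / \<kappa>" "cF = C1 / (\<kappa> * \<rho>)"
  unfolding C1_def cK_def cF_def using c2 by (auto simp: field_simps)

lemma cost_eq: "cost l = C1 / (\<kappa> * \<rho> ^ of_bool (t \<le> l \<and> even (l - t)))"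
  unfolding cost_def C1 by auto

lemma prod_cost: "finite S \<Longrightarrow> (\<Prod>i\<in>S. cost i) = C1 ^ card S / (\<kappa> ^ card S * \<rho> ^ fcount t S)"
proof -
  assume S: "finite S"
  have "(\<Prod>i\<in>S. cost i) = (\<Prod>i\<in>S. C1) / ((\<Prod>i\<in>S. \<kappa>) * (\<Prod>i\<in>S. \<rho> ^ of_bool (t \<le> i \<and> even (i - t))))"
    unfolding cost_eq by (simp only: prod_dividef prod.distrib)
  also have "(\<Prod>i\<in>S. \<rho> ^ of_bool (t \<le> i \<and> even (i - t))) = \<rho> ^ (\<Sum>i\<in>S. of_bool (t \<le> i \<and> even (i - t)))"
    by (rule power_sum[symmetric])
  also have "(\<Sum>i\<in>S. of_bool (t \<le> i \<and> even (i - t))) = fcount t S"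
    using S unfolding fcount_def by (simp only: sum_of_bool_eq of_nat_id Collect_conj_eq Collect_mem_eq)
  finally show ?thesis by simp
qed

text \<open>Some edge of \<open>T\<close> lies either within the first \<open>t\<close> steps or in
  the zigzag part; it pays \<open>1 / M\<close>, and each position off this edge pays
  \<open>cK\<close>. The resulting exponent falls short of the number of edges by at most
  one.\<close>

lemma edge_spread:
  assumes T: "T \<subseteq> {..b}" and e: "1 \<le> ecount T"
  obtains p where "ecount T \<le> p + 1" "p \<le> b" "sum (zw b) {f\<in>FS V b. agree T z f} \<le> 1 / M * cK ^ p"
proof (cases "\<exists>i. i \<in> T \<and> Suc i \<in> T \<and> Suc i \<le> t")
  case True
  then obtain i where i: "i \<in> T" "Suc i \<in> T" "Suc i \<le> t" by auto
  have fin: "finite T" "T \<noteq> {}" using T i finite_subset by auto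
  have "card T \<le> b + 1" using card_mono[OF _ T] by simp
  then show ?thesis
    using that[of "card T - 2"] ecount_le_card[OF fin] edge_spread_initial[OF T i, of z] by auto
next
  case False
  have "{i. i \<in> T \<and> Suc i \<in> T} \<noteq> {}" using e unfolding ecount_def by (metis card.empty not_one_le_zero)
  then obtain i where i: "i \<in> T" "Suc i \<in> T" by auto
  then have it: "t \<le> i" using False by auto
  \<comment> \<open>No edge of \<open>T\<close> lies within the first \<open>t\<close> steps, so
    dropping time 0 destroys none.\<close>
  let ?T = "T - {0}"
  have T': "?T \<subseteq> {..b}" "i \<in> ?T" "Suc i \<in> ?T" "0 \<notin> ?T" using T i it t2 by auto
  have fin: "finite ?T" "?T \<noteq> {}" using T' finite_subset[OF T'(1)] by auto
  have "{i. i \<in> T \<and> Suc i \<in> T} = {i. i \<in> ?T \<and> Suc i \<in> ?T}" using False t2 by (auto intro: gr0I)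
  then have ec: "ecount T = ecount ?T" unfolding ecount_def by simp
  have "card ?T \<le> b + 1" using card_mono[OF _ T'(1)] by simp
  moreover have "sum (zw b) {f\<in>FS V b. agree T z f} \<le> sum (zw b) {f\<in>FS V b. agree ?T z f}"
    by (rule sum_mono2[OF finFS]) (auto simp: agree_def zw_nonneg)
  ultimately show ?thesis
    using that[of "card ?T - 2"] ecount_le_card[OF fin] edge_spread_zigzag[OF T'(1-3) it T'(4), of z] ec by auto
qed

text \<open>A forest contains at most one whole path; that path is taken as \<open>j0\<close> if it
  exists, otherwise any path with an edge. Every other path misses a position, so its edges are at
  most as many as its prescribed inner vertices, each of which pays \<open>cK\<close>. Path
  \<open>j0\<close> pays \<open>1 / M\<close> for one edge.\<close>

lemma theta_forest_spread:
  assumes \<chi>: "valid_set r b V' E' \<chi>" "finite V'"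
    and forest: "forest (induced_edges (theta_edges r b) (fst ` \<chi>))"
    and e: "1 \<le> card (induced_edges (theta_edges r b) (fst ` \<chi>))"
  shows "(\<Sum>x\<in>{x\<in>thJ r. \<chi> \<subseteq> hyp r x}. tm r x) \<le>
    1 / M * C1 ^ (b + r * b) / \<kappa> ^ (card (induced_edges (theta_edges r b) (fst ` \<chi>)) - 1)"
proof -
  let ?\<nu> = "fst ` \<chi>" and ?z = "\<lambda>w. THE y. (w, y) \<in> \<chi>"
  let ?e = "card (induced_edges (theta_edges r b) ?\<nu>)"
  let ?s = "\<lambda>j. card (ppos b j ?\<nu> \<inter> {1..<b})"
  have sub: "ppos b j ?\<nu> \<subseteq> {..b}" for j unfolding ppos_def by auto
  have "\<exists>j0\<in>{1..r}. 1 \<le> ecount (ppos b j0 ?\<nu>) \<and> (\<forall>j\<in>{1..r} - {j0}. ppos b j ?\<nu> \<noteq> {..b})"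
  proof (cases "\<exists>j0\<in>{1..r}. ppos b j0 ?\<nu> = {..b}")
    case True
    then obtain j0 where j0: "j0 \<in> {1..r}" "ppos b j0 ?\<nu> = {..b}" by auto
    have "{0} \<subseteq> {i. i \<in> {..b} \<and> Suc i \<in> {..b}}" using b2 by auto
    then have "card {0::nat} \<le> card {i. i \<in> {..b} \<and> Suc i \<in> {..b}}" by (intro card_mono) auto
    then have "1 \<le> ecount {..b}" unfolding ecount_def by simp
    moreover have "ppos b j ?\<nu> \<noteq> {..b}" if "j \<in> {1..r} - {j0}" for j
      using two_paths_cycle[OF j0(1) _ _ j0(2) _ b2, of j] forest that by blast
    ultimately show ?thesis using j0 by (intro bexI[of _ j0]) auto
  next
    case False
    have "\<exists>j0\<in>{1..r}. 1 \<le> ecount (ppos b j0 ?\<nu>)"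
    proof (rule ccontr)
      assume "\<not> ?thesis"
      then have "(\<Sum>j=1..r. ecount (ppos b j ?\<nu>)) = 0" by (auto simp: not_le)
      then show False using e card_induced_le[of r b ?\<nu>] by simp
    qed
    then show ?thesis using False by auto
  qed
  then obtain j0 where j0: "j0 \<in> {1..r}" "1 \<le> ecount (ppos b j0 ?\<nu>)" "\<And>j. j \<in> {1..r} - {j0} \<Longrightarrow> ppos b j ?\<nu> \<noteq> {..b}"
    by auto
  obtain p where p: "ecount (ppos b j0 ?\<nu>) \<le> p + 1" "p \<le> b"
    "sum (zw b) {f\<in>FS V b. agree (ppos b j0 ?\<nu>) (\<lambda>i. ?z (path_vertex b i j0)) f} \<le> 1 / M * cK ^ p"
    by (rule edge_spread[OF sub j0(2)])
  let ?m = "p + (\<Sum>j\<in>{1..r} - {j0}. ?s j)"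
  have le1: "?e \<le> ?m + 1"
  proof -
    have "?e \<le> (\<Sum>j=1..r. ecount (ppos b j ?\<nu>))" by (rule card_induced_le)
    also have "\<dots> = ecount (ppos b j0 ?\<nu>) + (\<Sum>j\<in>{1..r} - {j0}. ecount (ppos b j ?\<nu>))"
      using j0 by (intro sum.remove) auto
    also have "(\<Sum>j\<in>{1..r} - {j0}. ecount (ppos b j ?\<nu>)) \<le> (\<Sum>j\<in>{1..r} - {j0}. ?s j)"
      using j0 sub by (intro sum_mono ecount_le_interior) auto
    finally show ?thesis using p by simp
  qed
  have le2: "?m \<le> b + r * b"
  proof -
    have "?s j \<le> b" for j using card_mono[of "{1..<b}" "ppos b j ?\<nu> \<inter> {1..<b}"] by simp
    then have "(\<Sum>j\<in>{1..r} - {j0}. ?s j) \<le> (\<Sum>j\<in>{1..r} - {j0}. b)" by (intro sum_mono)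
    also have "\<dots> \<le> r * b" using card_mono[of "{1..r}" "{1..r} - {j0}"] by simp
    finally show ?thesis using p by simp
  qed
  have "(\<Sum>x\<in>{x\<in>thJ r. \<chi> \<subseteq> hyp r x}. tm r x) \<le>
    sum (zw b) {f\<in>FS V b. agree (ppos b j0 ?\<nu>) (\<lambda>i. ?z (path_vertex b i j0)) f} *
    (\<Prod>j\<in>{1..r} - {j0}. \<Prod>i\<in>ppos b j ?\<nu> \<inter> {1..<b}. cost i)"
    by (rule theta_spread[OF j0(1) \<chi> refl])
  also have "\<dots> \<le> (1 / M * cK ^ p) * (\<Prod>j\<in>{1..r} - {j0}. cK ^ ?s j)"
  proof (intro mult_mono p prod_mono conjI)
    fix j show "0 \<le> (\<Prod>i\<in>ppos b j ?\<nu> \<inter> {1..<b}. cost i)" by (intro prod_nonneg cost_bounds)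
    have "(\<Prod>i\<in>ppos b j ?\<nu> \<inter> {1..<b}. cost i) \<le> (\<Prod>i\<in>ppos b j ?\<nu> \<inter> {1..<b}. cK)"
      using cost_bounds by (intro prod_mono) auto
    then show "(\<Prod>i\<in>ppos b j ?\<nu> \<inter> {1..<b}. cost i) \<le> cK ^ ?s j" by simp
  qed (use M_pos cKF cost_bounds in \<open>auto intro!: prod_nonneg\<close>)
  also have "\<dots> = 1 / M * cK ^ ?m" by (simp add: power_add power_sum)
  also have "\<dots> = 1 / M * (C1 ^ ?m / \<kappa> ^ ?m)" unfolding C1 by (simp add: power_divide)
  also have "\<dots> \<le> 1 / M * (C1 ^ (b + r * b) / \<kappa> ^ (?e - 1))"
    using le1 le2 C1 M_pos \<kappa>1 by (intro mult_left_mono frac_le power_increasing) auto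
  finally show ?thesis by simp
qed

text \<open>A cycle forces a whole path \<open>j0\<close> into the set, hence both ends. That path
  is priced by \<open>zw_full_le\<close>, the inner vertices of the others by their conditional
  costs. The exponents then depend only on the size of the set and of its part in
  \<open>F_set\<close>.\<close>

lemma theta_nonforest_spread:
  assumes \<chi>: "valid_set r b V' E' \<chi>" "finite V'"
    and nonforest: "\<not> forest (induced_edges (theta_edges r b) (fst ` \<chi>))"
  shows "(\<Sum>x\<in>{x\<in>thJ r. \<chi> \<subseteq> hyp r x}. tm r x) \<le>
      1 / M * C1 ^ (b + r * b) * \<rho> ^ of_bool (odd (b - t)) /
      (\<kappa> ^ (card (fst ` \<chi>) - 2) * \<rho> ^ (t - 1 + card (fst ` \<chi> \<inter> F_set r b t)))"
    and "U_end \<in> fst ` \<chi>" "V_end \<in> fst ` \<chi>"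
    and "b + 1 \<le> card (fst ` \<chi>)" "of_bool (odd (b - t)) \<le> card (fst ` \<chi> \<inter> F_set r b t)"
proof -
  let ?\<nu> = "fst ` \<chi>" and ?z = "\<lambda>w. THE y. (w, y) \<in> \<chi>"
  let ?S = "\<lambda>j. ppos b j ?\<nu> \<inter> {1..<b}"
  obtain j0 where j0: "j0 \<in> {1..r}" "ppos b j0 ?\<nu> = {..b}"
    using nonforest cycle_contains_path unfolding forest_def by metis
  then have pv: "path_vertex b i j0 \<in> ?\<nu>" if "i \<le> b" for i using that unfolding ppos_def by auto
  show ends: "U_end \<in> ?\<nu>" "V_end \<in> ?\<nu>" using pv[of 0] pv[of b] b2 by (auto simp: path_vertex_def)
  have \<nu>: "?\<nu> \<subseteq> theta_verts r b" using \<chi> unfolding valid_set_def by auto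
  have S0: "?S j0 = {1..<b}" unfolding j0(2) by auto
  have card\<nu>: "card ?\<nu> = b + 1 + (\<Sum>j\<in>{1..r} - {j0}. card (?S j))"
  proof -
    have "(\<Sum>j=1..r. card (?S j)) = card (?S j0) + (\<Sum>j\<in>{1..r} - {j0}. card (?S j))"
      using j0 by (intro sum.remove) auto
    moreover have "card (?S j0) = b - 1" unfolding S0 by simp
    ultimately show ?thesis unfolding card_theta_subset[OF \<nu> ends] using b2 by linarith
  qed
  show "b + 1 \<le> card ?\<nu>" using card\<nu> by simp
  have F0: "fcount t {1..<b} = fcount t {t..<b}"
    unfolding fcount_def using t2 by (intro arg_cong[where f=card]) auto
  have cardF: "card (?\<nu> \<inter> F_set r b t) = fcount t {t..<b} + (\<Sum>j\<in>{1..r} - {j0}. fcount t (?S j))"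
  proof -
    have "(\<Sum>j=1..r. fcount t (?S j)) = fcount t (?S j0) + (\<Sum>j\<in>{1..r} - {j0}. fcount t (?S j))"
      using j0 by (intro sum.remove) auto
    moreover have "card (?\<nu> \<inter> F_set r b t) = (\<Sum>j=1..r. fcount t (?S j))"
      using t2 by (intro card_F_set) simp
    ultimately show ?thesis unfolding S0 F0 by linarith
  qed
  \<comment> \<open>The whole path is charged for level-\<open>t\<close> times after
    \<open>t\<close> up to \<open>b\<close>, whereas \<open>F_set\<close> counts those from
    \<open>t\<close> to \<open>b - 1\<close>; this difference is the parity correction.\<close>
  have par: "fcount t {Suc t..b} + of_bool (odd (b - t)) = fcount t {t..<b}" by (rule parity_counts(1)[OF tb])
  show "of_bool (odd (b - t)) \<le> card (?\<nu> \<inter> F_set r b t)" using cardF par by simp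
  let ?B = "\<Sum>j\<in>{1..r} - {j0}. card (?S j)" and ?A = "\<Sum>j\<in>{1..r} - {j0}. fcount t (?S j)"
  \<comment> \<open>All positions are prescribed and sequences are extensional, so the sum has at
    most one term.\<close>
  have first: "sum (zw b) {f\<in>FS V b. agree {..b} (\<lambda>i. ?z (path_vertex b i j0)) f} \<le>
    1 / M * (2 / (\<kappa> * \<rho>)) ^ (t - 1) * (\<Prod>l=Suc t..b. cost l)" (is "sum _ ?X \<le> ?R")
  proof (cases "?X = {}")
    case True
    have "0 \<le> ?R" using M_pos \<kappa>\<rho>_pos cost_bounds by (intro mult_nonneg_nonneg prod_nonneg) auto
    then show ?thesis using True by (simp only: sum.empty)
  next
    case False
    then obtain f where f: "f \<in> ?X" by auto
    have "?X = {f}"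
    proof -
      have "g = f" if "g \<in> ?X" for g
      proof
        fix i show "g i = f i"
          using f that by (cases "i \<le> b") (auto simp: agree_def FS_def PiE_iff extensional_def)
      qed
      then show ?thesis using f by blast
    qed
    then have "sum (zw b) ?X = zw b f" by (simp only: sum.insert finite.emptyI empty_iff sum.empty simp_thms if_False add_0_right)
    then show ?thesis using zw_full_le[of f] f by auto
  qed
  have "(\<Sum>x\<in>{x\<in>thJ r. \<chi> \<subseteq> hyp r x}. tm r x) \<le>
    sum (zw b) {f\<in>FS V b. agree (ppos b j0 ?\<nu>) (\<lambda>i. ?z (path_vertex b i j0)) f} *
    (\<Prod>j\<in>{1..r} - {j0}. \<Prod>i\<in>?S j. cost i)"
    by (rule theta_spread[OF j0(1) \<chi> refl])
  also have "\<dots> \<le> (1 / M * (2 / (\<kappa> * \<rho>)) ^ (t - 1) * (\<Prod>l=Suc t..b. cost l)) * (\<Prod>j\<in>{1..r} - {j0}. \<Prod>i\<in>?S j. cost i)"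
    unfolding j0(2) by (rule mult_right_mono[OF first]) (auto intro!: prod_nonneg cost_bounds)
  also have "(\<Prod>l=Suc t..b. cost l) = C1 ^ (b - t) / (\<kappa> ^ (b - t) * \<rho> ^ fcount t {Suc t..b})"
    by (simp add: prod_cost)
  also have "(\<Prod>j\<in>{1..r} - {j0}. \<Prod>i\<in>?S j. cost i) = C1 ^ ?B / (\<kappa> ^ ?B * \<rho> ^ ?A)"
    by (simp add: prod_cost prod_dividef prod.distrib power_sum)
  also have "(1 / M * (2 / (\<kappa> * \<rho>)) ^ (t - 1) * (C1 ^ (b - t) / (\<kappa> ^ (b - t) * \<rho> ^ fcount t {Suc t..b}))) * (C1 ^ ?B / (\<kappa> ^ ?B * \<rho> ^ ?A))
    = 1 / M * (2 ^ (t - 1) * C1 ^ (b - t + ?B)) / (\<kappa> ^ (t - 1 + (b - t) + ?B) * \<rho> ^ (t - 1 + fcount t {Suc t..b} + ?A))"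
    by (simp add: power_divide power_mult_distrib power_add mult_ac)
  also have "\<dots> \<le> 1 / M * C1 ^ (b + r * b) / (\<kappa> ^ (t - 1 + (b - t) + ?B) * \<rho> ^ (t - 1 + fcount t {Suc t..b} + ?A))"
  proof (intro divide_right_mono mult_left_mono)
    have "card (?S j) \<le> b" for j using card_mono[of "{1..<b}" "?S j"] by simp
    then have "?B \<le> (\<Sum>j\<in>{1..r} - {j0}. b)" by (intro sum_mono)
    also have "\<dots> \<le> r * b" using card_mono[of "{1..r}" "{1..r} - {j0}"] by simp
    finally have B: "?B \<le> r * b" .
    have "2 ^ (t - 1) * C1 ^ (b - t + ?B) \<le> C1 ^ (t - 1) * C1 ^ (b - t + ?B)"
      using C1 by (intro mult_right_mono power_mono) auto
    also have "\<dots> = C1 ^ (t - 1 + (b - t + ?B))" by (simp add: power_add)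
    also have "\<dots> \<le> C1 ^ (b + r * b)" using C1 B tb by (intro power_increasing) auto
    finally show "2 ^ (t - 1) * C1 ^ (b - t + ?B) \<le> C1 ^ (b + r * b)" .
  qed (use M_pos \<kappa>\<rho>_pos in auto)
  also have "t - 1 + (b - t) + ?B = card ?\<nu> - 2" using card\<nu> t2 tb by simp
  also have "1 / M * C1 ^ (b + r * b) / (\<kappa> ^ (card ?\<nu> - 2) * \<rho> ^ (t - 1 + fcount t {Suc t..b} + ?A)) =
     1 / M * C1 ^ (b + r * b) * \<rho> ^ of_bool (odd (b - t)) / (\<kappa> ^ (card ?\<nu> - 2) * \<rho> ^ (t - 1 + card (?\<nu> \<inter> F_set r b t)))"
    using \<kappa>\<rho>_pos unfolding cardF par[symmetric] power_add by simp
  finally show "(\<Sum>x\<in>{x\<in>thJ r. \<chi> \<subseteq> hyp r x}. tm r x) \<le>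
      1 / M * C1 ^ (b + r * b) * \<rho> ^ of_bool (odd (b - t)) /
      (\<kappa> ^ (card ?\<nu> - 2) * \<rho> ^ (t - 1 + card (?\<nu> \<inter> F_set r b t)))" .
qed

end

section \<open>The parameters\<close>

lemma ceil_enat_pos:
  assumes "0 < x"
  shows "\<exists>q. ceil_enat x = enat q \<and> 1 \<le> q \<and> x \<le> real q"
proof -
  have "x \<le> real (nat \<lceil>x\<rceil>)" by (rule real_nat_ceiling_ge)
  moreover have "1 \<le> nat \<lceil>x\<rceil>" using assms by (simp add: Suc_le_eq)
  ultimately show ?thesis unfolding ceil_enat_def by blast
qed

lemma card_edges_le_square:
  assumes G: "finite_simple_graph V E"
  shows "card E \<le> (card V)\<^sup>2"
proof -
  have V: "finite V" using G unfolding finite_simple_graph_def by simp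
  have "E \<subseteq> (\<lambda>(x, y). {x, y}) ` (V \<times> V)"
  proof
    fix e assume "e \<in> E"
    then have "e \<subseteq> V" "card e = 2" using G unfolding finite_simple_graph_def by auto
    then obtain x y where "e = {x, y}" "x \<in> V" "y \<in> V" by (metis card_2_iff insert_subset)
    then show "e \<in> (\<lambda>(x, y). {x, y}) ` (V \<times> V)" by auto
  qed
  then have "card E \<le> card ((\<lambda>(x, y). {x, y}) ` (V \<times> V))" using V by (intro card_mono) auto
  also have "\<dots> \<le> card (V \<times> V)" using V by (intro card_image_le) auto
  finally show ?thesis by (simp add: card_cartesian_product power2_eq_square)
qed

locale params =
  fixes b n :: nat and k \<kappa> \<rho> :: real
  assumes b2: "2 \<le> b" and n1: "1 \<le> n" and k1: "1 \<le> k"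
    and \<kappa>: "\<kappa> = k powr (real b / (real b - 1))"
    and \<rho>: "\<rho> = real n powr (1 / real b) * k powr (- 1 / (real b - 1))"
begin

lemma pos: "0 < \<kappa>" "0 < \<rho>" unfolding \<kappa> \<rho> using k1 n1 by auto

lemma \<kappa>_ge: "k \<le> \<kappa>"
proof -
  have "1 \<le> real b / (real b - 1)" using b2 by (simp add: field_simps)
  then have "k powr 1 \<le> \<kappa>" unfolding \<kappa> using k1 by (intro powr_mono) auto
  then show ?thesis using k1 by simp
qed

lemma \<kappa>\<rho>: "\<kappa> * \<rho> = k * real n powr (1 / real b)"
proof -
  have "k powr (real b / (real b - 1)) * k powr (- 1 / (real b - 1)) = k powr 1"
    unfolding powr_add[symmetric] using b2
    by (intro arg_cong[where f="\<lambda>x. k powr x"]) (simp add: diff_divide_distrib[symmetric])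
  then show ?thesis unfolding \<kappa> \<rho> using k1 by (simp add: mult_ac)
qed

lemma n_eq: "real n = \<kappa> * \<rho> ^ b"
proof -
  have "\<rho> ^ b = \<rho> powr real b" using pos by (simp add: powr_realpow)
  also have "\<dots> = (real n powr (1 / real b)) powr real b * (k powr (- 1 / (real b - 1))) powr real b"
    unfolding \<rho> by (rule powr_mult)
  also have "\<dots> = real n * k powr (- (real b / (real b - 1)))"
    using b2 n1 by (simp add: powr_powr)
  finally show ?thesis unfolding \<kappa> using k1 by (simp add: powr_minus field_simps)
qed

lemma k_pow: "k ^ b = \<kappa> ^ (b - 1)"
proof -
  have "\<kappa> ^ (b - 1) = \<kappa> powr real (b - 1)" using pos by (simp add: powr_realpow)
  also have "\<dots> = k powr real b" unfolding \<kappa> using b2 by (simp add: powr_powr)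
  finally show ?thesis using k1 by (simp add: powr_realpow)
qed

lemma edges_eq: "k * real n powr (1 + 1 / real b) = \<kappa> * \<rho> * real n"
  unfolding \<kappa>\<rho> using n1 by (simp add: powr_add)

text \<open>The number of edges is at most \<open>n\<^sup>2\<close>, so
  \<open>\<kappa> * \<rho>\<close> is at most \<open>n\<close>, that is
  \<open>\<kappa> * \<rho> ^ b\<close>.\<close>

lemma \<rho>_ge:
  assumes "k * real n powr (1 + 1 / real b) \<le> (real n)\<^sup>2"
  shows "1 \<le> \<rho>"
proof -
  have "\<kappa> * \<rho> * real n \<le> real n * real n" using assms unfolding edges_eq by (simp add: power2_eq_square)
  then have "\<kappa> * \<rho> \<le> real n" using n1 by (intro mult_right_le_imp_le[of "\<kappa> * \<rho>" "real n" "real n"]) auto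
  then have "\<rho> \<le> \<rho> * \<rho> ^ (b - 1)" unfolding n_eq using pos b2 by (simp add: power_eq_if)
  then have "1 \<le> \<rho> ^ (b - 1)" using pos by simp
  then show ?thesis using power_strict_mono[of \<rho> 1 "b - 1"] pos b2 by fastforce
qed

section \<open>The codegree functions in powers of \<open>\<kappa>\<close> and
  \<open>\<rho>\<close>\<close>

lemma count_eq: "k ^ (a * b) * (real n)\<^sup>2 = \<kappa> ^ (2 + a * (b - 1)) * \<rho> ^ (2 * b)"
proof -
  have "k ^ (a * b) = \<kappa> ^ (a * (b - 1))" by (metis k_pow mult.commute power_mult)
  moreover have "(real n)\<^sup>2 = \<kappa>\<^sup>2 * \<rho> ^ (2 * b)" unfolding n_eq by (simp add: power_mult_distrib power_mult[symmetric] mult.commute)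
  ultimately show ?thesis by (simp only: power_add mult_ac)
qed

lemma denom_0b: "(real n)\<^sup>2 * \<delta> * (k ^ b) powr ((real c - 2) / (real b - 1)) = \<delta> * (\<kappa> powr real c * \<rho> powr real (2 * b))"
proof -
  have "(k ^ b) powr ((real c - 2) / (real b - 1)) = \<kappa> powr (real c - 2)"
    unfolding k_pow powr_realpow[OF pos(1), symmetric] powr_powr using b2 by simp
  moreover have "(real n)\<^sup>2 = \<kappa> powr 2 * \<rho> powr real (2 * b)"
  proof -
    have "(real n)\<^sup>2 = \<kappa>\<^sup>2 * \<rho> ^ (2 * b)" unfolding n_eq by (simp add: power_mult_distrib power_mult[symmetric] mult.commute)
    then show ?thesis unfolding powr_realpow[OF pos(2)] using pos by simp
  qed
  moreover have "\<kappa> powr 2 * \<kappa> powr (real c - 2) = \<kappa> powr real c" by (simp add: powr_add[symmetric])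
  ultimately show ?thesis by (simp add: mult_ac)
qed

lemma denom_0:
  "k powr ((2 * real b - 2 * real t + 1) / (real b - 1)) * real n powr ((2 * real t - 1) / real b) * \<delta> *
     (k * real n powr (1 / real b)) ^ f * (k powr (real b / (real b - 1))) powr (real c - real f - 2) =
   \<delta> * (\<kappa> powr real c * \<rho> powr (2 * real t - 1 + real f))"
proof -
  have "\<kappa> powr 2 * \<rho> powr (2 * real t - 1) =
      k powr (2 * (real b / (real b - 1))) * (real n powr ((2 * real t - 1) / real b) * k powr (- (2 * real t - 1) / (real b - 1)))"
  proof -
    have "- 1 / (real b - 1) * (2 * real t - 1) = - (2 * real t - 1) / (real b - 1)"
      "1 / real b * (2 * real t - 1) = (2 * real t - 1) / real b"
      "real b / (real b - 1) * 2 = 2 * (real b / (real b - 1))"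
      by (simp_all only: times_divide_eq_left mult_1_left mult_minus_left mult.commute times_divide_eq_right)
    then show ?thesis unfolding \<rho> \<kappa> powr_mult powr_powr by (simp only:)
  qed
  also have "\<dots> = (k powr (2 * (real b / (real b - 1))) * k powr (- (2 * real t - 1) / (real b - 1))) * real n powr ((2 * real t - 1) / real b)"
    by (simp add: mult_ac)
  also have "k powr (2 * (real b / (real b - 1))) * k powr (- (2 * real t - 1) / (real b - 1)) = k powr ((2 * real b - 2 * real t + 1) / (real b - 1))"
    unfolding powr_add[symmetric] by (intro arg_cong[where f="\<lambda>x. k powr x"]) (simp add: minus_divide_left add_divide_distrib[symmetric])
  finally have 1: "k powr ((2 * real b - 2 * real t + 1) / (real b - 1)) * real n powr ((2 * real t - 1) / real b) = \<kappa> powr 2 * \<rho> powr (2 * real t - 1)" ..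
  have 2: "(k * real n powr (1 / real b)) ^ f = \<kappa> powr real f * \<rho> powr real f"
    unfolding \<kappa>\<rho>[symmetric] using pos by (simp add: power_mult_distrib powr_realpow)
  have "\<kappa> powr 2 * \<kappa> powr real f * \<kappa> powr (real c - real f - 2) = \<kappa> powr real c" by (simp add: powr_add[symmetric])
  then show ?thesis unfolding 1 2 \<kappa>[symmetric] by (simp add: powr_add)
qed

lemma denom_t:
  "k * real n powr (1 + 1 / real b) * (k * real n powr (1 / real b)) powr g *
     (k powr (real b / (real b - 1))) powr (real c - g - 3) * \<delta> =
   \<delta> * (\<kappa> powr (real c - 1) * \<rho> powr (real b + 1 + g))"
proof -
  have 1: "k * real n powr (1 + 1 / real b) = \<kappa> powr 2 * \<rho> powr (real b + 1)"
    unfolding edges_eq unfolding n_eq using pos by (simp add: powr_add powr_realpow power2_eq_square mult_ac)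
  have 2: "(k * real n powr (1 / real b)) powr g = \<kappa> powr g * \<rho> powr g"
    unfolding \<kappa>\<rho>[symmetric] using pos by (simp add: powr_mult)
  have "\<kappa> powr 2 * \<kappa> powr g * \<kappa> powr (real c - g - 3) = \<kappa> powr (real c - 1)" by (simp add: powr_add[symmetric])
  then show ?thesis unfolding 1 2 \<kappa>[symmetric] by (simp add: powr_add[of \<rho>])
qed

end

lemma (in walk_graph) M_ge: "real (card E) \<le> M"
proof -
  have fin: "finite (nbrs V E x)" for x using finV unfolding nbrs_def by auto
  have "E \<subseteq> (\<Union>x\<in>V. (\<lambda>y. {x, y}) ` nbrs V E x)"
  proof
    fix e assume e: "e \<in> E"
    then obtain x y where "e = {x, y}" "x \<in> V" "y \<in> V" using edges[OF e] by (metis card_2_iff insert_subset)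
    then show "e \<in> (\<Union>x\<in>V. (\<lambda>y. {x, y}) ` nbrs V E x)" using e unfolding nbrs_def by auto
  qed
  then have "card E \<le> card (\<Union>x\<in>V. (\<lambda>y. {x, y}) ` nbrs V E x)" using fin finV by (intro card_mono) auto
  also have "\<dots> \<le> (\<Sum>x\<in>V. card ((\<lambda>y. {x, y}) ` nbrs V E x))" by (rule card_UN_le[OF finV])
  also have "\<dots> \<le> (\<Sum>x\<in>V. card (nbrs V E x))" by (intro sum_mono card_image_le fin)
  finally show ?thesis unfolding M_def deg_def using of_nat_mono by fastforce
qed

lemma valid_set_mono: "valid_set a b V' E' \<chi> \<Longrightarrow> V' \<subseteq> V \<Longrightarrow> E' \<subseteq> E \<Longrightarrow> valid_set a b V E \<chi>"
  unfolding valid_set_def by blast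

text \<open>All denominators become a power of \<open>\<delta>\<close> times powers of
  \<open>\<kappa>\<close> and \<open>\<rho>\<close>. As
  \<open>\<delta> \<le> 1 \<le> \<kappa>, \<rho>\<close>, it suffices to compare exponents: those of
  \<open>\<rho>\<close> are \<open>2 * t - 1 + f\<close>, or \<open>2 * b\<close> for
  \<open>t = b\<close>, in \<open>D_0\<close>, and \<open>b + 1 + g\<close> in
  \<open>D_t\<close>.\<close>

lemma (in params) D'_nonforest_ge:
  fixes a t q :: nat and \<delta> :: real and \<nu> :: "theta_vertex set"
  defines "c \<equiv> card \<nu>" and "f \<equiv> card (\<nu> \<inter> F_set a b t)"
  assumes \<delta>: "0 < \<delta>" "\<delta> \<le> 1" and t: "2 \<le> t" "t \<le> b" and one: "1 \<le> \<kappa>" "1 \<le> \<rho>"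
    and nonforest: "\<not> forest (induced_edges (theta_edges a b) \<nu>)"
    and ends: "U_end \<in> \<nu>" "V_end \<in> \<nu>"
    and f: "of_bool (odd (b - t)) \<le> f"
    and q: "D' a b \<delta> k n t \<nu> = enat q"
  shows "1 \<le> q" and "k ^ (a * b) * (real n)\<^sup>2 / (\<kappa> powr real c * \<rho> powr (real b + real t + real f - of_bool (odd (b - t)))) \<le> real q"
proof -
  let ?N = "k ^ (a * b) * (real n)\<^sup>2" and ?o = "of_bool (odd (b - t)) :: real"
  let ?X = "?N / (\<kappa> powr real c * \<rho> powr (real b + real t + real f - ?o))"
  have N: "0 < ?N" using k1 n1 by simp
  have \<delta>c: "0 < \<delta> ^ c" "\<delta> ^ c \<le> 1" using \<delta> by (auto intro: power_le_one)
  have key: "\<exists>r. ceil_enat (?N / (\<delta> ^ c * (\<kappa> powr x * \<rho> powr y))) = enat r \<and> 1 \<le> r \<and> ?X \<le> real r"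
    if "x \<le> real c" "y \<le> real b + real t + real f - ?o" for x y
  proof -
    have "\<kappa> powr x * \<rho> powr y \<le> \<kappa> powr real c * \<rho> powr (real b + real t + real f - ?o)"
      using that one by (intro mult_mono powr_mono) auto
    moreover have "\<delta> ^ c * (\<kappa> powr x * \<rho> powr y) \<le> 1 * (\<kappa> powr x * \<rho> powr y)"
      using \<delta>c by (intro mult_right_mono) auto
    ultimately have "\<delta> ^ c * (\<kappa> powr x * \<rho> powr y) \<le> \<kappa> powr real c * \<rho> powr (real b + real t + real f - ?o)" by simp
    then have "?X \<le> ?N / (\<delta> ^ c * (\<kappa> powr x * \<rho> powr y))"
      using N pos \<delta>c by (intro divide_left_mono) auto
    moreover have "0 < ?N / (\<delta> ^ c * (\<kappa> powr x * \<rho> powr y))" using N pos \<delta>c by simp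
    ultimately show ?thesis using ceil_enat_pos by (meson order_trans)
  qed
  have bt: "t = b \<longrightarrow> ?o = 0" by simp
  have "\<exists>r. D_0 a b \<delta> k n t \<nu> = enat r \<and> 1 \<le> r \<and> ?X \<le> real r"
  proof (cases "t = b")
    case True
    then show ?thesis using key[of "real c" "real (2 * b)"] ends bt
      unfolding D_0_def D_0b_def denom_0b c_def by (simp add: c_def)
  next
    case False
    then have "2 * real t - 1 + real f \<le> real b + real t + real f - ?o" using t by simp
    then show ?thesis using key[of "real c" "2 * real t - 1 + real f"] ends False
      unfolding D_0_def Let_def denom_0 by (simp add: c_def f_def)
  qed
  then obtain r0 where r0: "D_0 a b \<delta> k n t \<nu> = enat r0" "1 \<le> r0" "?X \<le> real r0" by auto
  have Dt: "1 \<le> r \<and> ?X \<le> real r" if r: "D_t a b \<delta> k n t \<nu> = enat r" for r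
  proof -
    define g where "g = (if even (b - t) then real f else real f - 1)"
    have g: "g = real f - ?o" unfolding g_def by auto
    have "real b + 1 + g \<le> real b + real t + real f - ?o" unfolding g using t by simp
    then have "\<exists>r. ceil_enat (?N / (\<delta> ^ c * (\<kappa> powr (real c - 1) * \<rho> powr (real b + 1 + g)))) = enat r \<and> 1 \<le> r \<and> ?X \<le> real r"
      using key[of "real c - 1" "real b + 1 + g"] by simp
    moreover have "D_t a b \<delta> k n t \<nu> = ceil_enat (?N / (\<delta> ^ c * (\<kappa> powr (real c - 1) * \<rho> powr (real b + 1 + g))))"
      using r unfolding D_t_def Let_def denom_t g_def f_def c_def by (auto split: if_splits)
    ultimately show ?thesis using r by auto
  qed
  have min: "min (D_t a b \<delta> k n t \<nu>) (20 * (D_0 a b \<delta> k n t \<nu> + ceil_enat (ln (real n)))) = enat q"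
    using q nonforest unfolding D'_def by simp
  have "1 \<le> q \<and> ?X \<le> real q"
  proof (cases "D_t a b \<delta> k n t \<nu> \<le> 20 * (D_0 a b \<delta> k n t \<nu> + ceil_enat (ln (real n)))")
    case True
    then show ?thesis using Dt min by (simp add: min_def)
  next
    case False
    have "enat q = enat (20 * (r0 + nat \<lceil>ln (real n)\<rceil>))"
      using False min r0 unfolding ceil_enat_def by (simp add: min_def numeral_eq_enat)
    then have "r0 \<le> q" by simp
    then show ?thesis using r0 by linarith
  qed
  then show "1 \<le> q" "?X \<le> real q" by auto
qed

lemma (in params) D'_forest_ge:
  fixes a t q :: nat and \<delta> :: real and \<nu> :: "theta_vertex set"
  defines "e \<equiv> card (induced_edges (theta_edges a b) \<nu>)"
  assumes \<delta>: "0 < \<delta>" "\<delta> \<le> 1" and forest: "forest (induced_edges (theta_edges a b) \<nu>)"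
    and q: "D' a b \<delta> k n t \<nu> = enat q"
  shows "1 \<le> e" and "1 \<le> q" and "k ^ (a * b) * (real n)\<^sup>2 / (\<kappa> * \<rho> * real n * \<kappa> ^ (e - 1)) \<le> real q"
proof -
  let ?N = "k ^ (a * b) * (real n)\<^sup>2"
  let ?d = "\<delta> * (\<kappa> * \<rho> * real n) * (\<delta> * \<kappa>) ^ (e - 1)"
  have N: "0 < ?N" using k1 n1 by simp
  have D: "D_forest a b \<delta> k n \<nu> = enat q" using q forest unfolding D'_def by simp
  then show e: "1 \<le> e" using forest unfolding D_forest_def Let_def e_def by (auto split: if_splits)
  have eq: "D_forest a b \<delta> k n \<nu> = ceil_enat (?N / ?d)"
    using e forest unfolding D_forest_def Let_def \<kappa>[symmetric] edges_eq[symmetric] e_def by (simp add: mult.assoc)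
  have d: "0 < ?d" using pos \<delta> n1 by simp
  have "?d = (\<delta> * \<delta> ^ (e - 1)) * (\<kappa> * \<rho> * real n * \<kappa> ^ (e - 1))" by (simp add: power_mult_distrib)
  also have "\<dots> \<le> 1 * (\<kappa> * \<rho> * real n * \<kappa> ^ (e - 1))"
    using \<delta> pos by (intro mult_right_mono mult_le_one) (auto intro: power_le_one)
  finally have "?N / (\<kappa> * \<rho> * real n * \<kappa> ^ (e - 1)) \<le> ?N / ?d"
    using N d pos n1 by (intro divide_left_mono) auto
  then show "1 \<le> q" "?N / (\<kappa> * \<rho> * real n * \<kappa> ^ (e - 1)) \<le> real q"
    using ceil_enat_pos[of "?N / ?d"] N d D eq by auto
qed

lemma full_theta_facts:
  assumes r: "2 \<le> r" and b: "2 \<le> b"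
  shows "\<not> forest (induced_edges (theta_edges r b) (theta_verts r b))"
    and "card (theta_verts r b) = 2 + r * (b - 1)"
    and "1 \<le> t \<Longrightarrow> card (theta_verts r b \<inter> F_set r b t) = r * fcount t {t..<b}"
proof -
  have pp: "ppos b j (theta_verts r b) = {..b}" if "j \<in> {1..r}" for j
    using that unfolding ppos_def theta_verts_def path_vertex_def by auto
  show "\<not> forest (induced_edges (theta_edges r b) (theta_verts r b))"
    using two_paths_cycle[of 1 r 2 b] pp[of 1] pp[of 2] r b by simp
  have int: "{..b} \<inter> {1..<b} = {1..<b}" by auto
  show "card (theta_verts r b) = 2 + r * (b - 1)"
    using card_theta_subset[OF subset_refl, of r b] pp int by (simp add: theta_verts_def)
  assume t: "1 \<le> t"
  have "fcount t {1..<b} = fcount t {t..<b}"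
    unfolding fcount_def using t by (intro arg_cong[where f=card]) auto
  then show "card (theta_verts r b \<inter> F_set r b t) = r * fcount t {t..<b}"
    using card_F_set[OF t, of "theta_verts r b" r b] pp int by simp
qed

theorem theorem4p1:
  fixes a b :: nat
  assumes "a \<ge> 6" and "b \<ge> 3"
  shows "\<exists>(\<delta>::real) (k0::real). \<delta> > 0 \<and> k0 > 0 \<and>
    (\<forall>(n::nat) (k::real) (V :: 'v set) (E :: 'v set set).
       n \<ge> 1 \<longrightarrow> k \<ge> k0 \<longrightarrow>
       finite_simple_graph V E \<longrightarrow> card V = n \<longrightarrow>
       real (card E) = k * real n powr (1 + 1 / real b) \<longrightarrow>
       (\<exists>t H. 2 \<le> t \<and> t \<le> b \<and> G_hypergraph a b V E H \<and>
          real (card H) \<ge> 1 / real b * \<delta> * k ^ (a * b) * real n ^ 2 \<and>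
          good a b V E (D' a b \<delta> k n t) H))"
proof -
  have b2: "2 \<le> b" and a2: "2 \<le> a" using assms by auto
  define \<epsilon>0 :: real where "\<epsilon>0 = (1 / (8 * real (b\<^sup>2))) ^ b / 2"
  have \<epsilon>0: "0 < \<epsilon>0" unfolding \<epsilon>0_def using b2 by simp
  define C where "C = 16 / (\<epsilon>0 / 8)"
  \<comment> \<open>The 2 comes from \<open>M\<close>, which is only known to be at least half of
    \<open>\<kappa> * \<rho> * n\<close>.\<close>
  define Cc where "Cc = 2 * C ^ (b + a * b)"
  define v where "v = (2::real) ^ card (theta_verts a b) + 1"
  \<comment> \<open>Solving the greedy estimate for \<open>card H\<close> gives this value; capping
    at 1 makes the powers of \<open>\<delta>\<close> in the denominators raise the codegree
    bounds.\<close>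
  define \<delta> where "\<delta> = min 1 (\<epsilon>0 / 8 / (Cc * v))"
  \<comment> \<open>The second summand gives the hypothesis of \<open>exists_zigzag\<close>; the
    third keeps the loss in \<open>thJ_mass\<close> below half of the available mass
    \<open>\<epsilon>0 / 4\<close>.\<close>
  define k0 where "k0 = 1 + 8 * real (b\<^sup>2) / \<epsilon>0 + 16 * real ((a * b)\<^sup>2) * C / \<epsilon>0"
  have C: "0 < C" "0 < Cc" "0 < v" unfolding Cc_def C_def v_def using \<epsilon>0 by (auto intro: add_pos_pos)
  have \<delta>: "0 < \<delta>" "\<delta> \<le> 1" "\<delta> \<le> \<epsilon>0 / 8 / (Cc * v)" unfolding \<delta>_def using C \<epsilon>0 by auto
  have k0: "1 \<le> k0" "8 * real (b\<^sup>2) / \<epsilon>0 \<le> k0" "16 * real ((a * b)\<^sup>2) * C / \<epsilon>0 \<le> k0"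
    unfolding k0_def using \<epsilon>0 C by (auto simp: add_nonneg_nonneg simp del: of_nat_power of_nat_mult)
  have "\<exists>t H. 2 \<le> t \<and> t \<le> b \<and> G_hypergraph a b V E H \<and>
          real (card H) \<ge> 1 / real b * \<delta> * k ^ (a * b) * real n ^ 2 \<and>
          good a b V E (D' a b \<delta> k n t) H"
    if n: "1 \<le> n" and k: "k0 \<le> k" and G: "finite_simple_graph V E" and cV: "card V = n"
      and cE: "real (card E) = k * real n powr (1 + 1 / real b)"
    for n k and V :: "'v set" and E :: "'v set set"
  proof -
    define \<kappa> where "\<kappa> = k powr (real b / (real b - 1))"
    define \<rho> where "\<rho> = real n powr (1 / real b) * k powr (- 1 / (real b - 1))"
    interpret p: params b n k \<kappa> \<rho>
      by unfold_locales (use b2 n k k0 in \<open>auto simp: \<kappa>_def \<rho>_def\<close>)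
    let ?N = "k ^ (a * b) * (real n)\<^sup>2"
    have N: "0 < ?N" using p.k1 n by simp
    have finV: "finite V" using G unfolding finite_simple_graph_def by simp
    have \<kappa>k0: "k0 \<le> \<kappa>" using p.\<kappa>_ge k by simp
    have one: "1 \<le> \<kappa>" using \<kappa>k0 k0 by simp
    have one': "1 \<le> \<rho>"
      using card_edges_le_square[OF G] cE cV by (intro p.\<rho>_ge) (metis of_nat_le_iff of_nat_power)
    have cE': "real (card E) = \<kappa> * \<rho> * real n" unfolding cE by (rule p.edges_eq)
    \<comment> \<open>At this threshold the deletion costs at most half of the
      \<open>\<kappa> * \<rho> * n\<close> edges.\<close>
    obtain V' where V': "V' \<subseteq> V" "real (card E) - \<kappa> * \<rho> / 2 * real (card V) \<le> real (card (induced_edges E V'))"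
      "\<And>x. x \<in> V' \<Longrightarrow> \<kappa> * \<rho> / 2 \<le> real (card (nbrs V' (induced_edges E V') x))"
      using min_degree_subgraph[OF G, of "\<kappa> * \<rho> / 2"] p.pos by auto
    let ?E = "induced_edges E V'"
    have E': "\<kappa> * \<rho> * real n / 2 \<le> real (card ?E)" using V'(2) unfolding cE' cV by (simp add: field_simps)
    have edges: "e \<subseteq> V' \<and> card e = 2" if "e \<in> ?E" for e
      using that G unfolding induced_edges_def finite_simple_graph_def by auto
    have "0 < \<kappa> * \<rho> * real n / 2" using p.pos n by simp
    then have "?E \<noteq> {}" using E' by (metis card.empty linorder_not_le of_nat_0)
    then have V'ne: "V' \<noteq> {}" using edges by (metis card.empty ex_in_conv subset_empty zero_neq_numeral)
    interpret g: walk_graph V' ?E \<kappa> \<rho> b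
    proof
      show "finite V'" using V' finV finite_subset by auto
      have "card V' \<le> n" using card_mono[OF finV V'(1)] cV by simp
      then show "real (card V') \<le> \<kappa> * \<rho> ^ b" unfolding p.n_eq[symmetric] by simp
    qed (use V'ne edges V'(3) one one' b2 in auto)
    have M: "\<kappa> * \<rho> * real n / 2 \<le> g.M" using E' g.M_ge by linarith
    have large: "real (b\<^sup>2) * (2 / \<kappa>) \<le> \<epsilon>0 / 4"
    proof -
      have "8 * real (b\<^sup>2) / \<epsilon>0 \<le> \<kappa>" using k0 \<kappa>k0 by linarith
      then show ?thesis using \<epsilon>0 p.pos by (simp add: field_simps)
    qed
    obtain t Ys Zs where zz: "zigzag V' ?E \<kappa> \<rho> b t Ys Zs (\<epsilon>0 / 8)"
      and mass: "\<epsilon>0 / 4 \<le> (\<Sum>f\<in>{f\<in>FS V' t. zigzag.adm V' ?E \<kappa> \<rho> t Ys Zs f}. g.W t f)"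
      by (rule g.exists_zigzag[folded \<epsilon>0_def, OF large])
    interpret z: zigzag V' ?E \<kappa> \<rho> b t Ys Zs "\<epsilon>0 / 8" by (rule zz)
    have C1: "z.C1 = C" unfolding z.C1_def C_def ..
    have mass': "\<epsilon>0 / 8 \<le> (\<Sum>x\<in>z.thJ a. z.tm a x)"
    proof -
      have "16 * real ((a * b)\<^sup>2) * C / \<epsilon>0 \<le> \<kappa>" using k0 \<kappa>k0 by linarith
      then have "2 * real ((a * b)\<^sup>2) * (C / \<kappa>) \<le> \<epsilon>0 / 8" using \<epsilon>0 p.pos by (simp add: field_simps)
      then show ?thesis using z.thJ_mass[of a] a2 mass unfolding z.zw_mass z.C1(3) C1 by linarith
    qed
    let ?B = "Cc / ?N"
    have cancel: "Cc / y * (y / x) = Cc * (1 / x)" if "0 < y" for x y using that by simp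
    have nonforest_bound: "(\<Sum>x\<in>{x\<in>z.thJ a. \<chi> \<subseteq> z.hyp a x}. z.tm a x) \<le>
        ?B * (?N / (\<kappa> powr real (card (fst ` \<chi>)) *
           \<rho> powr (real b + real t + real (card (fst ` \<chi> \<inter> F_set a b t)) - of_bool (odd (b - t)))))"
      if \<chi>: "valid_set a b V E \<chi>" and nf: "\<not> forest (induced_edges (theta_edges a b) (fst ` \<chi>))" for \<chi>
    proof -
      let ?c = "card (fst ` \<chi>)" and ?f = "card (fst ` \<chi> \<inter> F_set a b t)" and ?o = "of_bool (odd (b - t)) :: real"
      have c: "2 \<le> ?c" using z.theta_nonforest_spread(4)[OF \<chi> finV nf] b2 by linarith
      have K: "\<kappa> ^ (?c - 2) = \<kappa> powr (real ?c - 2)"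
        using p.pos c by (simp add: powr_realpow[symmetric] of_nat_diff)
      have R: "\<rho> ^ (t - 1 + ?f) = \<rho> powr (real t - 1 + real ?f)"
        using p.pos z.t2 by (simp add: powr_realpow[symmetric] of_nat_diff algebra_simps)
      have O: "\<rho> ^ of_bool (odd (b - t)) = \<rho> powr ?o" using p.pos by auto
      have n2: "\<kappa> * \<rho> * real n = \<kappa> powr 2 * \<rho> powr (real b + 1)"
        unfolding p.n_eq using p.pos by (simp add: powr_add powr_realpow power2_eq_square mult_ac)
      have "(\<Sum>x\<in>{x\<in>z.thJ a. \<chi> \<subseteq> z.hyp a x}. z.tm a x) \<le>
        1 / g.M * C ^ (b + a * b) * \<rho> powr ?o / (\<kappa> powr (real ?c - 2) * \<rho> powr (real t - 1 + real ?f))"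
        using z.theta_nonforest_spread(1)[OF \<chi> finV nf] unfolding C1 K R O .
      also have "\<dots> \<le> 1 / (\<kappa> * \<rho> * real n / 2) * C ^ (b + a * b) * \<rho> powr ?o / (\<kappa> powr (real ?c - 2) * \<rho> powr (real t - 1 + real ?f))"
        using M p.pos n C g.M_pos by (intro divide_right_mono mult_right_mono divide_left_mono) auto
      also have "\<dots> = Cc * (\<rho> powr ?o / ((\<kappa> powr 2 * \<kappa> powr (real ?c - 2)) * (\<rho> powr (real b + 1) * \<rho> powr (real t - 1 + real ?f))))"
        unfolding n2 Cc_def by (simp add: field_simps)
      also have "\<rho> powr ?o / ((\<kappa> powr 2 * \<kappa> powr (real ?c - 2)) * (\<rho> powr (real b + 1) * \<rho> powr (real t - 1 + real ?f))) =
        1 / (\<kappa> powr real ?c * \<rho> powr (real b + real t + real ?f - ?o))"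
        using p.pos by (simp add: powr_add[symmetric] powr_diff add_ac)
      finally show ?thesis unfolding cancel[OF N] .
    qed
    obtain H where H: "G_hypergraph a b V E H" "good a b V E (D' a b \<delta> k n t) H"
      "(\<Sum>x\<in>z.thJ a. z.tm a x) \<le> real (card H) * ?B * (2 ^ card (theta_verts a b) + 1)"
    proof (rule greedy_good_hypergraph[of "z.thJ a" "z.tm a" V ?B a b E "z.hyp a" "D' a b \<delta> k n t"])
      show "finite (z.thJ a)" unfolding z.thJ_def using z.finite_thI by auto
      show "0 \<le> z.tm a x" if "x \<in> z.thJ a" for x using that z.tm_nonneg unfolding z.thJ_def by auto
      show "finite V" by (rule finV)
      show "0 \<le> ?B" using C N by simp
      show valid: "valid_set a b V E (z.hyp a x) \<and> card (z.hyp a x) = card (theta_verts a b)" if "x \<in> z.thJ a" for x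
        using z.hyp_valid[OF that] a2 valid_set_mono[OF _ V'(1), of a b ?E _ E] by (auto simp: induced_edges_def)
      show "(\<Sum>x'\<in>{x'\<in>z.thJ a. z.hyp a x \<subseteq> z.hyp a x'}. z.tm a x') \<le> ?B" if x: "x \<in> z.thJ a" for x
      proof -
        have fs: "fst ` z.hyp a x = theta_verts a b" unfolding z.hyp_def by force
        \<comment> \<open>For a whole copy of the theta graph the exponent of
          \<open>\<kappa>\<close> is the one in the total count, and that of \<open>\<rho>\<close>
          is at least \<open>2 * b\<close>: two paths already supply \<open>b - t\<close>, rounded
          up to an even number, cheap positions. So no copy carries more than
          \<open>?B\<close>.\<close>
        let ?f = "a * fcount t {t..<b}"
        have par: "b - t + of_bool (odd (b - t)) = 2 * fcount t {t..<b}" by (rule parity_counts(2)[OF z.tb])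
        have "2 * fcount t {t..<b} \<le> ?f" using a2 by (intro mult_right_mono) auto
        then have "b + of_bool (odd (b - t)) \<le> t + ?f" using par z.tb by linarith
        then have "real (b + of_bool (odd (b - t))) \<le> real (t + ?f)" by (rule of_nat_mono)
        then have ex: "real (2 * b) \<le> real b + real t + real ?f - of_bool (odd (b - t))" by simp
        have "?N = \<kappa> powr real (2 + a * (b - 1)) * \<rho> powr real (2 * b)"
          unfolding p.count_eq using p.pos by (simp only: powr_realpow)
        also have "\<dots> \<le> \<kappa> powr real (2 + a * (b - 1)) * \<rho> powr (real b + real t + real ?f - of_bool (odd (b - t)))"
          using ex one' by (intro mult_left_mono powr_mono) auto
        finally have "?N / (\<kappa> powr real (2 + a * (b - 1)) * \<rho> powr (real b + real t + real ?f - of_bool (odd (b - t)))) \<le> 1"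
          using p.pos by simp
        then have "?B * (?N / (\<kappa> powr real (2 + a * (b - 1)) * \<rho> powr (real b + real t + real ?f - of_bool (odd (b - t))))) \<le> ?B * 1"
          using C N by (intro mult_left_mono) auto
        moreover have "card (theta_verts a b \<inter> F_set a b t) = ?f"
          using z.t2 by (intro full_theta_facts(3)[OF a2 b2]) simp
        ultimately show ?thesis
          using nonforest_bound[of "z.hyp a x"] valid[OF x] full_theta_facts(1,2)[OF a2 b2] unfolding fs by simp
      qed
      show "1 \<le> q \<and> (\<Sum>x\<in>{x\<in>z.thJ a. \<chi> \<subseteq> z.hyp a x}. z.tm a x) \<le> ?B * real q"
        if \<chi>: "valid_set a b V E \<chi>" and q: "D' a b \<delta> k n t (fst ` \<chi>) = enat q" for \<chi> q
      proof (cases "forest (induced_edges (theta_edges a b) (fst ` \<chi>))")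
        case True
        let ?e = "card (induced_edges (theta_edges a b) (fst ` \<chi>))"
        note ge = p.D'_forest_ge[OF \<delta>(1,2) True q]
        have "(\<Sum>x\<in>{x\<in>z.thJ a. \<chi> \<subseteq> z.hyp a x}. z.tm a x) \<le> 1 / g.M * C ^ (b + a * b) / \<kappa> ^ (?e - 1)"
          using z.theta_forest_spread[OF \<chi> finV True ge(1)] unfolding C1 .
        also have "\<dots> \<le> 1 / (\<kappa> * \<rho> * real n / 2) * C ^ (b + a * b) / \<kappa> ^ (?e - 1)"
          using M p.pos n C g.M_pos by (intro divide_right_mono mult_right_mono divide_left_mono) auto
        also have "\<dots> = ?B * (?N / (\<kappa> * \<rho> * real n * \<kappa> ^ (?e - 1)))"
          unfolding cancel[OF N] by (simp add: Cc_def)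
        also have "\<dots> \<le> ?B * real q" using ge(3) C N by (intro mult_left_mono) auto
        finally show ?thesis using ge(2) by simp
      next
        case False
        note sp = z.theta_nonforest_spread(2,3,5)[OF \<chi> finV False]
        note ge = p.D'_nonforest_ge[OF \<delta>(1,2) z.t2 z.tb one one' False sp q]
        note nonforest_bound[OF \<chi> False]
        also have "?B * (?N / (\<kappa> powr real (card (fst ` \<chi>)) *
           \<rho> powr (real b + real t + real (card (fst ` \<chi> \<inter> F_set a b t)) - of_bool (odd (b - t))))) \<le> ?B * real q"
          using ge(2) C N by (intro mult_left_mono) auto
        finally show ?thesis using ge(1) by simp
      qed
    qed
    have "\<epsilon>0 / 8 \<le> real (card H) * (Cc * v) / ?N"
    proof -
      have "real (card H) * ?B * (2 ^ card (theta_verts a b) + 1) = real (card H) * (Cc * v) / ?N"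
        unfolding v_def by (simp only: times_divide_eq_right times_divide_eq_left mult.assoc)
      then show ?thesis using mass' H(3) by linarith
    qed
    then have "\<epsilon>0 / 8 / (Cc * v) * ?N \<le> real (card H)" using C N by (simp add: field_simps)
    moreover have "\<delta> * ?N \<le> \<epsilon>0 / 8 / (Cc * v) * ?N" using \<delta> N by (intro mult_right_mono) auto
    moreover have "1 / real b * (\<delta> * ?N) \<le> 1 * (\<delta> * ?N)"
      using \<delta> N b2 by (intro mult_right_mono) auto
    ultimately have "1 / real b * \<delta> * k ^ (a * b) * (real n)\<^sup>2 \<le> real (card H)" by (simp add: mult.assoc)
    then show ?thesis using H z.t2 z.tb by blast
  qed
  then show ?thesis using \<delta> k0 by (intro exI[of _ \<delta>] exI[of _ k0]) auto
qed

end
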